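(* Every compact composition operator on $H^2_{\bf ball}$ is similar to a contraction. That is, if $\varphi$ is a free holomorphic self-map of $[B(\mathcal H)^n]_1$ such that $C_\varphi$ is a compact operator on $H^2_{\bf ball}$, then there exist a bounded invertible operator $V$ and an operator $A$ with $\|A\|\le1$ such that $C_\varphi=V^{-1}AV$.
   Context: $n\ge1$; $\mathcal H$ is a separable infinite dimensional complex Hilbert space. $\mathbb F_n^+$ is the free semigroup with generators $g_1,\ldots,g_n$ and identity $g_0$; $|g_0|=0$, $|\alpha|=k$ if $\alpha=g_{i_1}\cdots g_{i_k}$; $X_\alpha:=X_{i_1}\cdots X_{i_k}$, $X_{g_0}:=I$. $[B(\mathcal H)^n]_1:=\{(X_1,\ldots,X_n)\in B(\mathcal H)^n:\ \|X_1X_1^*+\cdots+X_nX_n^*\|^{1/2}<1\}$. A free holomorphic function $f:[B(\mathcal H)^n]_1\to B(\mathcal H)$ is a map $f(X)=\sum_{k=0}^\infty\sum_{|\alpha|=k}a_\alpha X_\alpha$ (series over $k$ converging in operator norm) with $a_\alpha\in\mathbb C$ and $\limsup_{k\to\infty}(\sum_{|\alpha|=k}|a_\alpha|^2)^{1/2k}\le1$. A free holomorphic self-map $\varphi=(\varphi_1,\ldots,\varphi_n)$ of $[B(\mathcal H)^n]_1$ has each $\varphi_i$ free holomorphic and maps $[B(\mathcal H)^n]_1$ into itself. With $\varphi_\alpha:=\varphi_{i_1}\cdots\varphi_{i_k}$, the composition is $(f\circ\varphi)(X)=\sum_{k=0}^\infty\sum_{|\alpha|=k}a_\alpha\varphi_\alpha(X)$.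 $H^2_{\bf ball}$ is the Hilbert space of free holomorphic functions $f=\sum_\alpha a_\alpha X_\alpha$ on $[B(\mathcal H)^n]_1$ with $\|f\|_2^2:=\sum_\alpha|a_\alpha|^2<\infty$. A composition operator on $H^2_{\bf ball}$ is an operator $C_\varphi f:=f\circ\varphi$ with $\varphi$ a free holomorphic self-map of $[B(\mathcal H)^n]_1$; it is always bounded. *)

theory Defs
  imports "HOL-Analysis.Analysis"
begin

class complex_hilbert_space = banach +
  fixes scaleC :: "complex \<Rightarrow> 'a \<Rightarrow> 'a"  (infixr \<open>*\<^sub>C\<close> 75)
    and cinner :: "'a \<Rightarrow> 'a \<Rightarrow> complex"
  assumes scaleR_scaleC: "r *\<^sub>R x = complex_of_real r *\<^sub>C x"
    and scaleC_add_right: "c *\<^sub>C (x + y) = c *\<^sub>C x + c *\<^sub>C y"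
    and scaleC_add_left: "(c + d) *\<^sub>C x = c *\<^sub>C x + d *\<^sub>C x"
    and scaleC_scaleC: "c *\<^sub>C d *\<^sub>C x = (c * d) *\<^sub>C x"
    and scaleC_one: "1 *\<^sub>C x = x"
    and cinner_commute: "cinner x y = cnj (cinner y x)"
    and cinner_add_left: "cinner (x + y) z = cinner x z + cinner y z"
    and cinner_scaleC_left: "cinner (c *\<^sub>C x) y = c * cinner x y"
    and cinner_self: "cinner x x = complex_of_real ((norm x)\<^sup>2)"

definition separable_inf_dim :: "'h::complex_hilbert_space itself \<Rightarrow> bool" where
  "separable_inf_dim _ \<longleftrightarrow>
     (\<exists>D::'h set. countable D \<and> closure D = UNIV) \<and>
     (\<nexists>B::'h set. finite B \<and> module.span scaleC B = UNIV)"

lemma norm_scaleC: "norm (c *\<^sub>C x) = cmod c * norm (x::'h::complex_hilbert_space)"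
proof -
  have "cinner (c *\<^sub>C x) (c *\<^sub>C x) = c * cnj (c * cinner x x)"
    by (metis cinner_commute cinner_scaleC_left)
  also have "\<dots> = (c * cnj c) * cinner x x"
    by (simp add: cinner_self)
  finally have "complex_of_real ((norm (c *\<^sub>C x))\<^sup>2) = complex_of_real ((cmod c * norm x)\<^sup>2)"
    by (simp add: cinner_self power_mult_distrib complex_norm_square[of c, symmetric])
  then have "(norm (c *\<^sub>C x))\<^sup>2 = (cmod c * norm x)\<^sup>2"
    using of_real_eq_iff by blast
  then show ?thesis
    by (simp add: power2_eq_iff_nonneg)
qed

text \<open>Elements of \<open>'h \<Rightarrow>\<^sub>L 'h\<close> are bounded and real-linear; \<open>B(H)\<close> is the subset
  of the complex-linear ones.  The norm of that type is the operator norm.\<close>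

type_synonym 'h op = "'h \<Rightarrow>\<^sub>L 'h"

definition BH :: "'h::complex_hilbert_space op set" where
  "BH = {T. \<forall>c x. blinfun_apply T (c *\<^sub>C x) = c *\<^sub>C blinfun_apply T x}"

lift_definition scale_op :: "complex \<Rightarrow> 'h::complex_hilbert_space op \<Rightarrow> 'h op"
  is "\<lambda>c T x. c *\<^sub>C T x"
proof -
  fix c :: complex and T :: "'h \<Rightarrow> 'h"
  assume T: "bounded_linear T"
  have "bounded_linear (\<lambda>x::'h. c *\<^sub>C x)"
    by (rule bounded_linear_intro[where K = "cmod c"])
      (simp_all add: scaleC_add_right scaleR_scaleC scaleC_scaleC norm_scaleC mult.commute)
  then show "bounded_linear (\<lambda>x. c *\<^sub>C T x)"
    using T by (rule bounded_linear_compose)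
qed

definition adj :: "'h::complex_hilbert_space op \<Rightarrow> 'h op" where
  "adj T = (THE S. \<forall>x y. cinner (blinfun_apply T x) y = cinner x (blinfun_apply S y))"

text \<open>The index set \<open>{1,\<dots>,n}\<close> is a finite type \<open>'n\<close>; words of the free
  semigroup are lists over \<open>'n\<close>, with the empty list as identity.\<close>

definition op_ball :: "('n::finite \<Rightarrow> 'h::complex_hilbert_space op) set" where
  "op_ball = {X. (\<forall>i. X i \<in> BH) \<and> sqrt (norm (\<Sum>i\<in>UNIV. X i o\<^sub>L adj (X i))) < 1}"

definition op_word :: "('n \<Rightarrow> 'h::complex_hilbert_space op) \<Rightarrow> 'n list \<Rightarrow> 'h op" where
  "op_word X \<alpha> = foldr (\<lambda>i T. X i o\<^sub>L T) \<alpha> id_blinfun"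

type_synonym ('n, 'h) free_fun = "('n \<Rightarrow> 'h op) \<Rightarrow> 'h op"

text \<open>Only the values of \<open>f\<close> on the ball matter here.\<close>

definition has_free_expansion ::
    "('n::finite, 'h::complex_hilbert_space) free_fun \<Rightarrow> ('n list \<Rightarrow> complex) \<Rightarrow> bool" where
  "has_free_expansion f a \<longleftrightarrow>
     limsup (\<lambda>k. ereal (root (2 * k) (\<Sum>\<alpha> | length \<alpha> = k. (cmod (a \<alpha>))\<^sup>2))) \<le> 1 \<and>
     (\<forall>X\<in>op_ball. (\<lambda>k. \<Sum>\<alpha> | length \<alpha> = k. scale_op (a \<alpha>) (op_word X \<alpha>)) sums f X)"

definition free_holomorphic :: "('n::finite, 'h::complex_hilbert_space) free_fun \<Rightarrow> bool" where
  "free_holomorphic f \<longleftrightarrow> (\<exists>a. has_free_expansion f a)"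

definition free_self_map ::
    "(('n::finite \<Rightarrow> 'h::complex_hilbert_space op) \<Rightarrow> ('n \<Rightarrow> 'h op)) \<Rightarrow> bool" where
  "free_self_map \<phi> \<longleftrightarrow>
     (\<forall>i. free_holomorphic (\<lambda>X. \<phi> X i)) \<and> (\<forall>X\<in>op_ball. \<phi> X \<in> op_ball)"

text \<open>The coefficients are unique when \<open>'h\<close> is infinite dimensional.\<close>

definition free_coeff ::
    "('n::finite, 'h::complex_hilbert_space) free_fun \<Rightarrow> 'n list \<Rightarrow> complex" where
  "free_coeff f = (THE a. has_free_expansion f a)"

text \<open>Functions on the ball are represented by total functions vanishing outside it, so that
  the vector space operations of \<open>H2_ball\<close> are pointwise.\<close>

definition H2_ball :: "('n::finite, 'h::complex_hilbert_space) free_fun set" where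
  "H2_ball = {f. free_holomorphic f \<and> (\<lambda>\<alpha>. (cmod (free_coeff f \<alpha>))\<^sup>2) summable_on UNIV \<and>
                 (\<forall>X. X \<notin> op_ball \<longrightarrow> f X = 0)}"

definition H2_norm :: "('n::finite, 'h::complex_hilbert_space) free_fun \<Rightarrow> real" where
  "H2_norm f = sqrt (\<Sum>\<^sub>\<infinity>\<alpha>. (cmod (free_coeff f \<alpha>))\<^sup>2)"

definition H2_topology :: "('n::finite, 'h::complex_hilbert_space) free_fun topology" where
  "H2_topology = Metric_space.mtopology H2_ball (\<lambda>f g. H2_norm (\<lambda>X. f X - g X))"

definition H2_linear ::
    "(('n::finite, 'h::complex_hilbert_space) free_fun \<Rightarrow> ('n, 'h) free_fun) \<Rightarrow> bool" where
  "H2_linear T \<longleftrightarrow>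
     (\<forall>f\<in>H2_ball. T f \<in> H2_ball) \<and>
     (\<forall>f\<in>H2_ball. \<forall>g\<in>H2_ball. T (\<lambda>X. f X + g X) = (\<lambda>X. T f X + T g X)) \<and>
     (\<forall>c. \<forall>f\<in>H2_ball. T (\<lambda>X. scale_op c (f X)) = (\<lambda>X. scale_op c (T f X)))"

definition H2_bounded ::
    "(('n::finite, 'h::complex_hilbert_space) free_fun \<Rightarrow> ('n, 'h) free_fun) \<Rightarrow> bool" where
  "H2_bounded T \<longleftrightarrow> H2_linear T \<and> (\<exists>K. \<forall>f\<in>H2_ball. H2_norm (T f) \<le> K * H2_norm f)"

definition H2_onorm ::
    "(('n::finite, 'h::complex_hilbert_space) free_fun \<Rightarrow> ('n, 'h) free_fun) \<Rightarrow> real" where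
  "H2_onorm T = (SUP f\<in>{f \<in> H2_ball. H2_norm f \<le> 1}. H2_norm (T f))"

definition H2_invertible ::
    "(('n::finite, 'h::complex_hilbert_space) free_fun \<Rightarrow> ('n, 'h) free_fun) \<Rightarrow> bool" where
  "H2_invertible V \<longleftrightarrow>
     H2_bounded V \<and> bij_betw V H2_ball H2_ball \<and> H2_bounded (inv_into H2_ball V)"

definition H2_compact ::
    "(('n::finite, 'h::complex_hilbert_space) free_fun \<Rightarrow> ('n, 'h) free_fun) \<Rightarrow> bool" where
  "H2_compact T \<longleftrightarrow>
     H2_linear T \<and>
     compactin H2_topology (H2_topology closure_of (T ` {f \<in> H2_ball. H2_norm f \<le> 1}))"

text \<open>For \<open>X\<close> in the ball, \<open>\<phi> X\<close> is again in the ball, so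
  \<open>f (\<phi> X)\<close> is the sum of the series
  \<open>\<Sum>\<^sub>k \<Sum>\<^bsub>length \<alpha> = k\<^esub> a\<^sub>\<alpha> op_word (\<phi> X) \<alpha>\<close>, and
  \<open>op_word (\<phi> X) \<alpha>\<close> is \<open>\<phi>\<^sub>\<alpha>(X)\<close>.\<close>

definition comp_op ::
    "(('n::finite \<Rightarrow> 'h::complex_hilbert_space op) \<Rightarrow> ('n \<Rightarrow> 'h op)) \<Rightarrow>
     ('n, 'h) free_fun \<Rightarrow> ('n, 'h) free_fun" where
  "comp_op \<phi> f = (\<lambda>X. if X \<in> op_ball then f (\<phi> X) else 0)"

end

theory Submission
  imports Defs
begin

text \<open>
  Write \<open>T = C\<^sub>\<phi>\<close>. Compactness of \<open>T\<close>, tested on normalised kernel functions, forces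
  \<open>\<bar>\<phi>(z)\<bar> < \<bar>z\<bar>\<close> on some sphere of scalar points in \<open>\<complex>\<^sup>n\<close>, so by Brouwer \<open>\<phi>\<close> has a
  scalar fixed point \<open>\<xi>\<close>. Let \<open>V\<close> be right multiplication by the kernel function
  \<open>k\<^sub>\<xi>\<close>, whose inverse is right multiplication by \<open>1 - \<Sum>\<^sub>i cnj \<xi>\<^sub>i X\<^sub>i\<close>, and
  \<open>A = V T V\<inverse>\<close>. For \<open>F = c + \<Sum>\<^sub>i X\<^sub>i F\<^sub>i\<close> one has
  \<open>A F - c k\<^sub>\<xi> = \<Sum>\<^sub>i \<phi>\<^sub>i (A F\<^sub>i - c (cnj \<xi>\<^sub>i) k\<^sub>\<xi>)\<close>. As \<open>\<phi>\<close> is a row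
  contraction and \<open>\<phi>(\<xi>) = \<xi>\<close>, the reproducing property at \<open>\<xi>\<close> turns this into
  \<open>\<parallel>A F\<parallel>\<^sup>2 \<le> \<bar>c\<bar>\<^sup>2 + \<Sum>\<^sub>i \<parallel>A F\<^sub>i\<parallel>\<^sup>2\<close>, and induction on the degree makes \<open>A\<close>
  a contraction on polynomials, hence everywhere. For \<open>\<xi> = 0\<close> this is Littlewood's
  subordination argument.
\<close>

section \<open>Operators on a complex Hilbert space\<close>

text \<open>Littlewood's argument rests on the fixed point being 0: constants are then fixed by
  \<open>T\<close> and orthogonal to every combination \<Sum> \<phi>_i f_i. For \<xi> \<noteq> 0
  this orthogonality is lost. The conjugation that repairs it has to be a right multiplication:
  substitution respects left factors, so A F = F(\<phi>) q with one fixed right factor q = A 1, and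
  A (X_i F) = \<phi>_i (A F) survives. The choice of k_\<xi> makes the defect |k_\<xi>|^2 -
  |\<xi>|^2 |k_\<xi>|^2 equal to 1, so the recursive inequality has constant exactly 1 and can be
  iterated over the degree without loss.

  Operators and coefficients are linked by evaluation at truncated creation operators scaled by r <
  1: applied to the vacuum vector, a free series becomes a finite orthonormal sum with coefficients
  a_\<alpha> r^|\<alpha>|. Operator inequalities on the ball thus become inequalities in l^2 as r
  tends to 1. The infinite dimension of the Hilbert space supplies the orthonormal vectors.\<close>

interpretation cvs: vector_space "scaleC :: complex \<Rightarrow> 'h \<Rightarrow> 'h::complex_hilbert_space"
  by unfold_locales (simp_all add: scaleC_add_right scaleC_add_left scaleC_scaleC scaleC_one)

lemma cinner_add_right: "cinner x (y + z) = cinner x y + cinner x z"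
  by (metis cinner_add_left cinner_commute complex_cnj_add)

lemma cinner_scaleC_right: "cinner x (c *\<^sub>C y) = cnj c * cinner x y"
  by (metis cinner_scaleC_left cinner_commute complex_cnj_mult)

lemma norm_add_sq: "(norm (x + y))\<^sup>2 = (norm x)\<^sup>2 + 2 * Re (cinner x y) + (norm y)\<^sup>2"
  for x y :: "'h::complex_hilbert_space"
proof -
  have "complex_of_real ((norm (x + y))\<^sup>2)
      = cinner x x + (cinner x y + cnj (cinner x y)) + cinner y y"
    by (simp only: cinner_self[symmetric] cinner_add_left cinner_add_right
        cinner_commute[of y x] ac_simps)
  also have "\<dots> = complex_of_real ((norm x)\<^sup>2 + 2 * Re (cinner x y) + (norm y)\<^sup>2)"
    by (simp only: cinner_self complex_add_cnj of_real_add)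
  finally show ?thesis
    using of_real_eq_iff by blast
qed

lemma Re_cinner_le: "Re (cinner x y) \<le> norm x * norm y"
  for x y :: "'h::complex_hilbert_space"
proof -
  have "(norm (x + y))\<^sup>2 \<le> (norm x + norm y)\<^sup>2"
    by (simp add: norm_triangle_ineq power_mono)
  then show ?thesis
    by (simp add: norm_add_sq power2_sum)
qed

lemma cinner_Cauchy_Schwarz: "cmod (cinner x y) \<le> norm x * norm y"
  for x y :: "'h::complex_hilbert_space"
proof (cases "cinner x y = 0")
  case False
  define c where "c = cnj (cinner x y) / complex_of_real (cmod (cinner x y))"
  have "c * cinner x y = complex_of_real (cmod (cinner x y))"
    using False complex_norm_square[of "cinner x y"]
    by (simp add: c_def power2_eq_square divide_simps mult.commute)
  then have "cmod (cinner x y) = Re (cinner (c *\<^sub>C x) y)"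
    by (simp add: cinner_scaleC_left)
  also have "\<dots> \<le> norm (c *\<^sub>C x) * norm y"
    by (rule Re_cinner_le)
  also have "norm (c *\<^sub>C x) = norm x"
    using False by (simp add: norm_scaleC c_def norm_divide)
  finally show ?thesis .
qed simp

interpretation cinner: bounded_bilinear
  "cinner :: 'h::complex_hilbert_space \<Rightarrow> 'h \<Rightarrow> complex"
proof
  show "\<exists>K. \<forall>a b::'h. norm (cinner a b) \<le> norm a * norm b * K"
    using cinner_Cauchy_Schwarz by (metis mult.right_neutral)
qed (simp_all add: cinner_add_left cinner_add_right scaleR_scaleC cinner_scaleC_left
    cinner_scaleC_right scaleR_conv_of_real)

lemma cinner_right_eqI:
  assumes "\<And>x. cinner x u = cinner x v"
  shows "u = (v::'h::complex_hilbert_space)"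
proof -
  have "cinner (u - v) (u - v) = 0"
    using assms by (simp add: cinner.diff_right)
  then show ?thesis
    by (simp add: cinner_self)
qed

text \<open>The representing vector is the minimiser of \<open>J\<close>, because |x|^2 - 2 Re f(x)
  would equal |x - y|^2 - |y|^2 if y represented f. Completeness gives the minimiser, and the
  vanishing first variation identifies f.\<close>

lemma Riesz_representation:
  fixes f :: "'h::complex_hilbert_space \<Rightarrow> complex"
  assumes f: "bounded_linear f" and fc: "\<And>c x. f (c *\<^sub>C x) = c * f x"
  shows "\<exists>y. \<forall>x. f x = cinner x y"
proof -
  interpret f: bounded_linear f by (rule f)
  define J where "J x = (norm x)\<^sup>2 - 2 * Re (f x)" for x
  obtain B where B: "\<And>x. norm (f x) \<le> norm x * B"
    using f.bounded by blast
  have J_lower: "J x \<ge> - (B\<^sup>2)" for x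
  proof -
    have "Re (f x) \<le> norm x * B"
      using B complex_Re_le_cmod order_trans by blast
    moreover have "0 \<le> (norm x - B)\<^sup>2"
      by simp
    ultimately show ?thesis
      by (simp add: J_def power2_diff)
  qed
  define m where "m = Inf (range J)"
  have bdd: "bdd_below (range J)"
    using J_lower by (auto intro!: bdd_belowI[where m = "- (B\<^sup>2)"])
  have m_le: "m \<le> J x" for x
    unfolding m_def by (rule cInf_lower[OF _ bdd]) simp
  have "\<exists>x. J x < m + 1 / (real n + 1)" for n
    using cInf_lessD[of "range J" "m + 1 / (real n + 1)"] unfolding m_def[symmetric] by auto
  then obtain s where s: "\<And>n. J (s n) < m + 1 / (real n + 1)"
    by metis
  \<comment> \<open>Parallelogram law: the midpoint of x and y cannot push \<open>J\<close> below
    its infimum, so near-minimisers are close to each other.\<close>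
  have para: "(norm (x - y))\<^sup>2 \<le> 2 * (J x - m) + 2 * (J y - m)" for x y
  proof -
    have "f (x + y) = 2 * f ((1/2) *\<^sub>R (x + y))"
      by (simp add: f.scaleR scaleR_conv_of_real)
    then have "4 * J ((1/2) *\<^sub>R (x + y)) = (norm (x + y))\<^sup>2 - 4 * Re (f (x + y))"
      by (simp add: J_def power_divide)
    moreover have "4 * m \<le> 4 * J ((1/2) *\<^sub>R (x + y))"
      using m_le[of "(1/2) *\<^sub>R (x + y)"] by simp
    moreover have "(norm (x - y))\<^sup>2 = (norm x)\<^sup>2 - 2 * Re (cinner x y) + (norm y)\<^sup>2"
      using norm_add_sq[of x "- y"] by (simp add: cinner.minus_right)
    ultimately show ?thesis
      by (simp add: J_def norm_add_sq f.add)
  qed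
  have "Cauchy s"
  proof (rule metric_CauchyI)
    fix e :: real assume e: "e > 0"
    obtain N where N: "4 / (real N + 1) < e\<^sup>2"
    proof -
      obtain N where "4 / e\<^sup>2 < real N"
        using reals_Archimedean2 by blast
      then have "4 < e\<^sup>2 * (real N + 1)"
        using e by (simp add: field_simps)
          (metis add_strict_increasing2 less_eq_real_def mult.commute zero_le_power2)
      then show thesis
        by (intro that[of N]) (simp add: field_simps)
    qed
    have small: "J (s n) - m \<le> 1 / (real N + 1)" if "n \<ge> N" for n
    proof -
      have "1 / (real n + 1) \<le> 1 / (real N + 1)"
        using that by (simp add: field_simps)
      then show ?thesis
        using s[of n] by linarith
    qed
    have "dist (s i) (s j) < e" if "i \<ge> N" "j \<ge> N" for i j
    proof -
      have "(norm (s i - s j))\<^sup>2 \<le> 2 * (J (s i) - m) + 2 * (J (s j) - m)"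
        by (rule para)
      also have "\<dots> \<le> 2 * (1 / (real N + 1)) + 2 * (1 / (real N + 1))"
        by (intro add_mono mult_left_mono small that) auto
      also have "\<dots> < e\<^sup>2"
        using N by simp
      finally have "(norm (s i - s j))\<^sup>2 < e\<^sup>2" .
      then show ?thesis
        using e by (simp add: dist_norm power_less_imp_less_base)
    qed
    then show "\<exists>M. \<forall>i\<ge>M. \<forall>j\<ge>M. dist (s i) (s j) < e"
      by blast
  qed
  then obtain y where y: "s \<longlonglongrightarrow> y"
    using Cauchy_convergent convergent_def by blast
  have "(\<lambda>n. J (s n)) \<longlonglongrightarrow> J y"
    unfolding J_def by (intro tendsto_intros f.tendsto y)
  moreover have "(\<lambda>n. m + 1 / (real n + 1)) \<longlonglongrightarrow> m + 0"
    using LIMSEQ_inverse_real_of_nat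
    by (intro tendsto_add tendsto_const) (simp add: inverse_eq_divide add.commute)
  ultimately have Jy: "J y \<le> m"
    using s by (simp add: LIMSEQ_le less_imp_le)
  have "Re (f h) = Re (cinner h y)" for h
  proof -
    define D where "D = Re (cinner h y) - Re (f h)"
    have ge: "0 \<le> t\<^sup>2 * (norm h)\<^sup>2 + 2 * t * D" for t
    proof -
      have "J y \<le> J (t *\<^sub>R h + y)"
        using Jy m_le order_trans by blast
      then show ?thesis
        by (simp add: J_def norm_add_sq f.add f.scaleR cinner.scaleR_left D_def
            power_mult_distrib) (simp add: algebra_simps)
    qed
    have "D = 0"
    proof (rule ccontr)
      assume "D \<noteq> 0"
      \<comment> \<open>This minimises t^2 (|h|^2 + 1) + 2 t D; the added 1 keeps the denominator
        positive when h = 0.\<close>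
      define t where "t = - D / ((norm h)\<^sup>2 + 1)"
      have pos: "(norm h)\<^sup>2 + 1 > 0"
        by (smt (verit) zero_le_power2)
      have "t\<^sup>2 * (norm h)\<^sup>2 + 2 * t * D \<le> t\<^sup>2 * ((norm h)\<^sup>2 + 1) + 2 * t * D"
        by (simp add: algebra_simps)
      also have "\<dots> = - (D\<^sup>2 / ((norm h)\<^sup>2 + 1))"
        using pos by (simp add: t_def power2_eq_square divide_simps)
      also have "\<dots> < 0"
        using pos \<open>D \<noteq> 0\<close> by simp
      finally show False
        using ge[of t] by linarith
    qed
    then show ?thesis
      by (simp add: D_def)
  qed
  then have Re_eq: "Re (f h) = Re (cinner h y)" for h .
  \<comment> \<open>The real part at \<i> x is minus the imaginary part at x, so the two real
    identities give the complex one.\<close>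
  have "f x = cinner x y" for x
    using Re_eq[of x] Re_eq[of "\<i> *\<^sub>C x"]
    by (simp add: fc cinner_scaleC_left complex_eq_iff)
  then show ?thesis
    by blast
qed

section \<open>Adjoints, and a description of the ball without them\<close>

lemma BH_D: "T \<in> BH \<Longrightarrow> blinfun_apply T (c *\<^sub>C x) = c *\<^sub>C blinfun_apply T x"
  by (simp add: BH_def)

lemma adj_exists:
  fixes T :: "'h::complex_hilbert_space op"
  assumes T: "T \<in> BH"
  shows "\<exists>S::'h op. \<forall>x y. cinner (blinfun_apply T x) y = cinner x (blinfun_apply S y)"
proof -
  have "\<exists>z. \<forall>x. cinner (blinfun_apply T x) y = cinner x z" for y
    by (rule Riesz_representation)
      (simp_all add: BH_D[OF T] cinner_scaleC_left bounded_linear_compose[OF cinner.bounded_linear_left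
        blinfun.bounded_linear_right])
  then obtain g where g: "\<And>x y. cinner (blinfun_apply T x) y = cinner x (g y)"
    by metis
  have "bounded_linear g"
  proof (rule bounded_linear_intro[where K = "norm T"])
    show "g (x + y) = g x + g y" for x y
      by (rule cinner_right_eqI) (simp add: g[symmetric] cinner_add_right)
    show "g (r *\<^sub>R x) = r *\<^sub>R g x" for r x
      by (rule cinner_right_eqI) (simp add: g[symmetric] cinner.scaleR_right)
    show "norm (g y) \<le> norm y * norm T" for y
    proof -
      have "(norm (g y))\<^sup>2 = cmod (cinner (g y) (g y))"
        by (simp add: cinner_self norm_power)
      also have "\<dots> = cmod (cinner (blinfun_apply T (g y)) y)"
        by (simp add: g)
      also have "\<dots> \<le> norm (blinfun_apply T (g y)) * norm y"
        by (rule cinner_Cauchy_Schwarz)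
      also have "\<dots> \<le> norm T * norm (g y) * norm y"
        by (intro mult_right_mono norm_blinfun norm_ge_zero)
      finally have "norm (g y) * norm (g y) \<le> norm (g y) * (norm y * norm T)"
        by (simp add: power2_eq_square mult_ac)
      then show ?thesis
        by (cases "g y = 0") auto
    qed
  qed
  then show ?thesis
    using g by (intro exI[of _ "Blinfun g"]) (simp add: bounded_linear_Blinfun_apply)
qed

lemma adj_unique:
  assumes "\<And>x y. cinner (blinfun_apply T x) y = cinner x (blinfun_apply S y)"
  shows "adj T = S"
  unfolding adj_def
proof (rule the_equality)
  show "\<forall>x y. cinner (blinfun_apply T x) y = cinner x (blinfun_apply S y)"
    using assms by blast
  show "S' = S" if "\<forall>x y. cinner (blinfun_apply T x) y = cinner x (blinfun_apply S' y)" for S'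
    using that assms by (intro blinfun_eqI cinner_right_eqI) metis
qed

lemma cinner_adj:
  assumes "T \<in> BH"
  shows "cinner (blinfun_apply T x) y = cinner x (blinfun_apply (adj T) y)"
  using adj_exists[OF assms] adj_unique by metis

lemma sum_norm_adj_sq:
  fixes X :: "'n::finite \<Rightarrow> 'h::complex_hilbert_space op"
  assumes "\<And>i. X i \<in> BH"
  shows "complex_of_real (\<Sum>i\<in>UNIV. (norm (blinfun_apply (adj (X i)) u))\<^sup>2)
    = cinner (blinfun_apply (\<Sum>i\<in>UNIV. X i o\<^sub>L adj (X i)) u) u"
  by (simp add: blinfun.sum_left cinner.sum_left cinner_adj[OF assms] cinner_self)

text \<open>With u the image of the row, |u|^2 is the sum of the inner products of h_i with the
  adjoint images of u. Cauchy-Schwarz bounds its square by S Q, and Q = <P u, u> is at most |P|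
  |u|^2; one factor |u|^2 then cancels.\<close>

lemma row_bound_of_norm:
  fixes X :: "'n::finite \<Rightarrow> 'h::complex_hilbert_space op"
  assumes X: "\<And>i. X i \<in> BH"
  shows "(norm (\<Sum>i\<in>UNIV. blinfun_apply (X i) (h i)))\<^sup>2
    \<le> norm (\<Sum>i\<in>UNIV. X i o\<^sub>L adj (X i)) * (\<Sum>i\<in>UNIV. (norm (h i))\<^sup>2)"
proof -
  define P where "P = (\<Sum>i\<in>UNIV. X i o\<^sub>L adj (X i))"
  define u where "u = (\<Sum>i\<in>UNIV. blinfun_apply (X i) (h i))"
  define S where "S = (\<Sum>i\<in>UNIV. (norm (h i))\<^sup>2)"
  define Q where "Q = (\<Sum>i\<in>UNIV. (norm (blinfun_apply (adj (X i)) u))\<^sup>2)"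
  have S0: "S \<ge> 0" and Q0: "Q \<ge> 0"
    by (simp_all add: S_def Q_def sum_nonneg)
  have Q: "Q \<le> norm P * (norm u)\<^sup>2"
  proof -
    have "Q = cmod (complex_of_real Q)"
      using Q0 by simp
    also have "\<dots> = cmod (cinner (blinfun_apply P u) u)"
      unfolding Q_def P_def sum_norm_adj_sq[OF X] ..
    also have "\<dots> \<le> norm (blinfun_apply P u) * norm u"
      by (rule cinner_Cauchy_Schwarz)
    also have "\<dots> \<le> norm P * norm u * norm u"
      by (intro mult_right_mono norm_blinfun norm_ge_zero)
    finally show ?thesis
      by (simp add: power2_eq_square mult.assoc)
  qed
  have "(norm u)\<^sup>2 = cmod (cinner u u)"
    by (simp add: cinner_self norm_power)
  also have "cinner u u = (\<Sum>i\<in>UNIV. cinner (h i) (blinfun_apply (adj (X i)) u))"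
    by (subst (1) u_def) (simp add: cinner.sum_left cinner_adj[OF X])
  also have "cmod \<dots> \<le> (\<Sum>i\<in>UNIV. norm (h i) * norm (blinfun_apply (adj (X i)) u))"
    by (intro sum_norm_le cinner_Cauchy_Schwarz)
  finally have "((norm u)\<^sup>2)\<^sup>2 \<le> (\<Sum>i\<in>UNIV. norm (h i) * norm (blinfun_apply (adj (X i)) u))\<^sup>2"
    by (intro power_mono) auto
  also have "\<dots> \<le> S * Q"
    unfolding S_def Q_def by (rule Cauchy_Schwarz_ineq_sum)
  also have "\<dots> \<le> S * (norm P * (norm u)\<^sup>2)"
    using Q S0 by (intro mult_left_mono)
  finally have "(norm u)\<^sup>2 * (norm u)\<^sup>2 \<le> (norm P * S) * (norm u)\<^sup>2"
    by (simp only: power2_eq_square mult_ac)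
  then have "(norm u)\<^sup>2 \<le> norm P * S"
    using S0 by (cases "u = 0") (simp, rule mult_right_le_imp_le[where c = "(norm u)\<^sup>2"], auto)
  then show ?thesis
    unfolding u_def P_def S_def .
qed

text \<open>Feeding the row with the adjoint images of u produces P u, whose norm is then controlled
  by Q = <P u, u>.\<close>

lemma norm_le_of_row_bound:
  fixes X :: "'n::finite \<Rightarrow> 'h::complex_hilbert_space op"
  assumes X: "\<And>i. X i \<in> BH" and "c \<ge> 0"
    and bound: "\<And>h. (norm (\<Sum>i\<in>UNIV. blinfun_apply (X i) (h i)))\<^sup>2 \<le> c * (\<Sum>i\<in>UNIV. (norm (h i))\<^sup>2)"
  shows "norm (\<Sum>i\<in>UNIV. X i o\<^sub>L adj (X i)) \<le> c"
proof (rule norm_blinfun_bound[OF \<open>c \<ge> 0\<close>])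
  fix u
  define P where "P = (\<Sum>i\<in>UNIV. X i o\<^sub>L adj (X i))"
  define Q where "Q = (\<Sum>i\<in>UNIV. (norm (blinfun_apply (adj (X i)) u))\<^sup>2)"
  have "Q = cmod (complex_of_real Q)"
    by (simp only: norm_of_real) (simp add: Q_def sum_nonneg)
  also have "\<dots> = cmod (cinner (blinfun_apply P u) u)"
    unfolding Q_def P_def sum_norm_adj_sq[OF X] ..
  also have "\<dots> \<le> norm (blinfun_apply P u) * norm u"
    by (rule cinner_Cauchy_Schwarz)
  finally have Q: "Q \<le> norm (blinfun_apply P u) * norm u" .
  have "(norm (blinfun_apply P u))\<^sup>2 \<le> c * Q"
    using bound[of "\<lambda>i. blinfun_apply (adj (X i)) u"]
    by (simp add: P_def Q_def blinfun.sum_left)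
  also have "\<dots> \<le> c * (norm (blinfun_apply P u) * norm u)"
    using Q \<open>c \<ge> 0\<close> by (rule mult_left_mono)
  finally have "norm (blinfun_apply P u) * norm (blinfun_apply P u)
      \<le> norm (blinfun_apply P u) * (c * norm u)"
    by (simp add: power2_eq_square mult_ac)
  then show "norm (blinfun_apply P u) \<le> c * norm u"
    using \<open>c \<ge> 0\<close> by (cases "blinfun_apply P u = 0") auto
qed

text \<open>The working form of the ball: a row operator of norm at most some \<rho> < 1. Adjoints
  do not occur after this point.\<close>

lemma op_ball_iff:
  fixes X :: "'n::finite \<Rightarrow> 'h::complex_hilbert_space op"
  shows "X \<in> op_ball \<longleftrightarrow> (\<forall>i. X i \<in> BH) \<and> (\<exists>\<rho>. 0 \<le> \<rho> \<and> \<rho> < 1 \<and>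
    (\<forall>h. (norm (\<Sum>i\<in>UNIV. blinfun_apply (X i) (h i)))\<^sup>2 \<le> \<rho>\<^sup>2 * (\<Sum>i\<in>UNIV. (norm (h i))\<^sup>2)))"
    (is "?L \<longleftrightarrow> ?R")
proof
  assume ?L
  then have X: "\<And>i. X i \<in> BH" and lt: "sqrt (norm (\<Sum>i\<in>UNIV. X i o\<^sub>L adj (X i))) < 1"
    by (auto simp: op_ball_def)
  then show ?R
    using row_bound_of_norm[OF X]
    by (intro conjI allI X exI[of _ "sqrt (norm (\<Sum>i\<in>UNIV. X i o\<^sub>L adj (X i)))"]) auto
next
  assume ?R
  then obtain \<rho> where X: "\<And>i. X i \<in> BH" and \<rho>: "0 \<le> \<rho>" "\<rho> < 1"
    and b: "\<And>h. (norm (\<Sum>i\<in>UNIV. blinfun_apply (X i) (h i)))\<^sup>2 \<le> \<rho>\<^sup>2 * (\<Sum>i\<in>UNIV. (norm (h i))\<^sup>2)"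
    by auto
  have "norm (\<Sum>i\<in>UNIV. X i o\<^sub>L adj (X i)) \<le> \<rho>\<^sup>2"
    by (rule norm_le_of_row_bound[OF X _ b]) simp
  then have "sqrt (norm (\<Sum>i\<in>UNIV. X i o\<^sub>L adj (X i))) \<le> \<rho>"
    using \<rho> by (simp add: real_le_lsqrt)
  then have "sqrt (norm (\<Sum>i\<in>UNIV. X i o\<^sub>L adj (X i))) < 1"
    using \<rho> by linarith
  then show ?L
    using X unfolding op_ball_def by blast
qed

section \<open>Words and truncated creation operators\<close>

lemma finite_words [simp]: "finite {\<alpha>::'n::finite list. length \<alpha> = k}"
  using finite_lists_length_eq[of "UNIV::'n set" k] by simp

lemma finite_words_less [simp]: "finite {\<alpha>::'n::finite list. length \<alpha> < k}"
  by (rule finite_subset[OF _ finite_lists_length_le[of "UNIV::'n set" k]]) auto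

lemma finite_words_le [simp]: "finite {\<alpha>::'n::finite list. length \<alpha> \<le> k}"
  using finite_lists_length_le[of "UNIV::'n set" k] by simp

lemma finite_words_bounded:
  fixes F :: "'n::finite list set"
  assumes "finite F"
  obtains d where "F \<subseteq> {\<alpha>. length \<alpha> < d}"
proof -
  obtain d where "\<forall>n\<in>length ` F. n < d"
    using assms finite_nat_set_iff_bounded by blast
  then show thesis
    by (intro that[of d]) auto
qed

lemma sum_words_Suc:
  "(\<Sum>\<alpha> | length \<alpha> = Suc k. g \<alpha>) = (\<Sum>i\<in>UNIV. \<Sum>\<beta> | length \<beta> = k. g (i # \<beta>))"
  for g :: "'n::finite list \<Rightarrow> 'a::comm_monoid_add"
proof -
  have *: "{\<alpha>::'n list. length \<alpha> = Suc k} = (\<lambda>(i, \<beta>). i # \<beta>) ` (UNIV \<times> {\<beta>. length \<beta> = k})"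
    by (auto simp: length_Suc_conv)
  show ?thesis
    unfolding * by (subst sum.reindex) (auto simp: inj_on_def sum.cartesian_product case_prod_unfold)
qed

lemma sum_words_Suc_snoc:
  "(\<Sum>\<alpha> | length \<alpha> = Suc k. g \<alpha>) = (\<Sum>\<beta> | length \<beta> = k. \<Sum>i\<in>UNIV. g (\<beta> @ [i]))"
  for g :: "'n::finite list \<Rightarrow> 'a::comm_monoid_add"
proof -
  have *: "{\<alpha>::'n list. length \<alpha> = Suc k} = (\<lambda>(\<beta>, i). \<beta> @ [i]) ` ({\<beta>. length \<beta> = k} \<times> UNIV)"
    by (auto simp: image_iff length_Suc_conv_rev)
  show ?thesis
    unfolding * by (subst sum.reindex) (auto simp: inj_on_def sum.cartesian_product case_prod_unfold)
qed

lemma sum_words_less: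
  "(\<Sum>\<alpha> | length \<alpha> < d. g \<alpha>) = (\<Sum>k<d. \<Sum>\<alpha> | length \<alpha> = k. g \<alpha>)"
  for g :: "'n::finite list \<Rightarrow> 'a::comm_monoid_add"
proof -
  have "{\<alpha>::'n list. length \<alpha> < d} = (\<Union>k<d. {\<alpha>. length \<alpha> = k})"
    by auto
  then show ?thesis
    by (simp add: sum.UNION_disjoint disjoint_iff)
qed

lemma op_word_Nil [simp]: "op_word X [] = id_blinfun"
  by (simp add: op_word_def)

lemma op_word_Cons: "op_word X (i # \<alpha>) = X i o\<^sub>L op_word X \<alpha>"
  by (simp add: op_word_def)

lemma op_word_snoc: "op_word X (\<alpha> @ [i]) = op_word X \<alpha> o\<^sub>L X i"
  by (induction \<alpha>) (auto simp: op_word_Cons intro!: blinfun_eqI)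

lemma scale_op_apply [simp]: "blinfun_apply (scale_op c T) x = c *\<^sub>C blinfun_apply T x"
  by (simp add: scale_op.rep_eq)

text \<open>The words of length k again form a row operator, the k-fold product of the given row.
  Peeling off the first letter costs one factor c.\<close>

lemma norm_word_row_le:
  fixes X :: "'n::finite \<Rightarrow> 'h::complex_hilbert_space op"
  assumes "\<And>h. (norm (\<Sum>i\<in>UNIV. blinfun_apply (X i) (h i)))\<^sup>2 \<le> c * (\<Sum>i\<in>UNIV. (norm (h i))\<^sup>2)"
    and "c \<ge> 0"
  shows "(norm (\<Sum>\<alpha> | length \<alpha> = k. blinfun_apply (op_word X \<alpha>) (h \<alpha>)))\<^sup>2
    \<le> c ^ k * (\<Sum>\<alpha> | length \<alpha> = k. (norm (h \<alpha>))\<^sup>2)"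
proof (induction k arbitrary: h)
  case (Suc k)
  let ?v = "\<lambda>i. \<Sum>\<beta> | length \<beta> = k. blinfun_apply (op_word X \<beta>) (h (i # \<beta>))"
  have "(\<Sum>\<alpha> | length \<alpha> = Suc k. blinfun_apply (op_word X \<alpha>) (h \<alpha>))
      = (\<Sum>i\<in>UNIV. blinfun_apply (X i) (?v i))"
    by (simp add: sum_words_Suc op_word_Cons blinfun.sum_right)
  then have "(norm (\<Sum>\<alpha> | length \<alpha> = Suc k. blinfun_apply (op_word X \<alpha>) (h \<alpha>)))\<^sup>2
      \<le> c * (\<Sum>i\<in>UNIV. (norm (?v i))\<^sup>2)"
    using assms(1)[of ?v] by simp
  also have "\<dots> \<le> c * (\<Sum>i\<in>UNIV. c ^ k * (\<Sum>\<beta> | length \<beta> = k. (norm (h (i # \<beta>)))\<^sup>2))"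
    using \<open>c \<ge> 0\<close> by (intro mult_left_mono sum_mono Suc.IH) auto
  also have "\<dots> = c ^ Suc k * (\<Sum>\<alpha> | length \<alpha> = Suc k. (norm (h \<alpha>))\<^sup>2)"
    by (simp add: sum_words_Suc sum_distrib_left mult.assoc)
  finally show ?case .
qed simp

section \<open>Orthonormal families indexed by words\<close>

definition orthonormal_on :: "'i set \<Rightarrow> ('i \<Rightarrow> 'h::complex_hilbert_space) \<Rightarrow> bool" where
  "orthonormal_on A e \<longleftrightarrow> (\<forall>i\<in>A. \<forall>j\<in>A. cinner (e i) (e j) = (if i = j then 1 else 0))"

lemma cinner_sum_orthonormal:
  assumes "orthonormal_on A e" "finite A" "j \<in> A"
  shows "cinner (\<Sum>i\<in>A. c i *\<^sub>C e i) (e j) = c j"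
proof -
  have "cinner (\<Sum>i\<in>A. c i *\<^sub>C e i) (e j) = (\<Sum>i\<in>A. if i = j then c i else 0)"
    using assms(1,3) unfolding cinner.sum_left
    by (intro sum.cong) (auto simp: cinner_scaleC_left orthonormal_on_def)
  then show ?thesis
    using assms by simp
qed

lemma norm_sum_orthonormal:
  assumes "orthonormal_on A e" "finite A"
  shows "(norm (\<Sum>i\<in>A. c i *\<^sub>C e i))\<^sup>2 = (\<Sum>i\<in>A. (cmod (c i))\<^sup>2)"
proof -
  have "complex_of_real ((norm (\<Sum>i\<in>A. c i *\<^sub>C e i))\<^sup>2) = (\<Sum>j\<in>A. cnj (c j) * c j)"
    unfolding cinner_self[symmetric]
    by (subst cinner.sum_right) (simp add: cinner_scaleC_right cinner_sum_orthonormal[OF assms])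
  also have "\<dots> = complex_of_real (\<Sum>i\<in>A. (cmod (c i))\<^sup>2)"
    unfolding of_real_sum by (intro sum.cong refl) (metis complex_norm_square mult.commute)
  finally show ?thesis
    using of_real_eq_iff by blast
qed

lemma Bessel_inequality:
  assumes "orthonormal_on A e" "finite A"
  shows "(\<Sum>i\<in>A. (cmod (cinner x (e i)))\<^sup>2) \<le> (norm x)\<^sup>2"
proof -
  define p where "p = (\<Sum>i\<in>A. cinner x (e i) *\<^sub>C e i)"
  have *: "cinner p (x - p) = 0"
  proof -
    have "cinner (x - p) (e j) = 0" if "j \<in> A" for j
      using cinner_sum_orthonormal[OF assms that] by (simp add: cinner.diff_left p_def)
    then have "cinner (e j) (x - p) = 0" if "j \<in> A" for j
      using that by (metis cinner_commute complex_cnj_zero)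
    then show ?thesis
      by (subst p_def) (simp add: cinner.sum_left cinner_scaleC_left)
  qed
  have "(norm x)\<^sup>2 = (norm p)\<^sup>2 + (norm (x - p))\<^sup>2"
    using norm_add_sq[of p "x - p"] * by simp
  then show ?thesis
    using norm_sum_orthonormal[OF assms, of "\<lambda>i. cinner x (e i)"] by (simp add: p_def)
qed

text \<open>One Gram-Schmidt step: the span of the vectors found so far is not the whole space, so a
  vector outside it has a nonzero component orthogonal to it.\<close>

lemma exists_orthonormal_nat:
  assumes "\<nexists>B::'h::complex_hilbert_space set. finite B \<and> module.span scaleC B = UNIV"
  shows "\<exists>e::nat \<Rightarrow> 'h. orthonormal_on {..<N} e"
proof (induction N)
  case (Suc N)
  then obtain e :: "nat \<Rightarrow> 'h" where e: "orthonormal_on {..<N} e" by blast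
  have "cvs.span (e ` {..<N}) \<noteq> UNIV"
    using assms by auto
  then obtain x where x: "x \<notin> cvs.span (e ` {..<N})" by blast
  define p where "p = (\<Sum>i<N. cinner x (e i) *\<^sub>C e i)"
  have "p \<in> cvs.span (e ` {..<N})"
    unfolding p_def by (intro cvs.span_sum cvs.span_scale cvs.span_base) auto
  then have ne: "x - p \<noteq> 0"
    using x by auto
  define y where "y = complex_of_real (1 / norm (x - p)) *\<^sub>C (x - p)"
  have 1: "cinner y y = 1"
    using ne by (simp add: y_def cinner_self norm_scaleC norm_divide)
  have 2: "cinner y (e j) = 0" if "j < N" for j
    using cinner_sum_orthonormal[OF e, of j "\<lambda>i. cinner x (e i)"] that
    by (simp add: y_def cinner_scaleC_left cinner.diff_left p_def)
  have 3: "cinner (e j) y = 0" if "j < N" for j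
    using 2[OF that] by (metis cinner_commute complex_cnj_zero)
  have "orthonormal_on {..<Suc N} (e(N := y))"
    using e 1 2 3 by (auto simp: orthonormal_on_def less_Suc_eq)
  then show ?case by blast
qed (simp add: orthonormal_on_def)

lemma exists_orthonormal_words:
  assumes "separable_inf_dim TYPE('h::complex_hilbert_space)"
  shows "\<exists>e::'n::finite list \<Rightarrow> 'h. orthonormal_on {\<alpha>. length \<alpha> \<le> d} e"
proof -
  let ?A = "{\<alpha>::'n list. length \<alpha> \<le> d}"
  obtain h where h: "bij_betw h ?A {0..<card ?A}"
    using ex_bij_betw_finite_nat[of ?A] by auto
  obtain e :: "nat \<Rightarrow> 'h" where e: "orthonormal_on {..<card ?A} e"
    using exists_orthonormal_nat assms unfolding separable_inf_dim_def by blast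
  have "h \<alpha> \<in> {..<card ?A}" if "\<alpha> \<in> ?A" for \<alpha>
    using bij_betwE[OF h] that by (auto simp: atLeast0LessThan)
  moreover have "h \<alpha> = h \<beta> \<longleftrightarrow> \<alpha> = \<beta>" if "\<alpha> \<in> ?A" "\<beta> \<in> ?A" for \<alpha> \<beta>
    using h that by (meson bij_betw_def inj_on_eq_iff)
  ultimately have "orthonormal_on ?A (e \<circ> h)"
    using e unfolding orthonormal_on_def by (simp del: mem_Collect_eq lessThan_iff)
  then show ?thesis by blast
qed

text \<open>Creation operators on the full Fock space, cut off at degree \<open>d\<close>: this needs only
  finitely many orthonormal vectors, and it determines all coefficients of degree at most \<open>d\<close>.\<close>

definition trunc_shift ::
    "('n::finite list \<Rightarrow> 'h::complex_hilbert_space) \<Rightarrow> nat \<Rightarrow> real \<Rightarrow> 'n \<Rightarrow> 'h op" where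
  "trunc_shift e d r i =
     Blinfun (\<lambda>x. \<Sum>\<alpha> | length \<alpha> < d. (complex_of_real r * cinner x (e \<alpha>)) *\<^sub>C e (i # \<alpha>))"

lemma bounded_linear_scaleC_left: "bounded_linear (\<lambda>c. c *\<^sub>C x)"
  for x :: "'h::complex_hilbert_space"
  by (rule bounded_linear_intro[where K = "norm x"])
    (simp_all add: scaleC_add_left scaleR_scaleC scaleC_scaleC norm_scaleC scaleR_conv_of_real)

lemma trunc_shift_apply:
  "blinfun_apply (trunc_shift e d r i) x
    = (\<Sum>\<alpha> | length \<alpha> < d. (complex_of_real r * cinner x (e \<alpha>)) *\<^sub>C e (i # \<alpha>))"
proof -
  have "bounded_linear (\<lambda>x. \<Sum>\<alpha> | length \<alpha> < d. (complex_of_real r * cinner x (e \<alpha>)) *\<^sub>C e (i # \<alpha>))"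
    by (intro bounded_linear_sum bounded_linear_compose[OF bounded_linear_scaleC_left]
        bounded_linear_compose[OF bounded_linear_mult_right] cinner.bounded_linear_left)
  then show ?thesis
    by (simp add: trunc_shift_def bounded_linear_Blinfun_apply)
qed

lemma trunc_shift_BH: "trunc_shift e d r i \<in> BH"
  by (simp add: BH_def trunc_shift_apply cinner_scaleC_left cvs.scale_sum_right scaleC_scaleC mult_ac)

text \<open>The ranges for different letters are orthogonal, since \<open_pair> (i, \<alpha>) is
  determined by the word i # \<alpha>. The row norm is therefore computed exactly, and Bessel bounds
  it; r < 1 makes the bound strict.\<close>

lemma trunc_shift_in_op_ball:
  fixes e :: "'n::finite list \<Rightarrow> 'h::complex_hilbert_space"
  assumes e: "orthonormal_on {\<alpha>. length \<alpha> \<le> d} e" and r: "0 \<le> r" "r < 1"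
  shows "trunc_shift e d r \<in> op_ball"
  unfolding op_ball_iff
proof (intro conjI exI[of _ r] allI r trunc_shift_BH)
  fix h :: "'n \<Rightarrow> 'h"
  let ?W = "{\<alpha>::'n list. length \<alpha> < d}"
  let ?f = "\<lambda>(i, \<alpha>). e (i # \<alpha>)"
  have on: "orthonormal_on (UNIV \<times> ?W) ?f"
    using e by (auto simp: orthonormal_on_def)
  have onW: "orthonormal_on ?W e"
    using e by (auto simp: orthonormal_on_def)
  have "(\<Sum>i\<in>UNIV. blinfun_apply (trunc_shift e d r i) (h i))
      = (\<Sum>p\<in>UNIV \<times> ?W. (complex_of_real r * cinner (h (fst p)) (e (snd p))) *\<^sub>C ?f p)"
    by (simp add: trunc_shift_apply sum.cartesian_product case_prod_unfold)
  then have "(norm (\<Sum>i\<in>UNIV. blinfun_apply (trunc_shift e d r i) (h i)))\<^sup>2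
      = (\<Sum>p\<in>UNIV \<times> ?W. (cmod (complex_of_real r * cinner (h (fst p)) (e (snd p))))\<^sup>2)"
    using norm_sum_orthonormal[OF on] by simp
  also have "\<dots> = (\<Sum>i\<in>UNIV. r\<^sup>2 * (\<Sum>\<alpha>\<in>?W. (cmod (cinner (h i) (e \<alpha>)))\<^sup>2))"
    by (simp add: norm_mult power_mult_distrib sum.cartesian_product case_prod_unfold sum_distrib_left)
  also have "\<dots> \<le> (\<Sum>i\<in>UNIV. r\<^sup>2 * (norm (h i))\<^sup>2)"
    by (intro sum_mono mult_left_mono Bessel_inequality[OF onW]) auto
  finally show "(norm (\<Sum>i\<in>UNIV. blinfun_apply (trunc_shift e d r i) (h i)))\<^sup>2
      \<le> r\<^sup>2 * (\<Sum>i\<in>UNIV. (norm (h i))\<^sup>2)"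
    by (simp add: sum_distrib_left)
qed

lemma trunc_shift_basis:
  fixes e :: "'n::finite list \<Rightarrow> 'h::complex_hilbert_space"
  assumes e: "orthonormal_on {\<alpha>. length \<alpha> \<le> d} e" and \<beta>: "length \<beta> \<le> d"
  shows "blinfun_apply (trunc_shift e d r i) (e \<beta>)
    = (if length \<beta> < d then complex_of_real r *\<^sub>C e (i # \<beta>) else 0)"
proof -
  have "blinfun_apply (trunc_shift e d r i) (e \<beta>)
      = (\<Sum>\<alpha> | length \<alpha> < d. if \<alpha> = \<beta> then complex_of_real r *\<^sub>C e (i # \<beta>) else 0)"
    unfolding trunc_shift_apply using e \<beta>
    by (intro sum.cong) (auto simp: orthonormal_on_def)
  then show ?thesis
    by simp
qed

text \<open>\<open>e []\<close> is the vacuum vector, and each operator prepends its letter at the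
  price of a factor r. A word longer than d is killed, because vectors of degree d are sent to
  0.\<close>

lemma op_word_trunc_shift:
  fixes e :: "'n::finite list \<Rightarrow> 'h::complex_hilbert_space"
  assumes e: "orthonormal_on {\<alpha>. length \<alpha> \<le> d} e"
  shows "blinfun_apply (op_word (trunc_shift e d r) \<alpha>) (e [])
    = (if length \<alpha> \<le> d then complex_of_real (r ^ length \<alpha>) *\<^sub>C e \<alpha> else 0)"
proof (induction \<alpha>)
  case Nil
  then show ?case
    by (simp add: scaleC_one)
next
  case (Cons i \<alpha>)
  then show ?case
    by (auto simp: op_word_Cons BH_D[OF trunc_shift_BH] trunc_shift_basis[OF e] scaleC_scaleC
        mult.commute)
qed

text \<open>A single evaluation reads off all coefficients of degree at most d: the homogeneous
  parts of higher degree annihilate the vacuum, so the operator series becomes a finite sum.\<close>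

lemma has_free_expansion_trunc_shift:
  fixes e :: "'n::finite list \<Rightarrow> 'h::complex_hilbert_space"
  assumes f: "has_free_expansion f a" and e: "orthonormal_on {\<alpha>. length \<alpha> \<le> d} e"
    and r: "0 \<le> r" "r < 1"
  shows "blinfun_apply (f (trunc_shift e d r)) (e [])
    = (\<Sum>\<alpha> | length \<alpha> \<le> d. (a \<alpha> * complex_of_real (r ^ length \<alpha>)) *\<^sub>C e \<alpha>)"
proof -
  let ?X = "trunc_shift e d r"
  have "(\<lambda>k. \<Sum>\<alpha> | length \<alpha> = k. scale_op (a \<alpha>) (op_word ?X \<alpha>)) sums f ?X"
    using f trunc_shift_in_op_ball[OF e r] by (auto simp: has_free_expansion_def)
  then have "(\<lambda>k. blinfun_apply (\<Sum>\<alpha> | length \<alpha> = k. scale_op (a \<alpha>) (op_word ?X \<alpha>)) (e []))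
      sums blinfun_apply (f ?X) (e [])"
    by (rule bounded_linear.sums[OF blinfun.bounded_linear_left])
  moreover have "(\<lambda>k. blinfun_apply (\<Sum>\<alpha> | length \<alpha> = k. scale_op (a \<alpha>) (op_word ?X \<alpha>)) (e []))
      sums (\<Sum>k<Suc d. blinfun_apply (\<Sum>\<alpha> | length \<alpha> = k. scale_op (a \<alpha>) (op_word ?X \<alpha>)) (e []))"
    by (rule sums_finite) (simp_all add: blinfun.sum_left op_word_trunc_shift[OF e])
  ultimately have "blinfun_apply (f ?X) (e [])
      = (\<Sum>k<Suc d. blinfun_apply (\<Sum>\<alpha> | length \<alpha> = k. scale_op (a \<alpha>) (op_word ?X \<alpha>)) (e []))"
    by (rule sums_unique2)
  also have "\<dots> = (\<Sum>k<Suc d. \<Sum>\<alpha> | length \<alpha> = k. (a \<alpha> * complex_of_real (r ^ length \<alpha>)) *\<^sub>C e \<alpha>)"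
    by (intro sum.cong) (simp_all add: blinfun.sum_left op_word_trunc_shift[OF e] scaleC_scaleC)
  also have "\<dots> = (\<Sum>\<alpha> | length \<alpha> < Suc d. (a \<alpha> * complex_of_real (r ^ length \<alpha>)) *\<^sub>C e \<alpha>)"
    by (rule sum_words_less[symmetric])
  finally show ?thesis
    by (simp add: less_Suc_eq_le)
qed

text \<open>The coefficient at \<alpha> is the inner product with e_\<alpha> of the value at a
  truncated shift, divided by r^|\<alpha>|. Any r strictly between 0 and 1 serves; 1/2 is
  taken.\<close>

lemma free_expansion_unique:
  fixes f :: "('n::finite, 'h::complex_hilbert_space) free_fun"
  assumes inf: "separable_inf_dim TYPE('h)"
    and a: "has_free_expansion f a" and b: "has_free_expansion f b"
  shows "a = b"
proof
  fix \<alpha> :: "'n list"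
  let ?d = "length \<alpha>"
  obtain e :: "'n list \<Rightarrow> 'h" where e: "orthonormal_on {\<alpha>. length \<alpha> \<le> ?d} e"
    using exists_orthonormal_words[OF inf] by blast
  have "c \<alpha> * complex_of_real ((1/2) ^ length \<alpha>)
      = cinner (blinfun_apply (f (trunc_shift e ?d (1/2))) (e [])) (e \<alpha>)"
    if "has_free_expansion f c" for c
    by (simp add: has_free_expansion_trunc_shift[OF that e] cinner_sum_orthonormal[OF e])
  from this[OF a] this[OF b]
  have "a \<alpha> * complex_of_real ((1/2) ^ length \<alpha>) = b \<alpha> * complex_of_real ((1/2) ^ length \<alpha>)"
    by (rule trans[OF _ sym])
  then show "a \<alpha> = b \<alpha>"
    by simp
qed

lemma free_coeff_eqI:
  fixes f :: "('n::finite, 'h::complex_hilbert_space) free_fun"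
  assumes "separable_inf_dim TYPE('h)" "has_free_expansion f a"
  shows "free_coeff f = a"
  unfolding free_coeff_def using assms free_expansion_unique by (intro the_equality) blast+

section \<open>Square-summable coefficients\<close>

definition square_summable :: "('i \<Rightarrow> complex) \<Rightarrow> bool" where
  "square_summable a \<longleftrightarrow> (\<lambda>i. (cmod (a i))\<^sup>2) summable_on UNIV"

definition l2norm :: "('i \<Rightarrow> complex) \<Rightarrow> real" where
  "l2norm a = sqrt (\<Sum>\<^sub>\<infinity>i. (cmod (a i))\<^sup>2)"

lemma l2norm_nonneg [simp]: "0 \<le> l2norm a"
  by (simp add: l2norm_def infsum_nonneg)

lemma l2norm_sq: "(l2norm a)\<^sup>2 = (\<Sum>\<^sub>\<infinity>i. (cmod (a i))\<^sup>2)"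
  by (simp add: l2norm_def infsum_nonneg)

lemma sum_le_l2norm_sq:
  assumes "square_summable a" "finite F"
  shows "(\<Sum>i\<in>F. (cmod (a i))\<^sup>2) \<le> (l2norm a)\<^sup>2"
  unfolding l2norm_sq using assms by (intro finite_sum_le_infsum) (auto simp: square_summable_def)

lemma square_summable_bounded:
  assumes "\<And>F. finite F \<Longrightarrow> (\<Sum>i\<in>F. (cmod (a i))\<^sup>2) \<le> C"
  shows "square_summable a" "(l2norm a)\<^sup>2 \<le> C"
proof -
  show s: "square_summable a"
    unfolding square_summable_def
    by (rule nonneg_bdd_above_summable_on) (auto intro!: bdd_aboveI[where M = C] assms)
  show "(l2norm a)\<^sup>2 \<le> C"
    unfolding l2norm_sq using s assms
    by (intro infsum_le_finite_sums) (auto simp: square_summable_def)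
qed

lemma square_summable_bounded_L2_set:
  assumes "\<And>F. finite F \<Longrightarrow> L2_set (\<lambda>i. cmod (a i)) F \<le> C" "C \<ge> 0"
  shows "square_summable a" "l2norm a \<le> C"
proof -
  have "(\<Sum>i\<in>F. (cmod (a i))\<^sup>2) \<le> C\<^sup>2" if "finite F" for F
    using assms(1)[OF that] by (simp add: L2_set_def sqrt_le_D)
  note * = square_summable_bounded[OF this]
  show "square_summable a" "l2norm a \<le> C"
    using * assms(2) by (auto intro: power2_le_imp_le)
qed

lemma L2_set_le_l2norm:
  assumes "square_summable a" "finite F"
  shows "L2_set (\<lambda>i. cmod (a i)) F \<le> l2norm a"
  unfolding L2_set_def using sum_le_l2norm_sq[OF assms] by (simp add: real_le_lsqrt)

lemma cmod_le_l2norm: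
  assumes "square_summable a"
  shows "cmod (a i) \<le> l2norm a"
  using L2_set_le_l2norm[OF assms, of "{i}"] by simp

lemma square_summable_add:
  assumes "square_summable a" "square_summable b"
  shows "square_summable (\<lambda>i. a i + b i)" "l2norm (\<lambda>i. a i + b i) \<le> l2norm a + l2norm b"
proof -
  have "L2_set (\<lambda>i. cmod (a i + b i)) F \<le> l2norm a + l2norm b" if "finite F" for F
  proof -
    have "L2_set (\<lambda>i. cmod (a i + b i)) F \<le> L2_set (\<lambda>i. cmod (a i) + cmod (b i)) F"
      by (intro L2_set_mono norm_triangle_ineq) auto
    also have "\<dots> \<le> L2_set (\<lambda>i. cmod (a i)) F + L2_set (\<lambda>i. cmod (b i)) F"
      by (rule L2_set_triangle_ineq)
    also have "\<dots> \<le> l2norm a + l2norm b"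
      using that assms by (intro add_mono L2_set_le_l2norm)
    finally show ?thesis .
  qed
  from square_summable_bounded_L2_set[OF this]
  show "square_summable (\<lambda>i. a i + b i)" "l2norm (\<lambda>i. a i + b i) \<le> l2norm a + l2norm b"
    by auto
qed

lemma square_summable_scale:
  assumes "square_summable a"
  shows "square_summable (\<lambda>i. c * a i)"
  using assms unfolding square_summable_def
  by (simp add: norm_mult power_mult_distrib summable_on_cmult_right)

lemma l2norm_scale: "l2norm (\<lambda>i. c * a i) = cmod c * l2norm a"
  by (simp add: l2norm_def norm_mult power_mult_distrib infsum_cmult_right' real_sqrt_mult)

lemma square_summable_diff:
  assumes "square_summable a" "square_summable b"
  shows "square_summable (\<lambda>i. a i - b i)"
  using square_summable_add(1)[OF assms(1) square_summable_scale[OF assms(2), of "-1"]] by simp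

lemma square_summable_zero [simp]: "square_summable (\<lambda>i. 0)"
  by (simp add: square_summable_def)

lemma l2norm_zero [simp]: "l2norm (\<lambda>i. 0) = 0"
  by (simp add: l2norm_def)

lemma l2norm_eq_0_iff:
  assumes "square_summable a"
  shows "l2norm a = 0 \<longleftrightarrow> a = (\<lambda>i. 0)"
proof
  assume "l2norm a = 0"
  then have "cmod (a i) \<le> 0" for i
    using cmod_le_l2norm[OF assms, of i] by simp
  then show "a = (\<lambda>i. 0)"
    by auto
qed simp

lemma finite_support_square_summable:
  assumes "finite {i. a i \<noteq> 0}"
  shows "square_summable a"
  unfolding square_summable_def
  by (rule finite_nonzero_values_imp_summable_on) (use assms in simp)

lemma square_summable_mult_bounded:
  assumes "square_summable a" "square_summable b" "finite F"
  shows "(\<Sum>i\<in>F. cmod (a i * b i)) \<le> l2norm a * l2norm b"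
proof -
  have "(\<Sum>i\<in>F. cmod (a i * b i)) \<le> L2_set (\<lambda>i. cmod (a i)) F * L2_set (\<lambda>i. cmod (b i)) F"
    using L2_set_mult_ineq[of "\<lambda>i. cmod (a i)" "\<lambda>i. cmod (b i)" F] by (simp add: norm_mult)
  also have "\<dots> \<le> l2norm a * l2norm b"
    using assms by (intro mult_mono L2_set_le_l2norm) auto
  finally show ?thesis .
qed

lemma square_summable_mult:
  assumes "square_summable a" "square_summable b"
  shows "(\<lambda>i. cmod (a i * b i)) summable_on UNIV"
    "(\<lambda>i. a i * b i) summable_on UNIV"
    "cmod (\<Sum>\<^sub>\<infinity>i. a i * b i) \<le> l2norm a * l2norm b"
proof -
  note b = square_summable_mult_bounded[OF assms]
  show s: "(\<lambda>i. cmod (a i * b i)) summable_on UNIV"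
    by (rule nonneg_bdd_above_summable_on) (auto intro!: bdd_aboveI b)
  then show "(\<lambda>i. a i * b i) summable_on UNIV"
    by (rule abs_summable_summable)
  have "cmod (\<Sum>\<^sub>\<infinity>i. a i * b i) \<le> (\<Sum>\<^sub>\<infinity>i. cmod (a i * b i))"
    using s by (rule norm_infsum_bound)
  also have "\<dots> \<le> l2norm a * l2norm b"
    using s by (rule infsum_le_finite_sums) (auto intro: b)
  finally show "cmod (\<Sum>\<^sub>\<infinity>i. a i * b i) \<le> l2norm a * l2norm b" .
qed

lemma l2norm_add_sq:
  assumes a: "square_summable a" and b: "square_summable b"
  shows "(l2norm (\<lambda>i. a i + b i))\<^sup>2
    = (l2norm a)\<^sup>2 + 2 * Re (\<Sum>\<^sub>\<infinity>i. a i * cnj (b i)) + (l2norm b)\<^sup>2"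
proof -
  have b': "square_summable (\<lambda>i. cnj (b i))"
    using b by (simp add: square_summable_def)
  have ex: "(cmod (a i + b i))\<^sup>2 = (cmod (a i))\<^sup>2 + 2 * Re (a i * cnj (b i)) + (cmod (b i))\<^sup>2" for i
    unfolding cmod_power2 by (simp add: power2_eq_square algebra_simps)
  have "((\<lambda>i. Re (a i * cnj (b i))) has_sum Re (\<Sum>\<^sub>\<infinity>i. a i * cnj (b i))) UNIV"
    by (intro has_sum_Re has_sum_infsum square_summable_mult(2) a b')
  then have "((\<lambda>i. (cmod (a i))\<^sup>2 + 2 * Re (a i * cnj (b i)) + (cmod (b i))\<^sup>2) has_sum
      ((l2norm a)\<^sup>2 + 2 * Re (\<Sum>\<^sub>\<infinity>i. a i * cnj (b i)) + (l2norm b)\<^sup>2)) UNIV"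
    using a b unfolding l2norm_sq square_summable_def
    by (intro has_sum_add has_sum_cmult_right has_sum_infsum)
  then show ?thesis
    unfolding l2norm_sq ex by (rule infsumI)
qed

text \<open>Connects unordered sums over all words, in which norms are defined, with series over the
  degree, in which free functions are defined. The sets of words shorter than d eventually contain
  every finite set of words.\<close>

lemma has_sum_words:
  fixes f :: "'n::finite list \<Rightarrow> 'a::{comm_monoid_add,topological_space}"
  assumes "(f has_sum S) UNIV"
  shows "(\<lambda>k. \<Sum>\<alpha> | length \<alpha> = k. f \<alpha>) sums S"
proof -
  have "filterlim (\<lambda>d. {\<alpha>::'n list. length \<alpha> < d}) (finite_subsets_at_top UNIV) sequentially"
    unfolding filterlim_finite_subsets_at_top
  proof (intro allI impI, elim conjE)
    fix F :: "'n list set" assume "finite F"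
    then obtain N where "F \<subseteq> {\<alpha>. length \<alpha> < N}"
      by (rule finite_words_bounded)
    then show "\<forall>\<^sub>F d in sequentially. finite {\<alpha>::'n list. length \<alpha> < d} \<and>
        F \<subseteq> {\<alpha>. length \<alpha> < d} \<and> {\<alpha>. length \<alpha> < d} \<subseteq> UNIV"
      by (intro eventually_sequentiallyI[of N]) (auto dest: subsetD)
  qed
  then have "(\<lambda>d. \<Sum>\<alpha> | length \<alpha> < d. f \<alpha>) \<longlonglongrightarrow> S"
    using assms unfolding has_sum_def by (rule filterlim_compose[rotated])
  then show ?thesis
    by (simp add: sums_def sum_words_less)
qed

lemma l2norm_tail:
  fixes a :: "'n::finite list \<Rightarrow> complex"
  assumes a: "square_summable a" and "\<epsilon> > 0"
  shows "\<exists>d. l2norm (\<lambda>\<alpha>. if length \<alpha> < d then 0 else a \<alpha>) < \<epsilon>"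
proof -
  have "((\<lambda>\<alpha>. (cmod (a \<alpha>))\<^sup>2) has_sum (l2norm a)\<^sup>2) UNIV"
    using a by (simp add: l2norm_sq square_summable_def)
  from has_sum_words[OF this] have "(\<lambda>d. \<Sum>\<alpha> | length \<alpha> < d. (cmod (a \<alpha>))\<^sup>2) \<longlonglongrightarrow> (l2norm a)\<^sup>2"
    by (simp add: sums_def sum_words_less)
  \<comment> \<open>Half of \<epsilon>^2 is spent, so that the non-strict bound obtained for the
    full tail is still strictly below \<epsilon>^2.\<close>
  then obtain d where d: "(l2norm a)\<^sup>2 - \<epsilon>\<^sup>2 / 2 < (\<Sum>\<alpha> | length \<alpha> < d. (cmod (a \<alpha>))\<^sup>2)"
    using order_tendstoD(1)[of _ "(l2norm a)\<^sup>2" sequentially "(l2norm a)\<^sup>2 - \<epsilon>\<^sup>2 / 2"] \<open>\<epsilon> > 0\<close>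
    by (auto simp: eventually_sequentially)
  let ?t = "\<lambda>\<alpha>. if length \<alpha> < d then 0 else a \<alpha>"
  have "(\<Sum>\<alpha>\<in>F. (cmod (?t \<alpha>))\<^sup>2) \<le> \<epsilon>\<^sup>2 / 2" if "finite F" for F
  proof -
    let ?W = "{\<alpha>::'n list. length \<alpha> < d}"
    have "(\<Sum>\<alpha>\<in>F. (cmod (?t \<alpha>))\<^sup>2) = (\<Sum>\<alpha>\<in>F - ?W. (cmod (a \<alpha>))\<^sup>2)"
      using that by (intro sum.mono_neutral_cong_right) auto
    also have "\<dots> + (\<Sum>\<alpha>\<in>?W. (cmod (a \<alpha>))\<^sup>2) = (\<Sum>\<alpha>\<in>(F - ?W) \<union> ?W. (cmod (a \<alpha>))\<^sup>2)"
      using that by (intro sum.union_disjoint[symmetric]) auto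
    also have "\<dots> \<le> (l2norm a)\<^sup>2"
      using that by (intro sum_le_l2norm_sq[OF a]) auto
    finally show ?thesis
      using d by linarith
  qed
  then have "(l2norm ?t)\<^sup>2 \<le> \<epsilon>\<^sup>2 / 2"
    by (rule square_summable_bounded(2))
  also have "\<dots> < \<epsilon>\<^sup>2"
    using \<open>\<epsilon> > 0\<close> by simp
  finally show ?thesis
    using \<open>\<epsilon> > 0\<close> by (meson less_imp_le power_less_imp_less_base)
qed

lemma l2norm_mono:
  assumes "square_summable b" "\<And>i. cmod (a i) \<le> cmod (b i)"
  shows "square_summable a" "l2norm a \<le> l2norm b"
proof -
  have "L2_set (\<lambda>i. cmod (a i)) F \<le> l2norm b" if "finite F" for F
    using assms L2_set_le_l2norm[OF assms(1) that]
    by (meson L2_set_mono norm_ge_zero order_trans)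
  from square_summable_bounded_L2_set[OF this]
  show "square_summable a" "l2norm a \<le> l2norm b"
    by auto
qed

lemma has_sum_Cons_split:
  fixes f :: "'n::finite list \<Rightarrow> 'a::{topological_comm_monoid_add,t2_space}"
  assumes "\<And>i. ((\<lambda>\<alpha>. f (i # \<alpha>)) has_sum S i) UNIV"
  shows "(f has_sum (f [] + (\<Sum>i\<in>UNIV. S i))) UNIV"
proof -
  have 1: "(f has_sum f []) {[]}"
    by (simp add: has_sum_finiteI)
  have "(f has_sum S i) (range ((#) i))" for i
    using assms[of i] by (subst has_sum_reindex) (auto simp: inj_on_def o_def)
  then have 2: "(f has_sum (\<Sum>i\<in>UNIV. S i)) (\<Union>i\<in>UNIV. range ((#) i))"
    by (intro sum_has_sum) auto
  have "UNIV = {[]} \<union> (\<Union>i::'n. range ((#) i))"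
    by (auto simp: image_iff) (metis neq_Nil_conv)
  moreover have "{[]} \<inter> (\<Union>i::'n. range ((#) i)) = {}"
    by auto
  ultimately show ?thesis
    using has_sum_Un_disjoint[OF 1 2] by simp
qed

text \<open>The Fock space is the orthogonal sum of the vacuum line and one copy of itself per first
  letter. The induction on the degree runs along this splitting.\<close>

lemma l2norm_Cons_split:
  fixes a :: "'n::finite list \<Rightarrow> complex"
  assumes a: "square_summable a"
  shows "square_summable (\<lambda>\<alpha>. a (i # \<alpha>))"
    and "(l2norm a)\<^sup>2 = (cmod (a []))\<^sup>2 + (\<Sum>i\<in>UNIV. (l2norm (\<lambda>\<alpha>. a (i # \<alpha>)))\<^sup>2)"
proof -
  have s: "square_summable (\<lambda>\<alpha>. a (i # \<alpha>))" for i
  proof (rule square_summable_bounded(1))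
    fix F :: "'n list set" assume "finite F"
    then have "(\<Sum>\<alpha>\<in>(#) i ` F. (cmod (a \<alpha>))\<^sup>2) \<le> (l2norm a)\<^sup>2"
      by (intro sum_le_l2norm_sq[OF a]) simp
    then show "(\<Sum>\<alpha>\<in>F. (cmod (a (i # \<alpha>)))\<^sup>2) \<le> (l2norm a)\<^sup>2"
      by (simp add: sum.reindex inj_on_def)
  qed
  then show "square_summable (\<lambda>\<alpha>. a (i # \<alpha>))" .
  have "((\<lambda>\<alpha>. (cmod (a (i # \<alpha>)))\<^sup>2) has_sum (l2norm (\<lambda>\<alpha>. a (i # \<alpha>)))\<^sup>2) UNIV" for i
    using s[of i] by (simp add: l2norm_sq square_summable_def)
  from has_sum_Cons_split[of "\<lambda>\<alpha>. (cmod (a \<alpha>))\<^sup>2", OF this]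
  show "(l2norm a)\<^sup>2 = (cmod (a []))\<^sup>2 + (\<Sum>i\<in>UNIV. (l2norm (\<lambda>\<alpha>. a (i # \<alpha>)))\<^sup>2)"
    unfolding l2norm_sq by (rule infsumI)
qed

section \<open>The space \<open>H\<^sup>2\<close> of the ball\<close>

lemma BH_id [simp]: "id_blinfun \<in> BH"
  by (simp add: BH_def)

lemma BH_compose: "S \<in> BH \<Longrightarrow> T \<in> BH \<Longrightarrow> S o\<^sub>L T \<in> BH"
  by (simp add: BH_def)

lemma BH_scale: "T \<in> BH \<Longrightarrow> scale_op c T \<in> BH"
  by (simp add: BH_def scaleC_scaleC mult.commute)

lemma op_ball_BH: "X \<in> op_ball \<Longrightarrow> X i \<in> BH"
  by (simp add: op_ball_def)

lemma op_word_BH: "(\<And>i. X i \<in> BH) \<Longrightarrow> op_word X \<alpha> \<in> BH"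
  by (induction \<alpha>) (simp_all add: op_word_Cons BH_compose)

lemma scale_op_add_left: "scale_op (c + d) T = scale_op c T + scale_op d T"
  by (rule blinfun_eqI) (simp add: scaleC_add_left blinfun.add_left)

lemma scale_op_add_right: "scale_op c (S + T) = scale_op c S + scale_op c T"
  by (rule blinfun_eqI) (simp add: scaleC_add_right blinfun.add_left)

lemma scale_op_scale_op: "scale_op c (scale_op d T) = scale_op (c * d) T"
  by (rule blinfun_eqI) (simp add: scaleC_scaleC)

lemma scale_op_one [simp]: "scale_op 1 T = T"
  by (rule blinfun_eqI) (simp add: scaleC_one)

lemma scale_op_zero_left [simp]: "scale_op 0 T = 0"
  by (rule blinfun_eqI) simp

lemma scale_op_zero_right [simp]: "scale_op c 0 = 0"
  by (rule blinfun_eqI) simp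

lemma scale_op_minus_one: "scale_op (- 1) T = - T"
  by (rule blinfun_eqI) (simp add: scaleC_one blinfun.minus_left)

lemma scale_op_sum_left: "scale_op (sum c A) T = (\<Sum>i\<in>A. scale_op (c i) T)"
  by (rule blinfun_eqI) (simp add: cvs.scale_sum_left blinfun.sum_left)

lemma scale_op_sum_right: "scale_op c (sum T A) = (\<Sum>i\<in>A. scale_op c (T i))"
  by (rule blinfun_eqI) (simp add: cvs.scale_sum_right blinfun.sum_left)

lemma scale_op_compose_right: "S \<in> BH \<Longrightarrow> S o\<^sub>L scale_op c T = scale_op c (S o\<^sub>L T)"
  by (rule blinfun_eqI) (simp add: BH_D)

lemma norm_scale_op: "norm (scale_op c T) = cmod c * norm T"
proof (cases "c = 0")
  case False
  have le: "norm (scale_op d S) \<le> cmod d * norm S" for d and S :: "'a op"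
    by (rule norm_blinfun_bound)
      (auto simp: norm_scaleC mult.assoc intro!: mult_left_mono norm_blinfun)
  have "norm (scale_op (inverse c) (scale_op c T)) \<le> cmod (inverse c) * norm (scale_op c T)"
    by (rule le)
  then have "cmod c * norm T \<le> norm (scale_op c T)"
    using False by (simp add: scale_op_scale_op norm_inverse norm_divide field_simps)
  with le[of c T] show ?thesis
    by simp
qed simp

lemma bounded_linear_scale_op_right: "bounded_linear (scale_op c)"
proof (rule bounded_linear_intro[where K = "cmod c"])
  show "scale_op c (r *\<^sub>R T) = r *\<^sub>R scale_op c T" for r T
    by (rule blinfun_eqI) (simp add: blinfun.scaleR_left scaleR_scaleC scaleC_scaleC mult.commute)
qed (simp_all add: scale_op_add_right norm_scale_op)

lemma bounded_linear_scale_op_left: "bounded_linear (\<lambda>c. scale_op c T)"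
proof (rule bounded_linear_intro[where K = "norm T"])
  show "scale_op (r *\<^sub>R c) T = r *\<^sub>R scale_op c T" for r c
    by (rule blinfun_eqI) (simp add: blinfun.scaleR_left scaleR_scaleC scaleC_scaleC scaleR_conv_of_real)
qed (simp_all add: scale_op_add_left norm_scale_op)

lemma bounded_linear_compose_right: "bounded_linear (\<lambda>S. S o\<^sub>L T)"
  by (rule bounded_bilinear.bounded_linear_left[OF bounded_bilinear_blinfun_compose])

lemma bounded_linear_compose_left: "bounded_linear (\<lambda>S. T o\<^sub>L S)"
  by (rule bounded_bilinear.bounded_linear_right[OF bounded_bilinear_blinfun_compose])

text \<open>The row bound for words is applied to the vectors a_\<alpha> x. The rate \<rho> depends
  on X alone, so the series over the degree is dominated by a geometric one.\<close>

lemma norm_homogeneous_part_le: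
  fixes X :: "'n::finite \<Rightarrow> 'h::complex_hilbert_space op"
  assumes "X \<in> op_ball"
  shows "\<exists>\<rho>. 0 \<le> \<rho> \<and> \<rho> < 1 \<and> (\<forall>a k. square_summable a \<longrightarrow>
    norm (\<Sum>\<alpha> | length \<alpha> = k. scale_op (a \<alpha>) (op_word X \<alpha>)) \<le> l2norm a * \<rho> ^ k)"
proof -
  obtain \<rho> where \<rho>: "0 \<le> \<rho>" "\<rho> < 1"
    and row: "\<And>h. (norm (\<Sum>i\<in>UNIV. blinfun_apply (X i) (h i)))\<^sup>2 \<le> \<rho>\<^sup>2 * (\<Sum>i\<in>UNIV. (norm (h i))\<^sup>2)"
    using assms unfolding op_ball_iff by blast
  have "norm (\<Sum>\<alpha> | length \<alpha> = k. scale_op (a \<alpha>) (op_word X \<alpha>)) \<le> l2norm a * \<rho> ^ k"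
    if a: "square_summable a" for a k
  proof (rule norm_blinfun_bound)
    fix x :: 'h
    have "blinfun_apply (\<Sum>\<alpha> | length \<alpha> = k. scale_op (a \<alpha>) (op_word X \<alpha>)) x
        = (\<Sum>\<alpha> | length \<alpha> = k. blinfun_apply (op_word X \<alpha>) (a \<alpha> *\<^sub>C x))"
      using op_word_BH[of X] op_ball_BH[OF assms] by (simp add: blinfun.sum_left BH_D)
    then have "(norm (blinfun_apply (\<Sum>\<alpha> | length \<alpha> = k. scale_op (a \<alpha>) (op_word X \<alpha>)) x))\<^sup>2
        \<le> (\<rho>\<^sup>2) ^ k * (\<Sum>\<alpha> | length \<alpha> = k. (norm (a \<alpha> *\<^sub>C x))\<^sup>2)"
      using norm_word_row_le[OF row] by simp
    also have "\<dots> = (\<rho> ^ k)\<^sup>2 * (norm x)\<^sup>2 * (\<Sum>\<alpha> | length \<alpha> = k. (cmod (a \<alpha>))\<^sup>2)"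
      by (simp add: norm_scaleC power_mult_distrib sum_distrib_left power_even_eq[symmetric]
          power_mult[symmetric] mult_ac)
    also have "\<dots> \<le> (\<rho> ^ k)\<^sup>2 * (norm x)\<^sup>2 * (l2norm a)\<^sup>2"
      by (intro mult_left_mono sum_le_l2norm_sq[OF a]) auto
    also have "\<dots> = (l2norm a * \<rho> ^ k * norm x)\<^sup>2"
      by (simp add: power_mult_distrib)
    finally show "norm (blinfun_apply (\<Sum>\<alpha> | length \<alpha> = k. scale_op (a \<alpha>) (op_word X \<alpha>)) x)
        \<le> l2norm a * \<rho> ^ k * norm x"
      using \<rho> by (auto intro: power2_le_imp_le)
  qed (use \<rho> in auto)
  then show ?thesis
    using \<rho> by blast
qed

text \<open>The value 0 outside the ball matches the normal form required in \<open>H2_ball\<close>,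
  which makes this the inverse of \<open>free_coeff\<close> on square-summable families.\<close>

definition free_series :: "('n::finite list \<Rightarrow> complex) \<Rightarrow> ('n, 'h::complex_hilbert_space) free_fun" where
  "free_series a X = (if X \<in> op_ball
     then \<Sum>k. \<Sum>\<alpha> | length \<alpha> = k. scale_op (a \<alpha>) (op_word X \<alpha>) else 0)"

lemma free_series_sums:
  assumes "X \<in> op_ball" "square_summable a"
  shows "(\<lambda>k. \<Sum>\<alpha> | length \<alpha> = k. scale_op (a \<alpha>) (op_word X \<alpha>)) sums free_series a X"
proof -
  obtain \<rho> where \<rho>: "0 \<le> \<rho>" "\<rho> < 1" and b: "\<And>k.
    norm (\<Sum>\<alpha> | length \<alpha> = k. scale_op (a \<alpha>) (op_word X \<alpha>)) \<le> l2norm a * \<rho> ^ k"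
    using norm_homogeneous_part_le[OF assms(1)] assms(2) by blast
  have "summable (\<lambda>k. l2norm a * \<rho> ^ k)"
    using \<rho> by (intro summable_mult summable_geometric) auto
  then have "summable (\<lambda>k. \<Sum>\<alpha> | length \<alpha> = k. scale_op (a \<alpha>) (op_word X \<alpha>))"
    by (rule summable_comparison_test') (rule b)
  then show ?thesis
    using assms(1) by (simp add: free_series_def summable_sums)
qed

text \<open>All degree sums lie below one constant C > 0, whose roots tend to 1. The summand 1 in
  \<open>C\<close> keeps it positive when a = 0.\<close>

lemma limsup_root_le_1:
  fixes a :: "'n::finite list \<Rightarrow> complex"
  assumes "square_summable a"
  shows "limsup (\<lambda>k. ereal (root (2 * k) (\<Sum>\<alpha> | length \<alpha> = k. (cmod (a \<alpha>))\<^sup>2))) \<le> 1"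
proof -
  define C where "C = (l2norm a)\<^sup>2 + 1"
  have C: "C > 0"
    unfolding C_def by (smt (verit) zero_le_power2)
  have "(\<Sum>\<alpha> | length \<alpha> = k. (cmod (a \<alpha>))\<^sup>2) \<le> C" for k
    using sum_le_l2norm_sq[OF assms, of "{\<alpha>. length \<alpha> = k}"] by (simp add: C_def)
  then have "root (2 * k) (\<Sum>\<alpha> | length \<alpha> = k. (cmod (a \<alpha>))\<^sup>2) \<le> root (2 * k) C" for k
    by (cases "k = 0") (auto intro: real_root_le_mono)
  then have "limsup (\<lambda>k. ereal (root (2 * k) (\<Sum>\<alpha> | length \<alpha> = k. (cmod (a \<alpha>))\<^sup>2)))
      \<le> limsup (\<lambda>k. ereal (root (2 * k) C))"
    by (intro Limsup_mono always_eventually) simp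
  also have "\<dots> = 1"
  proof -
    have "filterlim (\<lambda>k::nat. 2 * k) at_top at_top"
      by (rule filterlim_subseq) (auto simp: strict_mono_def)
    then have "(\<lambda>k. root (2 * k) C) \<longlonglongrightarrow> 1"
      by (rule filterlim_compose[OF LIMSEQ_root_const[OF C]])
    then have "(\<lambda>k. ereal (root (2 * k) C)) \<longlonglongrightarrow> ereal 1"
      by simp
    then show ?thesis
      using lim_imp_Limsup by (metis one_ereal_def sequentially_bot)
  qed
  finally show ?thesis .
qed

lemma free_series_expansion: "square_summable a \<Longrightarrow> has_free_expansion (free_series a) a"
  by (simp add: has_free_expansion_def limsup_root_le_1 free_series_sums)

lemma free_coeff_free_series:
  assumes "separable_inf_dim TYPE('h::complex_hilbert_space)" "square_summable a"
  shows "free_coeff (free_series a :: ('n::finite, 'h) free_fun) = a"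
  using assms by (intro free_coeff_eqI free_series_expansion)

lemma H2_norm_eq: "H2_norm f = l2norm (free_coeff f)"
  by (simp add: H2_norm_def l2norm_def)

lemma free_series_H2:
  assumes "separable_inf_dim TYPE('h::complex_hilbert_space)" "square_summable a"
  shows "(free_series a :: ('n::finite, 'h) free_fun) \<in> H2_ball"
    and "H2_norm (free_series a :: ('n, 'h) free_fun) = l2norm a"
  using assms free_series_expansion[OF assms(2), where 'b = 'h]
  by (auto simp: H2_ball_def free_holomorphic_def H2_norm_eq free_coeff_free_series
      square_summable_def free_series_def)

text \<open>Together with \<open>free_series_H2\<close> this identifies \<open>H2_ball\<close>
  isometrically with l^2 over the words.\<close>

lemma H2_coeff:
  fixes f :: "('n::finite, 'h::complex_hilbert_space) free_fun"
  assumes inf: "separable_inf_dim TYPE('h)" and f: "f \<in> H2_ball"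
  shows "square_summable (free_coeff f)" "f = free_series (free_coeff f)"
proof -
  show s: "square_summable (free_coeff f)"
    using f by (simp add: H2_ball_def square_summable_def)
  obtain a where a: "has_free_expansion f a"
    using f by (auto simp: H2_ball_def free_holomorphic_def)
  then have "free_coeff f = a"
    by (rule free_coeff_eqI[OF inf])
  then have e: "has_free_expansion f (free_coeff f)"
    using a by simp
  show "f = free_series (free_coeff f)"
  proof
    fix X
    show "f X = free_series (free_coeff f) X"
    proof (cases "X \<in> op_ball")
      case True
      then show ?thesis
        using e free_series_sums[OF True s] by (auto simp: has_free_expansion_def sums_unique2)
    next
      case False
      then show ?thesis
        using f by (auto simp: H2_ball_def free_series_def)
    qed
  qed
qed

lemma free_series_add:
  assumes "square_summable a" "square_summable b"
  shows "free_series (\<lambda>\<alpha>. a \<alpha> + b \<alpha>) X = free_series a X + free_series b X"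
proof (cases "X \<in> op_ball")
  case True
  have "(\<lambda>k. \<Sum>\<alpha> | length \<alpha> = k. scale_op (a \<alpha> + b \<alpha>) (op_word X \<alpha>))
      sums (free_series a X + free_series b X)"
    using sums_add[OF free_series_sums[OF True assms(1)] free_series_sums[OF True assms(2)]]
    by (simp add: scale_op_add_left sum.distrib)
  then show ?thesis
    using free_series_sums[OF True square_summable_add(1)[OF assms]] sums_unique2 by blast
qed (simp add: free_series_def)

lemma free_series_scale:
  assumes "square_summable a"
  shows "free_series (\<lambda>\<alpha>. c * a \<alpha>) X = scale_op c (free_series a X)"
proof (cases "X \<in> op_ball")
  case True
  have "(\<lambda>k. \<Sum>\<alpha> | length \<alpha> = k. scale_op (c * a \<alpha>) (op_word X \<alpha>))
      sums scale_op c (free_series a X)"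
    using bounded_linear.sums[OF bounded_linear_scale_op_right free_series_sums[OF True assms], of c]
    by (simp add: scale_op_sum_right scale_op_scale_op)
  then show ?thesis
    using free_series_sums[OF True square_summable_scale[OF assms]] sums_unique2 by blast
qed (simp add: free_series_def)

lemma free_series_diff:
  assumes "square_summable a" "square_summable b"
  shows "free_series (\<lambda>\<alpha>. a \<alpha> - b \<alpha>) X = free_series a X - free_series b X"
proof -
  have "free_series (\<lambda>\<alpha>. a \<alpha> + - 1 * b \<alpha>) X
      = free_series a X + scale_op (- 1) (free_series b X)"
    by (simp only: free_series_add[OF assms(1) square_summable_scale[OF assms(2)]]
        free_series_scale[OF assms(2)])
  then show ?thesis
    by (simp add: scale_op_minus_one)
qed

lemma H2_add:
  fixes f g :: "('n::finite, 'h::complex_hilbert_space) free_fun"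
  assumes "separable_inf_dim TYPE('h)" "f \<in> H2_ball" "g \<in> H2_ball"
  shows "(\<lambda>X. f X + g X) \<in> H2_ball"
    and "free_coeff (\<lambda>X. f X + g X) = (\<lambda>\<alpha>. free_coeff f \<alpha> + free_coeff g \<alpha>)"
proof -
  note f = H2_coeff[OF assms(1,2)] and g = H2_coeff[OF assms(1,3)]
  have *: "(\<lambda>X. f X + g X) = free_series (\<lambda>\<alpha>. free_coeff f \<alpha> + free_coeff g \<alpha>)"
    by (rule ext, subst f(2), subst g(2)) (simp add: free_series_add f(1) g(1))
  show "(\<lambda>X. f X + g X) \<in> H2_ball"
    and "free_coeff (\<lambda>X. f X + g X) = (\<lambda>\<alpha>. free_coeff f \<alpha> + free_coeff g \<alpha>)"
    unfolding * using square_summable_add(1)[OF f(1) g(1)]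
    by (simp_all add: free_series_H2(1) free_coeff_free_series assms(1))
qed

lemma H2_scale:
  fixes f :: "('n::finite, 'h::complex_hilbert_space) free_fun"
  assumes "separable_inf_dim TYPE('h)" "f \<in> H2_ball"
  shows "(\<lambda>X. scale_op c (f X)) \<in> H2_ball"
    and "free_coeff (\<lambda>X. scale_op c (f X)) = (\<lambda>\<alpha>. c * free_coeff f \<alpha>)"
proof -
  note f = H2_coeff[OF assms]
  have *: "(\<lambda>X. scale_op c (f X)) = free_series (\<lambda>\<alpha>. c * free_coeff f \<alpha>)"
    by (rule ext, subst f(2)) (simp add: free_series_scale f(1))
  show "(\<lambda>X. scale_op c (f X)) \<in> H2_ball"
    and "free_coeff (\<lambda>X. scale_op c (f X)) = (\<lambda>\<alpha>. c * free_coeff f \<alpha>)"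
    unfolding * using square_summable_scale[OF f(1), of c]
    by (simp_all add: free_series_H2(1) free_coeff_free_series assms(1))
qed

lemma H2_diff:
  fixes f g :: "('n::finite, 'h::complex_hilbert_space) free_fun"
  assumes "separable_inf_dim TYPE('h)" "f \<in> H2_ball" "g \<in> H2_ball"
  shows "(\<lambda>X. f X - g X) \<in> H2_ball"
    and "free_coeff (\<lambda>X. f X - g X) = (\<lambda>\<alpha>. free_coeff f \<alpha> - free_coeff g \<alpha>)"
proof -
  have eq: "(\<lambda>X. f X - g X) = (\<lambda>X. f X + scale_op (- 1) (g X))"
    by (simp add: scale_op_minus_one)
  note m = H2_scale[OF assms(1,3), of "- 1"]
  show "(\<lambda>X. f X - g X) \<in> H2_ball"
    unfolding eq by (rule H2_add(1)[OF assms(1,2) m(1)])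
  show "free_coeff (\<lambda>X. f X - g X) = (\<lambda>\<alpha>. free_coeff f \<alpha> - free_coeff g \<alpha>)"
    unfolding eq H2_add(2)[OF assms(1,2) m(1)] m(2) by simp
qed

lemma Metric_space_H2:
  assumes inf: "separable_inf_dim TYPE('h::complex_hilbert_space)"
  shows "Metric_space (H2_ball :: ('n::finite, 'h) free_fun set) (\<lambda>f g. H2_norm (\<lambda>X. f X - g X))"
proof
  fix f g h :: "('n, 'h) free_fun"
  show "0 \<le> H2_norm (\<lambda>X. f X - g X)"
    by (simp add: H2_norm_eq)
  \<comment> \<open>\<open>Metric_space\<close> asks for symmetry for all functions, also outside
    \<open>H2_ball\<close>. If neither difference has an expansion, both coefficient families are
    the same definite description of an empty predicate.\<close>
  show "H2_norm (\<lambda>X. f X - g X) = H2_norm (\<lambda>X. g X - f X)"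
  proof -
    have "has_free_expansion (\<lambda>X. f X - g X) a \<Longrightarrow> has_free_expansion (\<lambda>X. g X - f X) (\<lambda>\<alpha>. - a \<alpha>)"
      for f g :: "('n, 'h) free_fun" and a
    proof -
      have "scale_op (- c) T = - scale_op c T" for c and T :: "'h op"
        by (rule blinfun_eqI) (simp add: blinfun.minus_left)
      then show "has_free_expansion (\<lambda>X. f X - g X) a
          \<Longrightarrow> has_free_expansion (\<lambda>X. g X - f X) (\<lambda>\<alpha>. - a \<alpha>)"
        unfolding has_free_expansion_def by (force simp: sum_negf dest: sums_minus)
    qed
    note * = this
    show ?thesis
    proof (cases "\<exists>a. has_free_expansion (\<lambda>X. f X - g X) a")
      case True
      then obtain a where a: "has_free_expansion (\<lambda>X. f X - g X) a" by blast
      show ?thesis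
        unfolding H2_norm_eq free_coeff_eqI[OF inf a] free_coeff_eqI[OF inf *[OF a]]
        using l2norm_scale[of "- 1" a] by simp
    next
      case False
      then have "\<not> has_free_expansion (\<lambda>X. g X - f X) a" for a
        using *[of g f a] by blast
      then have "free_coeff (\<lambda>X. g X - f X) = free_coeff (\<lambda>X. f X - g X)"
        using False by (simp add: free_coeff_def)
      then show ?thesis
        by (simp add: H2_norm_eq)
    qed
  qed
  assume f: "f \<in> H2_ball" and g: "g \<in> H2_ball"
  note cf = H2_coeff[OF inf f] and cg = H2_coeff[OF inf g]
  show "H2_norm (\<lambda>X. f X - g X) = 0 \<longleftrightarrow> f = g"
  proof -
    have "H2_norm (\<lambda>X. f X - g X) = 0 \<longleftrightarrow> (\<lambda>\<alpha>. free_coeff f \<alpha> - free_coeff g \<alpha>) = (\<lambda>\<alpha>. 0)"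
      using l2norm_eq_0_iff square_summable_diff[OF cf(1) cg(1)]
      by (simp add: H2_norm_eq H2_diff(2)[OF inf f g])
    also have "\<dots> \<longleftrightarrow> free_coeff f = free_coeff g"
      by (auto simp: fun_eq_iff)
    also have "\<dots> \<longleftrightarrow> f = g"
    proof
      assume "free_coeff f = free_coeff g"
      then have "(free_series (free_coeff f) :: ('n, 'h) free_fun) = free_series (free_coeff g)"
        by simp
      then show "f = g"
        by (simp only: cf(2)[symmetric] cg(2)[symmetric])
    qed simp
    finally show ?thesis .
  qed
  assume h: "h \<in> H2_ball"
  note ch = H2_coeff[OF inf h]
  show "H2_norm (\<lambda>X. f X - h X) \<le> H2_norm (\<lambda>X. f X - g X) + H2_norm (\<lambda>X. g X - h X)"
    using square_summable_add(2)[OF square_summable_diff[OF cf(1) cg(1)] square_summable_diff[OF cg(1) ch(1)]]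
    by (simp add: H2_norm_eq H2_diff(2)[OF inf f g] H2_diff(2)[OF inf g h] H2_diff(2)[OF inf f h])
qed

text \<open>Grouping words by their first letter; the part of degree k + 1 collects the parts of
  degree k of the series on the right.\<close>

lemma free_series_Cons_split:
  fixes X :: "'n::finite \<Rightarrow> 'h::complex_hilbert_space op"
  assumes X: "X \<in> op_ball" and a: "square_summable a"
  shows "free_series a X
    = scale_op (a []) id_blinfun + (\<Sum>i\<in>UNIV. X i o\<^sub>L free_series (\<lambda>\<alpha>. a (i # \<alpha>)) X)"
proof -
  have "(\<lambda>k. X i o\<^sub>L (\<Sum>\<alpha> | length \<alpha> = k. scale_op (a (i # \<alpha>)) (op_word X \<alpha>)))
      sums (X i o\<^sub>L free_series (\<lambda>\<alpha>. a (i # \<alpha>)) X)" for i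
    by (intro bounded_linear.sums[OF bounded_linear_compose_left] free_series_sums X
        l2norm_Cons_split(1) a)
  then have "(\<lambda>k. \<Sum>i\<in>UNIV. X i o\<^sub>L (\<Sum>\<alpha> | length \<alpha> = k. scale_op (a (i # \<alpha>)) (op_word X \<alpha>)))
      sums (\<Sum>i\<in>UNIV. X i o\<^sub>L free_series (\<lambda>\<alpha>. a (i # \<alpha>)) X)"
    by (intro sums_sum)
  moreover have "(\<Sum>i\<in>UNIV. X i o\<^sub>L (\<Sum>\<alpha> | length \<alpha> = k. scale_op (a (i # \<alpha>)) (op_word X \<alpha>)))
      = (\<Sum>\<alpha> | length \<alpha> = Suc k. scale_op (a \<alpha>) (op_word X \<alpha>))" for k
    unfolding sum_words_Suc
    by (rule sum.cong) (auto intro!: blinfun_eqI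
        simp: blinfun.sum_left blinfun.sum_right op_word_Cons BH_D[OF op_ball_BH[OF X]])
  ultimately have "(\<lambda>k. \<Sum>\<alpha> | length \<alpha> = Suc k. scale_op (a \<alpha>) (op_word X \<alpha>))
      sums (\<Sum>i\<in>UNIV. X i o\<^sub>L free_series (\<lambda>\<alpha>. a (i # \<alpha>)) X)"
    by simp
  then have "(\<lambda>k. \<Sum>\<alpha> | length \<alpha> = k. scale_op (a \<alpha>) (op_word X \<alpha>))
      sums (scale_op (a []) id_blinfun + (\<Sum>i\<in>UNIV. X i o\<^sub>L free_series (\<lambda>\<alpha>. a (i # \<alpha>)) X))"
    by (subst (asm) sums_Suc_iff) (simp add: add.commute)
  with free_series_sums[OF X a] show ?thesis
    by (rule sums_unique2)
qed

text \<open>On coefficients this is right multiplication by the linear form \<Sum> z_i X_i, a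
  combination of the right creation operators.\<close>

definition right_shift :: "('n \<Rightarrow> complex) \<Rightarrow> ('n list \<Rightarrow> complex) \<Rightarrow> 'n list \<Rightarrow> complex" where
  "right_shift z a \<alpha> = (if \<alpha> = [] then 0 else a (butlast \<alpha>) * z (last \<alpha>))"

lemma right_shift_snoc [simp]: "right_shift z a (\<alpha> @ [i]) = a \<alpha> * z i"
  by (simp add: right_shift_def)

lemma free_series_right_shift:
  fixes X :: "'n::finite \<Rightarrow> 'h::complex_hilbert_space op"
  assumes X: "X \<in> op_ball" and a: "square_summable a" and s: "square_summable (right_shift z a)"
  shows "free_series (right_shift z a) X
    = free_series a X o\<^sub>L (\<Sum>i\<in>UNIV. scale_op (z i) (X i))"
proof -
  let ?L = "\<Sum>i\<in>UNIV. scale_op (z i) (X i)"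
  have "(\<lambda>k. (\<Sum>\<alpha> | length \<alpha> = k. scale_op (a \<alpha>) (op_word X \<alpha>)) o\<^sub>L ?L) sums (free_series a X o\<^sub>L ?L)"
    by (intro bounded_linear.sums[OF bounded_linear_compose_right] free_series_sums X a)
  moreover have "(\<Sum>\<alpha> | length \<alpha> = k. scale_op (a \<alpha>) (op_word X \<alpha>)) o\<^sub>L ?L
      = (\<Sum>\<alpha> | length \<alpha> = Suc k. scale_op (right_shift z a \<alpha>) (op_word X \<alpha>))" for k
    unfolding sum_words_Suc_snoc
    by (rule blinfun_eqI) (simp add: blinfun.sum_left blinfun.sum_right op_word_snoc
        BH_D[OF op_word_BH, OF op_ball_BH[OF X]] scaleC_scaleC cvs.scale_sum_right,
        rule sum.swap)
  ultimately have "(\<lambda>k. \<Sum>\<alpha> | length \<alpha> = Suc k. scale_op (right_shift z a \<alpha>) (op_word X \<alpha>))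
      sums (free_series a X o\<^sub>L ?L)"
    by simp
  then have "(\<lambda>k. \<Sum>\<alpha> | length \<alpha> = k. scale_op (right_shift z a \<alpha>) (op_word X \<alpha>))
      sums (free_series a X o\<^sub>L ?L)"
    by (subst (asm) sums_Suc_iff) (simp add: right_shift_def)
  with free_series_sums[OF X s] show ?thesis
    by (rule sums_unique2)
qed

section \<open>Row contractions and point evaluations\<close>

lemma H2_expansion:
  fixes f :: "('n::finite, 'h::complex_hilbert_space) free_fun"
  assumes "separable_inf_dim TYPE('h)" "f \<in> H2_ball"
  shows "has_free_expansion f (free_coeff f)"
  by (subst H2_coeff(2)[OF assms]) (rule free_series_expansion[OF H2_coeff(1)[OF assms]])

lemma op_ball_row_contraction:
  fixes X :: "'n::finite \<Rightarrow> 'h::complex_hilbert_space op"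
  assumes "X \<in> op_ball"
  shows "(norm (\<Sum>i\<in>UNIV. blinfun_apply (X i) (h i)))\<^sup>2 \<le> (\<Sum>i\<in>UNIV. (norm (h i))\<^sup>2)"
proof -
  obtain \<rho> where \<rho>: "0 \<le> \<rho>" "\<rho> < 1"
    and row: "(norm (\<Sum>i\<in>UNIV. blinfun_apply (X i) (h i)))\<^sup>2 \<le> \<rho>\<^sup>2 * (\<Sum>i\<in>UNIV. (norm (h i))\<^sup>2)"
    using assms unfolding op_ball_iff by blast
  have "\<rho>\<^sup>2 * (\<Sum>i\<in>UNIV. (norm (h i))\<^sup>2) \<le> 1 * (\<Sum>i\<in>UNIV. (norm (h i))\<^sup>2)"
    using \<rho> by (intro mult_right_mono) (auto simp: power_le_one sum_nonneg)
  with row show ?thesis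
    by linarith
qed

text \<open>At a truncated shift X, the vector G(X) e_[] is the row \<Phi>(X) applied to the vectors
  B_i(X) e_[]. Both sides of the row inequality are finite sums of squared coefficients weighted by
  powers of r, and r tends to 1.\<close>

lemma H2_row_contraction:
  fixes G :: "('n::finite, 'h::complex_hilbert_space) free_fun"
    and \<Phi> :: "('n \<Rightarrow> 'h op) \<Rightarrow> 'm::finite \<Rightarrow> 'h op"
  assumes inf: "separable_inf_dim TYPE('h)"
    and \<Phi>: "\<And>X. X \<in> op_ball \<Longrightarrow> \<Phi> X \<in> op_ball"
    and G: "G \<in> H2_ball" and B: "\<And>i. B i \<in> H2_ball"
    and eq: "\<And>X. X \<in> op_ball \<Longrightarrow> G X = (\<Sum>i\<in>UNIV. \<Phi> X i o\<^sub>L B i X)"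
  shows "(H2_norm G)\<^sup>2 \<le> (\<Sum>i\<in>UNIV. (H2_norm (B i))\<^sup>2)"
  unfolding H2_norm_eq
proof (rule square_summable_bounded(2))
  let ?g = "free_coeff G" and ?b = "\<lambda>i. free_coeff (B i)"
  let ?C = "\<Sum>i\<in>UNIV. (l2norm (?b i))\<^sup>2"
  fix F :: "'n list set" assume "finite F"
  then obtain d where "F \<subseteq> {\<alpha>. length \<alpha> < d}"
    by (rule finite_words_bounded)
  then have d: "F \<subseteq> {\<alpha>. length \<alpha> \<le> d}"
    by auto
  obtain e :: "'n list \<Rightarrow> 'h" where e: "orthonormal_on {\<alpha>. length \<alpha> \<le> d} e"
    using exists_orthonormal_words[OF inf] by blast
  let ?W = "{\<alpha>::'n list. length \<alpha> \<le> d}"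
  have *: "(\<Sum>\<alpha>\<in>?W. (cmod (?g \<alpha> * complex_of_real (r ^ length \<alpha>)))\<^sup>2) \<le> ?C"
    if r: "0 \<le> r" "r < 1" for r
  proof -
    let ?X = "trunc_shift e d r"
    have X: "?X \<in> op_ball"
      by (rule trunc_shift_in_op_ball[OF e r])
    have "(\<Sum>\<alpha>\<in>?W. (cmod (?g \<alpha> * complex_of_real (r ^ length \<alpha>)))\<^sup>2)
        = (norm (blinfun_apply (G ?X) (e [])))\<^sup>2"
      unfolding has_free_expansion_trunc_shift[OF H2_expansion[OF inf G] e r]
      by (rule norm_sum_orthonormal[symmetric, OF e]) simp
    also have "blinfun_apply (G ?X) (e []) = (\<Sum>i\<in>UNIV. blinfun_apply (\<Phi> ?X i) (blinfun_apply (B i ?X) (e [])))"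
      by (simp add: eq[OF X] blinfun.sum_left)
    also have "(norm \<dots>)\<^sup>2 \<le> (\<Sum>i\<in>UNIV. (norm (blinfun_apply (B i ?X) (e [])))\<^sup>2)"
      by (rule op_ball_row_contraction[OF \<Phi>[OF X]])
    also have "\<dots> = (\<Sum>i\<in>UNIV. \<Sum>\<alpha>\<in>?W. (cmod (?b i \<alpha> * complex_of_real (r ^ length \<alpha>)))\<^sup>2)"
      unfolding has_free_expansion_trunc_shift[OF H2_expansion[OF inf B] e r]
      by (subst norm_sum_orthonormal[OF e]) simp_all
    also have "\<dots> \<le> (\<Sum>i\<in>UNIV. \<Sum>\<alpha>\<in>?W. (cmod (?b i \<alpha>))\<^sup>2)"
    proof (intro sum_mono power_mono)
      fix i \<alpha>
      have "cmod (?b i \<alpha>) * r ^ length \<alpha> \<le> cmod (?b i \<alpha>) * 1"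
        using r by (intro mult_left_mono) (auto simp: power_le_one)
      then show "cmod (?b i \<alpha> * complex_of_real (r ^ length \<alpha>)) \<le> cmod (?b i \<alpha>)"
        using r by (simp add: norm_mult norm_power)
    qed simp
    also have "\<dots> \<le> ?C"
      by (intro sum_mono sum_le_l2norm_sq H2_coeff(1)[OF inf B]) simp
    finally show ?thesis .
  qed
  \<comment> \<open>The cut-off d stays fixed while r tends to 1, so only a finite sum passes to the
    limit.\<close>
  have lim: "((\<lambda>r. \<Sum>\<alpha>\<in>?W. (cmod (?g \<alpha> * complex_of_real (r ^ length \<alpha>)))\<^sup>2)
      \<longlongrightarrow> (\<Sum>\<alpha>\<in>?W. (cmod (?g \<alpha> * complex_of_real (1 ^ length \<alpha>)))\<^sup>2)) (at_left 1)"
    by (intro tendsto_intros)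
  have "eventually (\<lambda>r::real. 0 < r \<and> r < 1) (at_left 1)"
    using eventually_at_left_real[of 0 1] by simp
  then have "\<forall>\<^sub>F r in at_left 1. (\<Sum>\<alpha>\<in>?W. (cmod (?g \<alpha> * complex_of_real (r ^ length \<alpha>)))\<^sup>2) \<le> ?C"
    by eventually_elim (simp only: *[OF less_imp_le])
  then have "(\<Sum>\<alpha>\<in>?W. (cmod (?g \<alpha>))\<^sup>2) \<le> ?C"
    using tendsto_upperbound[OF lim] by simp
  moreover have "(\<Sum>\<alpha>\<in>F. (cmod (?g \<alpha>))\<^sup>2) \<le> (\<Sum>\<alpha>\<in>?W. (cmod (?g \<alpha>))\<^sup>2)"
    using d by (intro sum_mono2) auto
  ultimately show "(\<Sum>\<alpha>\<in>F. (cmod (?g \<alpha>))\<^sup>2) \<le> ?C"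
    by linarith
qed

section \<open>Scalar points, point evaluations and kernels\<close>

definition scalar_point :: "('n \<Rightarrow> complex) \<Rightarrow> 'n \<Rightarrow> 'h::complex_hilbert_space op" where
  "scalar_point z i = scale_op (z i) id_blinfun"

definition word_val :: "('n \<Rightarrow> complex) \<Rightarrow> 'n list \<Rightarrow> complex" where
  "word_val z \<alpha> = prod_list (map z \<alpha>)"

definition pt_eval :: "('n list \<Rightarrow> complex) \<Rightarrow> ('n \<Rightarrow> complex) \<Rightarrow> complex" where
  "pt_eval a z = (\<Sum>\<^sub>\<infinity>\<alpha>. a \<alpha> * word_val z \<alpha>)"

text \<open>The reproducing kernel: the inner product of a with \<open>kern z\<close> is
  \<open>pt_eval a z\<close>, and its squared norm is 1 / (1 - |z|^2).\<close>

definition kern :: "('n \<Rightarrow> complex) \<Rightarrow> 'n list \<Rightarrow> complex" where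
  "kern z \<alpha> = cnj (word_val z \<alpha>)"

lemma op_word_scalar_point: "op_word (scalar_point z) \<alpha> = scale_op (word_val z \<alpha>) id_blinfun"
  by (induction \<alpha>) (auto simp: word_val_def op_word_Cons scalar_point_def scaleC_scaleC intro!: blinfun_eqI)

lemma norm_sum_scaleC_le:
  fixes h :: "'n \<Rightarrow> 'h::complex_hilbert_space"
  shows "(norm (\<Sum>i\<in>A. z i *\<^sub>C h i))\<^sup>2 \<le> (\<Sum>i\<in>A. (cmod (z i))\<^sup>2) * (\<Sum>i\<in>A. (norm (h i))\<^sup>2)"
proof -
  have "norm (\<Sum>i\<in>A. z i *\<^sub>C h i) \<le> (\<Sum>i\<in>A. cmod (z i) * norm (h i))"
    by (rule sum_norm_le) (simp add: norm_scaleC)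
  then have "(norm (\<Sum>i\<in>A. z i *\<^sub>C h i))\<^sup>2 \<le> (\<Sum>i\<in>A. cmod (z i) * norm (h i))\<^sup>2"
    by (rule power_mono) simp
  also have "\<dots> \<le> (\<Sum>i\<in>A. (cmod (z i))\<^sup>2) * (\<Sum>i\<in>A. (norm (h i))\<^sup>2)"
    by (rule Cauchy_Schwarz_ineq_sum)
  finally show ?thesis .
qed

lemma scalar_point_apply [simp]: "blinfun_apply (scalar_point z i) x = z i *\<^sub>C x"
  by (simp add: scalar_point_def)

lemma scalar_point_in_op_ball:
  fixes z :: "'n::finite \<Rightarrow> complex"
  assumes "(\<Sum>i\<in>UNIV. (cmod (z i))\<^sup>2) < 1"
  shows "(scalar_point z :: 'n \<Rightarrow> 'h::complex_hilbert_space op) \<in> op_ball"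
  unfolding op_ball_iff
proof (intro conjI allI exI[of _ "sqrt (\<Sum>i\<in>UNIV. (cmod (z i))\<^sup>2)"])
  show "(scalar_point z i :: 'h op) \<in> BH" for i
    by (simp add: scalar_point_def BH_scale)
qed (use assms in \<open>auto simp: sum_nonneg norm_sum_scaleC_le\<close>)

text \<open>Testing the row on h_i = cnj z_i e with a unit vector e gives s^2 \<le> \<rho>^2 s for s
  = |z|^2.\<close>

lemma scalar_point_in_op_ball_D:
  fixes z :: "'n::finite \<Rightarrow> complex"
  assumes inf: "separable_inf_dim TYPE('h::complex_hilbert_space)"
    and "(scalar_point z :: 'n \<Rightarrow> 'h op) \<in> op_ball"
  shows "(\<Sum>i\<in>UNIV. (cmod (z i))\<^sup>2) < 1"
proof -
  define s where "s = (\<Sum>i\<in>UNIV. (cmod (z i))\<^sup>2)"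
  have s0: "s \<ge> 0"
    by (simp add: s_def sum_nonneg)
  obtain e :: "'n list \<Rightarrow> 'h" where "orthonormal_on {\<alpha>. length \<alpha> \<le> 0} e"
    using exists_orthonormal_words[OF inf] by blast
  then have "cinner (e []) (e []) = 1"
    by (simp add: orthonormal_on_def)
  then have "complex_of_real ((norm (e []))\<^sup>2) = complex_of_real 1"
    by (simp only: cinner_self of_real_1)
  then have ne: "(norm (e []))\<^sup>2 = 1"
    using of_real_eq_iff by blast
  obtain \<rho> where \<rho>: "0 \<le> \<rho>" "\<rho> < 1"
    and row: "\<And>h::'n \<Rightarrow> 'h. (norm (\<Sum>i\<in>UNIV. z i *\<^sub>C h i))\<^sup>2 \<le> \<rho>\<^sup>2 * (\<Sum>i\<in>UNIV. (norm (h i))\<^sup>2)"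
    using assms(2) unfolding op_ball_iff by auto
  have eq: "(\<Sum>i\<in>UNIV. z i *\<^sub>C cnj (z i) *\<^sub>C e []) = complex_of_real s *\<^sub>C e []"
    unfolding s_def of_real_sum cvs.scale_sum_left
    by (intro sum.cong refl) (simp only: scaleC_scaleC complex_norm_square)
  have "(norm (complex_of_real s *\<^sub>C e []))\<^sup>2
      \<le> \<rho>\<^sup>2 * (\<Sum>i\<in>UNIV. (norm (cnj (z i) *\<^sub>C e []))\<^sup>2)"
    using row[of "\<lambda>i. cnj (z i) *\<^sub>C e []"] unfolding eq .
  moreover have "(\<Sum>i\<in>UNIV. (norm (cnj (z i) *\<^sub>C e []))\<^sup>2) = s * (norm (e []))\<^sup>2"
    by (simp add: norm_scaleC power_mult_distrib s_def sum_distrib_right)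
  ultimately have "s\<^sup>2 * (norm (e []))\<^sup>2 \<le> \<rho>\<^sup>2 * (s * (norm (e []))\<^sup>2)"
    using s0 by (simp add: norm_scaleC power_mult_distrib)
  then have "s * s \<le> \<rho>\<^sup>2 * s"
    by (simp add: ne power2_eq_square[of s])
  moreover have "\<rho>\<^sup>2 < 1"
    using \<rho> by (simp add: abs_square_less_1)
  ultimately have "s < 1"
    using s0 by (cases "s = 0") auto
  then show ?thesis
    by (simp add: s_def)
qed

lemma sum_word_val_sq:
  fixes z :: "'n::finite \<Rightarrow> complex"
  shows "(\<Sum>\<alpha> | length \<alpha> = k. (cmod (word_val z \<alpha>))\<^sup>2) = (\<Sum>i\<in>UNIV. (cmod (z i))\<^sup>2) ^ k"
proof (induction k)
  case (Suc k)
  have "(\<Sum>\<alpha> | length \<alpha> = Suc k. (cmod (word_val z \<alpha>))\<^sup>2)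
      = (\<Sum>i\<in>UNIV. (cmod (z i))\<^sup>2 * (\<Sum>\<beta> | length \<beta> = k. (cmod (word_val z \<beta>))\<^sup>2))"
    unfolding sum_words_Suc sum_distrib_left
    by (simp add: word_val_def norm_mult power_mult_distrib)
  then show ?case
    by (simp add: Suc.IH sum_distrib_right)
qed (simp add: word_val_def)

text \<open>The words of length k contribute |z|^(2k), so the total is a geometric series.\<close>

lemma square_summable_word_val:
  fixes z :: "'n::finite \<Rightarrow> complex"
  assumes "(\<Sum>i\<in>UNIV. (cmod (z i))\<^sup>2) < 1"
  shows "square_summable (word_val z)"
    and "(l2norm (word_val z))\<^sup>2 = 1 / (1 - (\<Sum>i\<in>UNIV. (cmod (z i))\<^sup>2))"
proof -
  define s where "s = (\<Sum>i\<in>UNIV. (cmod (z i))\<^sup>2)"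
  have s: "0 \<le> s" "s < 1"
    using assms by (simp_all add: s_def sum_nonneg)
  have geo: "(\<lambda>k. s ^ k) sums (1 / (1 - s))"
    using s by (intro geometric_sums) simp
  show 1: "square_summable (word_val z)"
  proof (rule square_summable_bounded(1))
    fix F :: "'n list set" assume "finite F"
    then obtain d where d: "F \<subseteq> {\<alpha>. length \<alpha> < d}"
      by (rule finite_words_bounded)
    have "(\<Sum>\<alpha>\<in>F. (cmod (word_val z \<alpha>))\<^sup>2) \<le> (\<Sum>\<alpha> | length \<alpha> < d. (cmod (word_val z \<alpha>))\<^sup>2)"
      using d by (intro sum_mono2) auto
    also have "\<dots> = (\<Sum>k<d. s ^ k)"
      by (simp add: sum_words_less sum_word_val_sq s_def)
    also have "\<dots> \<le> 1 / (1 - s)"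
      using sum_le_suminf[OF sums_summable[OF geo], of "{..<d}"] s by (simp add: sums_unique[OF geo, symmetric])
    finally show "(\<Sum>\<alpha>\<in>F. (cmod (word_val z \<alpha>))\<^sup>2) \<le> 1 / (1 - s)" .
  qed
  have "((\<lambda>\<alpha>. (cmod (word_val z \<alpha>))\<^sup>2) has_sum (l2norm (word_val z))\<^sup>2) UNIV"
    using 1 by (simp add: l2norm_sq square_summable_def)
  from has_sum_words[OF this] have "(\<lambda>k. s ^ k) sums (l2norm (word_val z))\<^sup>2"
    by (simp add: sum_word_val_sq s_def)
  with geo show "(l2norm (word_val z))\<^sup>2 = 1 / (1 - (\<Sum>i\<in>UNIV. (cmod (z i))\<^sup>2))"
    unfolding s_def[symmetric] by (rule sums_unique2[symmetric])
qed

lemma l2norm_kern: "l2norm (kern z) = l2norm (word_val z)"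
  by (simp add: l2norm_def kern_def)

lemma square_summable_kern:
  fixes z :: "'n::finite \<Rightarrow> complex"
  assumes "(\<Sum>i\<in>UNIV. (cmod (z i))\<^sup>2) < 1"
  shows "square_summable (kern z)"
  using square_summable_word_val(1)[OF assms] by (simp add: square_summable_def kern_def)

lemma pt_eval_kern:
  fixes z :: "'n::finite \<Rightarrow> complex"
  assumes "(\<Sum>i\<in>UNIV. (cmod (z i))\<^sup>2) < 1"
  shows "pt_eval (kern z) z = complex_of_real ((l2norm (kern z))\<^sup>2)"
proof -
  have "kern z \<alpha> * word_val z \<alpha> = complex_of_real ((cmod (kern z \<alpha>))\<^sup>2)" for \<alpha>
    unfolding complex_norm_square by (simp add: kern_def)
  then have "pt_eval (kern z) z = (\<Sum>\<^sub>\<infinity>\<alpha>. complex_of_real ((cmod (kern z \<alpha>))\<^sup>2))"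
    by (simp only: pt_eval_def)
  also have "\<dots> = complex_of_real ((l2norm (kern z))\<^sup>2)"
    unfolding l2norm_sq using square_summable_kern[OF assms]
    by (intro infsumI has_sum_of_real has_sum_infsum) (simp add: square_summable_def)
  finally show ?thesis .
qed

lemma pt_eval_sums:
  fixes z :: "'n::finite \<Rightarrow> complex"
  assumes "(\<Sum>i\<in>UNIV. (cmod (z i))\<^sup>2) < 1" "square_summable a"
  shows "(\<lambda>k. \<Sum>\<alpha> | length \<alpha> = k. a \<alpha> * word_val z \<alpha>) sums pt_eval a z"
  unfolding pt_eval_def
  by (intro has_sum_words has_sum_infsum square_summable_mult square_summable_word_val assms)

lemma cmod_pt_eval_le:
  fixes z :: "'n::finite \<Rightarrow> complex"
  assumes "(\<Sum>i\<in>UNIV. (cmod (z i))\<^sup>2) < 1" "square_summable a"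
  shows "cmod (pt_eval a z) \<le> l2norm a * l2norm (kern z)"
  unfolding pt_eval_def l2norm_kern
  by (intro square_summable_mult square_summable_word_val assms)

lemma pt_eval_add:
  fixes z :: "'n::finite \<Rightarrow> complex"
  assumes "(\<Sum>i\<in>UNIV. (cmod (z i))\<^sup>2) < 1" "square_summable a" "square_summable b"
  shows "pt_eval (\<lambda>\<alpha>. a \<alpha> + b \<alpha>) z = pt_eval a z + pt_eval b z"
  unfolding pt_eval_def distrib_right
  by (intro infsum_add square_summable_mult(2) square_summable_word_val assms)

lemma pt_eval_scale: "pt_eval (\<lambda>\<alpha>. c * a \<alpha>) z = c * pt_eval a z"
  by (simp add: pt_eval_def mult.assoc infsum_cmult_right')

lemma free_series_scalar_point:
  fixes z :: "'n::finite \<Rightarrow> complex"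
  assumes "(\<Sum>i\<in>UNIV. (cmod (z i))\<^sup>2) < 1" "square_summable a"
  shows "free_series a (scalar_point z :: 'n \<Rightarrow> 'h::complex_hilbert_space op)
    = scale_op (pt_eval a z) id_blinfun"
proof -
  have "(\<lambda>k. scale_op (\<Sum>\<alpha> | length \<alpha> = k. a \<alpha> * word_val z \<alpha>) (id_blinfun :: 'h op))
      sums scale_op (pt_eval a z) id_blinfun"
    by (rule bounded_linear.sums[OF bounded_linear_scale_op_left pt_eval_sums[OF assms]])
  then have "(\<lambda>k. \<Sum>\<alpha> | length \<alpha> = k. scale_op (a \<alpha>) (op_word (scalar_point z) \<alpha> :: 'h op))
      sums scale_op (pt_eval a z) id_blinfun"
    by (simp add: op_word_scalar_point scale_op_scale_op scale_op_sum_left)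
  with free_series_sums[OF scalar_point_in_op_ball[OF assms(1)] assms(2)] show ?thesis
    by (rule sums_unique2)
qed

lemma scale_id_inject:
  assumes inf: "separable_inf_dim TYPE('h::complex_hilbert_space)"
    and "scale_op c (id_blinfun :: 'h op) = scale_op d id_blinfun"
  shows "c = d"
proof -
  obtain e :: "nat \<Rightarrow> 'h" where "orthonormal_on {..<1} e"
    using exists_orthonormal_nat inf unfolding separable_inf_dim_def by blast
  then have e: "cinner (e 0) (e 0) = 1"
    by (simp add: orthonormal_on_def)
  have "c *\<^sub>C e 0 = d *\<^sub>C e 0"
    using arg_cong[OF assms(2), of "\<lambda>T. blinfun_apply T (e 0)"] by simp
  then have "cinner (c *\<^sub>C e 0) (e 0) = cinner (d *\<^sub>C e 0) (e 0)"
    by (rule arg_cong)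
  then show ?thesis
    by (simp add: cinner_scaleC_left e)
qed

text \<open>Cauchy-Schwarz in each degree gives the majorant |a| r^k, so evaluation is a uniform
  limit of polynomials on the closed ball. Points are taken in \<open>complex^'n\<close> because
  Brouwer's theorem will be applied there.\<close>

lemma continuous_on_pt_eval:
  fixes a :: "'n::finite list \<Rightarrow> complex"
  assumes a: "square_summable a" and r: "0 \<le> r" "r < 1"
  shows "continuous_on (cball 0 r) (\<lambda>z::complex^'n. pt_eval a (($) z))"
proof -
  have norm_sq: "(\<Sum>i\<in>UNIV. (cmod (z $ i))\<^sup>2) = (norm z)\<^sup>2" for z :: "complex^'n"
    by (simp add: norm_vec_def L2_set_def sum_nonneg)
  have lt: "(\<Sum>i\<in>UNIV. (cmod (z $ i))\<^sup>2) < 1" if "z \<in> cball 0 r" for z :: "complex^'n"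
    using that r unfolding norm_sq by (simp add: abs_square_less_1)
  have "uniform_limit (cball 0 r)
      (\<lambda>d (z::complex^'n). \<Sum>k<d. \<Sum>\<alpha> | length \<alpha> = k. a \<alpha> * word_val (($) z) \<alpha>)
      (\<lambda>z. \<Sum>k. \<Sum>\<alpha> | length \<alpha> = k. a \<alpha> * word_val (($) z) \<alpha>) sequentially"
  proof (rule Weierstrass_m_test)
    fix k and z :: "complex^'n" assume z: "z \<in> cball 0 r"
    have "norm (\<Sum>\<alpha> | length \<alpha> = k. a \<alpha> * word_val (($) z) \<alpha>)
        \<le> (\<Sum>\<alpha> | length \<alpha> = k. cmod (a \<alpha>) * cmod (word_val (($) z) \<alpha>))"
      by (rule sum_norm_le) (simp add: norm_mult)
    also have "\<dots> \<le> L2_set (\<lambda>\<alpha>. cmod (a \<alpha>)) {\<alpha>. length \<alpha> = k}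
        * L2_set (\<lambda>\<alpha>. cmod (word_val (($) z) \<alpha>)) {\<alpha>. length \<alpha> = k}"
      using L2_set_mult_ineq[of "\<lambda>\<alpha>. cmod (a \<alpha>)" "\<lambda>\<alpha>. cmod (word_val (($) z) \<alpha>)"] by simp
    also have "L2_set (\<lambda>\<alpha>. cmod (word_val (($) z) \<alpha>)) {\<alpha>. length \<alpha> = k} = norm z ^ k"
      by (simp add: L2_set_def sum_word_val_sq norm_sq real_sqrt_power)
    also have "L2_set (\<lambda>\<alpha>. cmod (a \<alpha>)) {\<alpha>. length \<alpha> = k} * norm z ^ k \<le> l2norm a * r ^ k"
      using z by (intro mult_mono L2_set_le_l2norm a power_mono) auto
    finally show "norm (\<Sum>\<alpha> | length \<alpha> = k. a \<alpha> * word_val (($) z) \<alpha>) \<le> l2norm a * r ^ k" .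
  next
    show "summable (\<lambda>k. l2norm a * r ^ k)"
      using r by (intro summable_mult summable_geometric) auto
  qed
  moreover have "continuous_on (cball 0 r) (\<lambda>z::complex^'n. word_val (($) z) \<alpha>)" for \<alpha>
    unfolding word_val_def by (induction \<alpha>) (auto intro!: continuous_intros)
  ultimately have "continuous_on (cball 0 r)
      (\<lambda>z::complex^'n. \<Sum>k. \<Sum>\<alpha> | length \<alpha> = k. a \<alpha> * word_val (($) z) \<alpha>)"
    by (intro uniform_limit_theorem) (auto intro!: always_eventually continuous_intros)
  then show ?thesis
    by (rule continuous_on_eq) (rule sums_unique[symmetric, OF pt_eval_sums[OF lt a]])
qed

section \<open>Compactness gives a scalar fixed point\<close>

lemma H2_norm_scale:
  fixes f :: "('n::finite, 'h::complex_hilbert_space) free_fun"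
  assumes "separable_inf_dim TYPE('h)" "f \<in> H2_ball"
  shows "H2_norm (\<lambda>X. scale_op c (f X)) = cmod c * H2_norm f"
  by (simp add: H2_norm_eq H2_scale(2)[OF assms] l2norm_scale)

text \<open>Evaluation grows more slowly than the norm of the kernel: a polynomial head stays
  bounded on the ball, and the tail has small norm. In other words, normalised kernels tend weakly
  to 0 at the boundary.\<close>

lemma cmod_pt_eval_le_head_tail:
  fixes a :: "'n::finite list \<Rightarrow> complex"
  assumes a: "square_summable a" and "\<epsilon> > 0"
  shows "\<exists>C. \<forall>z. (\<Sum>i\<in>UNIV. (cmod (z i))\<^sup>2) < 1 \<longrightarrow> cmod (pt_eval a z) \<le> C + \<epsilon> * l2norm (kern z)"
proof -
  obtain d where d: "l2norm (\<lambda>\<alpha>. if length \<alpha> < d then 0 else a \<alpha>) < \<epsilon>"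
    using l2norm_tail[OF assms] by blast
  let ?h = "\<lambda>\<alpha>. if length \<alpha> < d then a \<alpha> else 0"
  let ?t = "\<lambda>\<alpha>. if length \<alpha> < d then 0 else a \<alpha>"
  let ?C = "\<Sum>\<alpha> | length \<alpha> < d. cmod (a \<alpha>)"
  have h: "square_summable ?h" and t: "square_summable ?t"
    by (rule l2norm_mono(1)[OF a], simp)+
  have "cmod (pt_eval a z) \<le> ?C + \<epsilon> * l2norm (kern z)"
    if z: "(\<Sum>i\<in>UNIV. (cmod (z i))\<^sup>2) < 1" for z
  proof -
    have "a = (\<lambda>\<alpha>. ?h \<alpha> + ?t \<alpha>)"
      by auto
    then have "pt_eval a z = pt_eval ?h z + pt_eval ?t z"
      using pt_eval_add[OF z h t] by simp
    then have "cmod (pt_eval a z) \<le> cmod (pt_eval ?h z) + cmod (pt_eval ?t z)"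
      by (simp add: norm_triangle_ineq)
    also have "cmod (pt_eval ?t z) \<le> \<epsilon> * l2norm (kern z)"
    proof -
      have "cmod (pt_eval ?t z) \<le> l2norm ?t * l2norm (kern z)"
        by (rule cmod_pt_eval_le[OF z t])
      also have "\<dots> \<le> \<epsilon> * l2norm (kern z)"
        using d by (intro mult_right_mono) auto
      finally show ?thesis .
    qed
    also have "cmod (pt_eval ?h z) \<le> ?C"
    proof -
      have zi: "cmod (z i) \<le> 1" for i
      proof -
        have "(cmod (z i))\<^sup>2 \<le> (\<Sum>i\<in>UNIV. (cmod (z i))\<^sup>2)"
          by (rule member_le_sum) auto
        with z have "(cmod (z i))\<^sup>2 \<le> 1\<^sup>2"
          by simp
        then show ?thesis
          by (rule power2_le_imp_le) simp
      qed
      have w: "cmod (word_val z \<alpha>) \<le> 1" for \<alpha>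
        by (induction \<alpha>) (auto simp: word_val_def norm_mult intro!: mult_le_one zi)
      have "pt_eval ?h z = (\<Sum>\<alpha> | length \<alpha> < d. a \<alpha> * word_val z \<alpha>)"
        unfolding pt_eval_def
        by (rule infsumI, rule has_sum_finite_neutralI[of "{\<alpha>. length \<alpha> < d}"]) auto
      also have "cmod \<dots> \<le> ?C"
        using w by (intro sum_norm_le) (simp add: norm_mult mult_left_le)
      finally show ?thesis .
    qed
    finally show ?thesis
      by simp
  qed
  then show ?thesis
    by blast
qed

text \<open>Its image under \<open>comp_op \<phi>\<close> is the i-th component of \<phi> on the
  ball, which gives access to the coefficients of \<phi>.\<close>

definition coordinate :: "'n::finite \<Rightarrow> ('n, 'h::complex_hilbert_space) free_fun" where
  "coordinate i = free_series (\<lambda>\<alpha>. if \<alpha> = [i] then 1 else 0)"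

lemma square_summable_single: "square_summable (\<lambda>\<alpha>. if \<alpha> = \<beta> then 1 else 0)"
  by (rule finite_support_square_summable) (auto intro: finite_subset[of _ "{\<beta>}"])

lemma coordinate_apply:
  assumes "X \<in> op_ball"
  shows "coordinate i X = X i"
proof -
  let ?t = "\<lambda>k. \<Sum>\<alpha> | length \<alpha> = k. scale_op (if \<alpha> = [i] then 1 else 0) (op_word X \<alpha>)"
  have "?t k = (if k = 1 then X i else 0)" for k
  proof -
    have "?t k = (\<Sum>\<alpha> | length \<alpha> = k. if \<alpha> = [i] then X i else 0)"
      by (rule sum.cong) (auto simp: op_word_Cons intro!: blinfun_eqI)
    then show ?thesis
      by auto
  qed
  then have "?t sums X i"
    using sums_single[of 1 "\<lambda>_. X i"] by simp
  with free_series_sums[OF assms square_summable_single] show ?thesis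
    unfolding coordinate_def by (rule sums_unique2)
qed

section \<open>A compact composition operator and its action on scalar points\<close>

locale compact_composition =
  fixes \<phi> :: "('n::finite \<Rightarrow> 'h::complex_hilbert_space op) \<Rightarrow> ('n \<Rightarrow> 'h op)"
  assumes inf: "separable_inf_dim TYPE('h)"
    and self_map: "\<And>X. X \<in> op_ball \<Longrightarrow> \<phi> X \<in> op_ball"
    and compact: "H2_compact (comp_op \<phi>)"
begin

abbreviation "T \<equiv> comp_op \<phi>"

lemma T_H2: "f \<in> H2_ball \<Longrightarrow> T f \<in> H2_ball"
  using compact by (simp add: H2_compact_def H2_linear_def)

lemma T_apply: "X \<in> op_ball \<Longrightarrow> T f X = f (\<phi> X)"
  by (simp add: comp_op_def)

interpretation M: Metric_space "H2_ball :: ('n, 'h) free_fun set" "\<lambda>f g. H2_norm (\<lambda>X. f X - g X)"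
  by (rule Metric_space_H2[OF inf])

lemma T_image_closure:
  defines "K \<equiv> H2_topology closure_of (T ` {f \<in> H2_ball. H2_norm f \<le> 1})"
  shows "compactin M.mtopology K" "T ` {f \<in> H2_ball. H2_norm f \<le> 1} \<subseteq> K"
proof -
  have top: "(H2_topology :: ('n, 'h) free_fun topology) = M.mtopology"
    by (simp add: H2_topology_def)
  show "compactin M.mtopology K"
    using compact unfolding K_def H2_compact_def top by blast
  show "T ` {f \<in> H2_ball. H2_norm f \<le> 1} \<subseteq> K"
    unfolding K_def top by (rule closure_of_subset) (auto simp: T_H2)
qed

lemma zero_H2: "(\<lambda>X. 0) \<in> (H2_ball :: ('n, 'h) free_fun set)" "H2_norm (\<lambda>X::'n \<Rightarrow> 'h op. 0 :: 'h op) = 0"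
proof -
  have "(free_series (\<lambda>\<alpha>. 0) :: ('n, 'h) free_fun) = (\<lambda>X. 0)"
    by (auto simp: free_series_def)
  with free_series_H2[OF inf square_summable_zero, where 'n = 'n]
  show "(\<lambda>X. 0) \<in> (H2_ball :: ('n, 'h) free_fun set)" "H2_norm (\<lambda>X::'n \<Rightarrow> 'h op. 0 :: 'h op) = 0"
    by simp_all
qed

text \<open>A compact set is metrically bounded. Comparison with the image of 0 turns a bound on
  distances into a bound on norms over the unit ball, and homogeneity extends it.\<close>

lemma T_bounded: "\<exists>B\<ge>0. \<forall>f\<in>H2_ball. H2_norm (T f) \<le> B * H2_norm f"
proof -
  have "M.mbounded (T ` {f \<in> H2_ball. H2_norm f \<le> 1})"
    using M.compactin_imp_mbounded[OF T_image_closure(1)] T_image_closure(2) M.mbounded_subset by blast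
  then obtain B where B: "\<And>f g. f \<in> H2_ball \<Longrightarrow> g \<in> H2_ball \<Longrightarrow> H2_norm f \<le> 1 \<Longrightarrow> H2_norm g \<le> 1
      \<Longrightarrow> H2_norm (\<lambda>X. T f X - T g X) \<le> B"
    unfolding M.mbounded_alt by blast
  have T0: "T (\<lambda>X. 0) = (\<lambda>X. 0)"
    by (auto simp: comp_op_def)
  have B1: "H2_norm (T f) \<le> B" if "f \<in> H2_ball" "H2_norm f \<le> 1" for f
    using B[OF that(1) zero_H2(1) that(2)] zero_H2(2) by (simp add: T0)
  have "0 \<le> B"
    using B1[OF zero_H2(1)] zero_H2(2) by (simp add: T0)
  moreover have "H2_norm (T f) \<le> B * H2_norm f" if f: "f \<in> H2_ball" for f
  proof (cases "H2_norm f = 0")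
    case True
    then have "f = (\<lambda>X. 0)"
      using M.zero[OF f zero_H2(1)] by simp
    then show ?thesis
      by (simp add: T0 zero_H2(2))
  next
    case False
    define s where "s = H2_norm f"
    have s: "s > 0"
      using False by (simp add: s_def H2_norm_eq order_less_le)
    let ?c = "complex_of_real (1 / s)"
    have "H2_norm (\<lambda>X. scale_op ?c (f X)) \<le> 1"
      using s by (simp add: H2_norm_scale[OF inf f] norm_divide flip: s_def)
    from B1[OF H2_scale(1)[OF inf f] this] have "H2_norm (T (\<lambda>X. scale_op ?c (f X))) \<le> B" .
    also have "T (\<lambda>X. scale_op ?c (f X)) = (\<lambda>X. scale_op ?c (T f X))"
      by (auto simp: comp_op_def)
    finally show ?thesis
      using s by (simp add: H2_norm_scale[OF inf T_H2[OF f]] norm_divide field_simps flip: s_def)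
  qed
  ultimately show ?thesis
    by blast
qed

text \<open>The restriction of \<phi> to scalar points, read as a self-map of the Euclidean unit
  ball of C^n.\<close>

definition scalar_map :: "('n \<Rightarrow> complex) \<Rightarrow> 'n \<Rightarrow> complex" where
  "scalar_map z i = pt_eval (free_coeff (T (coordinate i))) z"

lemma coordinate_H2: "(coordinate i :: ('n, 'h) free_fun) \<in> H2_ball"
  unfolding coordinate_def by (rule free_series_H2(1)[OF inf square_summable_single])

lemma H2_scalar_point:
  assumes "f \<in> H2_ball" "(\<Sum>i\<in>UNIV. (cmod (z i))\<^sup>2) < 1"
  shows "f (scalar_point z :: 'n \<Rightarrow> 'h op) = scale_op (pt_eval (free_coeff f) z) id_blinfun"
  by (subst H2_coeff(2)[OF inf assms(1)])
    (rule free_series_scalar_point[OF assms(2) H2_coeff(1)[OF inf assms(1)]])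

text \<open>Every function in \<open>H2_ball\<close> takes a multiple of the identity as its value
  at a scalar point; this applies to the components of \<phi>.\<close>

lemma \<phi>_scalar_point:
  assumes z: "(\<Sum>i\<in>UNIV. (cmod (z i))\<^sup>2) < 1"
  shows "\<phi> (scalar_point z) = scalar_point (scalar_map z)"
proof
  fix i
  have X: "(scalar_point z :: 'n \<Rightarrow> 'h op) \<in> op_ball"
    by (rule scalar_point_in_op_ball[OF z])
  have "T (coordinate i) (scalar_point z) = scale_op (scalar_map z i) id_blinfun"
    unfolding scalar_map_def by (rule H2_scalar_point[OF T_H2[OF coordinate_H2] z])
  then show "\<phi> (scalar_point z) i = scalar_point (scalar_map z) i"
    by (simp add: T_apply[OF X] coordinate_apply[OF self_map[OF X]] scalar_point_def)
qed

lemma scalar_map_in_ball: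
  assumes z: "(\<Sum>i\<in>UNIV. (cmod (z i))\<^sup>2) < 1"
  shows "(\<Sum>i\<in>UNIV. (cmod (scalar_map z i))\<^sup>2) < 1"
  using self_map[OF scalar_point_in_op_ball[OF z]] \<phi>_scalar_point[OF z]
  by (intro scalar_point_in_op_ball_D[OF inf]) simp

text \<open>The evaluation form of the classical fact that the adjoint of a composition operator
  sends the kernel at z to the kernel at \<phi>(z).\<close>

lemma pt_eval_T:
  assumes f: "f \<in> H2_ball" and z: "(\<Sum>i\<in>UNIV. (cmod (z i))\<^sup>2) < 1"
  shows "pt_eval (free_coeff (T f)) z = pt_eval (free_coeff f) (scalar_map z)"
proof (rule scale_id_inject[OF inf])
  have "scale_op (pt_eval (free_coeff (T f)) z) (id_blinfun :: 'h op) = T f (scalar_point z)"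
    by (rule H2_scalar_point[OF T_H2[OF f] z, symmetric])
  also have "\<dots> = f (scalar_point (scalar_map z))"
    by (simp add: T_apply[OF scalar_point_in_op_ball[OF z]] \<phi>_scalar_point[OF z])
  also have "\<dots> = scale_op (pt_eval (free_coeff f) (scalar_map z)) id_blinfun"
    by (rule H2_scalar_point[OF f scalar_map_in_ball[OF z]])
  finally show "scale_op (pt_eval (free_coeff (T f)) z) (id_blinfun :: 'h op)
      = scale_op (pt_eval (free_coeff f) (scalar_map z)) id_blinfun" .
qed

lemma sum_cmod_vec: "(\<Sum>i\<in>UNIV. (cmod (z $ i))\<^sup>2) = (norm z)\<^sup>2" for z :: "complex^'n"
  by (simp add: norm_vec_def L2_set_def sum_nonneg)

text \<open>If \<open>\<phi>\<close> were nowhere contracting near the boundary, the images under \<open>T\<close> of normalised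
  kernel functions would be at least as large at \<open>z\<close> as the norm of the kernel at \<open>z\<close>; but
  an \<open>H\<^sup>2\<close> function, hence also a compact family, is of smaller order there.\<close>

lemma scalar_map_contracts_sphere:
  "\<exists>r. 0 < r \<and> r < 1 \<and> (\<forall>z::complex^'n. norm z = r \<longrightarrow>
    (\<Sum>i\<in>UNIV. (cmod (scalar_map (($) z) i))\<^sup>2) < r\<^sup>2)"
proof (rule ccontr)
  assume neg: "\<not> ?thesis"
  \<comment> \<open>These radii tend to 1, and 1 / (1 - r m) = m + 2 makes the growth of the kernel
    norms explicit.\<close>
  define r where "r m = 1 - 1 / (real m + 2)" for m
  have r: "0 < r m" "r m < 1" for m
    by (simp_all add: r_def)
  have "\<exists>z::complex^'n. norm z = r m \<and> (r m)\<^sup>2 \<le> (\<Sum>i\<in>UNIV. (cmod (scalar_map (($) z) i))\<^sup>2)" for m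
    using neg r[of m] not_le by blast
  then obtain z :: "nat \<Rightarrow> complex^'n" where nz: "\<And>m. norm (z m) = r m"
    and ge: "\<And>m. (r m)\<^sup>2 \<le> (\<Sum>i\<in>UNIV. (cmod (scalar_map (($) (z m)) i))\<^sup>2)"
    by metis
  define w where "w m = scalar_map (($) (z m))" for m
  define N where "N m = l2norm (kern (($) (z m)))" for m
  have z1: "(\<Sum>i\<in>UNIV. (cmod (z m $ i))\<^sup>2) < 1" for m
    unfolding sum_cmod_vec nz using r[of m] by (simp add: abs_square_less_1)
  have w1: "(\<Sum>i\<in>UNIV. (cmod (w m i))\<^sup>2) < 1" for m
    unfolding w_def by (rule scalar_map_in_ball[OF z1])
  have N2: "(N m)\<^sup>2 = 1 / (1 - (r m)\<^sup>2)" for m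
    using square_summable_word_val(2)[OF z1[of m]] by (simp add: N_def l2norm_kern sum_cmod_vec nz)
  have NW: "N m \<le> l2norm (kern (w m))" for m
  proof (rule power2_le_imp_le)
    have "(N m)\<^sup>2 \<le> 1 / (1 - (\<Sum>i\<in>UNIV. (cmod (w m i))\<^sup>2))"
      unfolding N2 using w1[of m] ge[of m] r[of m]
      by (intro divide_left_mono mult_pos_pos) (auto simp: w_def abs_square_less_1)
    then show "(N m)\<^sup>2 \<le> (l2norm (kern (w m)))\<^sup>2"
      using square_summable_word_val(2)[OF w1[of m]] by (simp add: l2norm_kern)
  qed simp
  have Npos: "N m > 0" for m
  proof -
    have "(N m)\<^sup>2 > 0"
      unfolding N2 using r[of m] by (simp add: abs_square_less_1)
    then show ?thesis
      by (simp add: N_def order_less_le)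
  qed
  define c where "c m = complex_of_real (1 / l2norm (kern (w m)))" for m
  define h where "h m = (free_series (\<lambda>\<alpha>. c m * kern (w m) \<alpha>) :: ('n, 'h) free_fun)" for m
  have k2: "square_summable (kern (w m))" for m
    by (rule square_summable_kern[OF w1])
  note ck = square_summable_scale[OF k2]
  have Wpos: "l2norm (kern (w m)) > 0" for m
    using NW[of m] Npos[of m] by linarith
  have h: "h m \<in> H2_ball" "H2_norm (h m) = 1" "free_coeff (h m) = (\<lambda>\<alpha>. c m * kern (w m) \<alpha>)" for m
    unfolding h_def free_series_H2(2)[OF inf ck] l2norm_scale
    by (rule free_series_H2(1)[OF inf ck], use Wpos[of m] in \<open>simp add: c_def norm_divide\<close>,
        rule free_coeff_free_series[OF inf ck])
  \<comment> \<open>\<open>T\<close> carries the value of \<open>h m\<close> at \<open>w m\<close>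
    to the point \<open>z m\<close>, and a normalised kernel takes its own kernel norm as value at
    its base point.\<close>
  have big: "N m \<le> cmod (pt_eval (free_coeff (T (h m))) (($) (z m)))" for m
  proof -
    have "pt_eval (free_coeff (T (h m))) (($) (z m)) = c m * pt_eval (kern (w m)) (w m)"
      unfolding pt_eval_T[OF h(1) z1] h(3) by (simp add: pt_eval_scale flip: w_def)
    also have "\<dots> = complex_of_real (l2norm (kern (w m)))"
      unfolding pt_eval_kern[OF w1] c_def using Wpos[of m] by (simp add: power2_eq_square)
    finally show ?thesis
      using NW[of m] by simp
  qed
  let ?K = "H2_topology closure_of (T ` {f \<in> H2_ball. H2_norm f \<le> 1})"
  have "range (\<lambda>m. T (h m)) \<subseteq> ?K"
    using T_image_closure(2) h(1,2) by force
  then obtain l q where l: "l \<in> ?K" and q: "strict_mono (q :: nat \<Rightarrow> nat)"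
    and lim: "limitin M.mtopology ((\<lambda>m. T (h m)) \<circ> q) l sequentially"
    using T_image_closure(1) unfolding M.compactin_sequentially by meson
  have lH: "l \<in> H2_ball"
    using lim by (simp add: M.limit_metric_sequentially)
  note l2 = H2_coeff(1)[OF inf lH]
  \<comment> \<open>The quarter here and the quarter in the bound defining \<open>C\<close> together
    absorb half of \<open>N (q n)\<close>, leaving N \<le> 2 C.\<close>
  obtain n0 where n0: "\<And>n. n \<ge> n0 \<Longrightarrow> H2_norm (\<lambda>X. T (h (q n)) X - l X) < 1/4"
    using lim unfolding M.limit_metric_sequentially by (metis comp_apply zero_less_divide_1_iff zero_less_numeral)
  obtain C where C: "\<And>v. (\<Sum>i\<in>UNIV. (cmod (v i))\<^sup>2) < 1 \<Longrightarrow>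
      cmod (pt_eval (free_coeff l) v) \<le> C + 1/4 * l2norm (kern v)"
    using cmod_pt_eval_le_head_tail[OF l2, of "1/4"] by auto
  have bound: "N (q n) \<le> 2 * C" if "n \<ge> n0" for n
  proof -
    let ?m = "q n" and ?D = "\<lambda>X. T (h (q n)) X - l X"
    note D = H2_diff[OF inf T_H2[OF h(1)] lH, of ?m]
    have Ds: "square_summable (free_coeff ?D)"
      by (rule H2_coeff(1)[OF inf D(1)])
    have "pt_eval (free_coeff (T (h ?m))) (($) (z ?m))
        = pt_eval (free_coeff ?D) (($) (z ?m)) + pt_eval (free_coeff l) (($) (z ?m))"
      using pt_eval_add[OF z1[of ?m] Ds l2] by (simp add: D(2))
    then have "N ?m \<le> cmod (pt_eval (free_coeff ?D) (($) (z ?m))) + cmod (pt_eval (free_coeff l) (($) (z ?m)))"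
      by (intro order_trans[OF big]) (simp add: norm_triangle_ineq)
    also have "cmod (pt_eval (free_coeff ?D) (($) (z ?m))) \<le> H2_norm ?D * N ?m"
      unfolding H2_norm_eq N_def by (rule cmod_pt_eval_le[OF z1 Ds])
    also have "\<dots> \<le> 1/4 * N ?m"
      using n0[OF that] Npos[of ?m] by (intro mult_right_mono) auto
    also have "cmod (pt_eval (free_coeff l) (($) (z ?m))) \<le> C + 1/4 * N ?m"
      unfolding N_def by (rule C[OF z1])
    finally show ?thesis
      by linarith
  qed
  \<comment> \<open>The threshold contradicts N \<le> 2 C, because N^2 = 1 / (1 - r^2) is at least 1
    / (2 (1 - r)), which is (q n + 2) / 2, and q n \<ge> n.\<close>
  obtain n1 where "real n1 > 2 * (2 * C)\<^sup>2"
    using reals_Archimedean2 by blast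
  then obtain n where n: "n \<ge> n0" "real n > 2 * (2 * C)\<^sup>2"
    by (intro that[of "n0 + n1"]) auto
  have "1 - (r (q n))\<^sup>2 \<le> 2 * (1 - r (q n))"
    using zero_le_power2[of "1 - r (q n)"] by (simp add: power2_diff)
  then have "1 / (2 * (1 - r (q n))) \<le> (N (q n))\<^sup>2"
    unfolding N2 using r[of "q n"] by (intro divide_left_mono mult_pos_pos) (auto simp: abs_square_less_1)
  then have "(real (q n) + 2) / 2 \<le> (N (q n))\<^sup>2"
    by (simp add: r_def)
  also have "\<dots> \<le> (2 * C)\<^sup>2"
    using bound[OF n(1)] Npos[of "q n"] by (intro power_mono) auto
  finally have "real (q n) \<le> 2 * (2 * C)\<^sup>2"
    by (simp add: field_simps)
  moreover have "real n \<le> real (q n)"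
    using q by (simp add: strict_mono_imp_increasing)
  ultimately show False
    using n(2) by linarith
qed

text \<open>\<open>F\<close> need not map the ball of radius r into itself, so Brouwer is applied to
  its radial retraction \<open>g\<close>. A fixed point of \<open>g\<close> at which the retraction
  acts would lie on the sphere of radius r, where \<open>F\<close> has norm below r.\<close>

lemma scalar_fixed_point:
  "\<exists>\<xi>. (\<Sum>i\<in>UNIV. (cmod (\<xi> i))\<^sup>2) < 1 \<and> \<phi> (scalar_point \<xi>) = scalar_point \<xi>"
proof -
  obtain r where r: "0 < r" "r < 1"
    and contr: "\<And>z::complex^'n. norm z = r \<Longrightarrow> (\<Sum>i\<in>UNIV. (cmod (scalar_map (($) z) i))\<^sup>2) < r\<^sup>2"
    using scalar_map_contracts_sphere by blast
  define F :: "complex^'n \<Rightarrow> complex^'n" where "F z = (\<chi> i. scalar_map (($) z) i)" for z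
  define g where "g z = (r / max r (norm (F z))) *\<^sub>R F z" for z
  have contF: "continuous_on (cball 0 r) F"
    unfolding F_def scalar_map_def using r
    by (intro continuous_on_vec_lambda continuous_on_pt_eval H2_coeff(1)[OF inf] T_H2 coordinate_H2) auto
  have "continuous_on (cball 0 r) g"
    unfolding g_def using r by (intro continuous_intros contF) auto
  moreover have "g \<in> cball 0 r \<rightarrow> cball 0 r"
    using r by (auto simp: g_def abs_mult field_simps max_def)
  ultimately obtain z where z: "z \<in> cball 0 r" "g z = z"
    using brouwer[of "cball (0::complex^'n) r" g] r by auto
  have Fz: "F z = z"
  proof (cases "norm (F z) \<le> r")
    case True
    then show ?thesis
      using z(2) r by (simp add: g_def max_def)
  next
    case False
    then have "norm (g z) = r"
      using r by (auto simp: g_def max_def)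
    then have "norm z = r"
      by (simp add: z(2))
    then have "(norm (F z))\<^sup>2 < r\<^sup>2"
      using contr[of z] by (simp add: F_def flip: sum_cmod_vec)
    then show ?thesis
      using False r power_less_imp_less_base[of "norm (F z)" 2 r] by simp
  qed
  have "scalar_map (($) z) i = z $ i" for i
    using arg_cong[OF Fz, of "\<lambda>v. v $ i"] by (simp add: F_def)
  then have "scalar_map (($) z) = ($) z"
    by (rule ext)
  moreover have "(\<Sum>i\<in>UNIV. (cmod (z $ i))\<^sup>2) < 1"
    using z(1) r unfolding sum_cmod_vec by (simp add: abs_square_less_1)
  ultimately show ?thesis
    using \<phi>_scalar_point[of "($) z"] by (intro exI[of _ "($) z"]) simp
qed

end

section \<open>Similarity to a contraction\<close>

text \<open>The right shift removes the last letter while list recursion removes the first, hence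
  the recursion over the reversed word.\<close>

primrec right_resolvent_rev :: "('n \<Rightarrow> complex) \<Rightarrow> ('n list \<Rightarrow> complex) \<Rightarrow> 'n list \<Rightarrow> complex" where
  "right_resolvent_rev z a [] = a []"
| "right_resolvent_rev z a (i # \<beta>) = a (rev (i # \<beta>)) + right_resolvent_rev z a \<beta> * z i"

text \<open>With R the right shift by z, this is (1 - R)^(-1) a, the solution b of b = a + R
  b.\<close>

definition right_resolvent :: "('n \<Rightarrow> complex) \<Rightarrow> ('n list \<Rightarrow> complex) \<Rightarrow> 'n list \<Rightarrow> complex" where
  "right_resolvent z a \<alpha> = right_resolvent_rev z a (rev \<alpha>)"

lemma right_resolvent_eq: "right_resolvent z a \<alpha> = a \<alpha> + right_shift z (right_resolvent z a) \<alpha>"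
  by (cases \<alpha> rule: rev_cases) (simp_all add: right_resolvent_def right_shift_def)

text \<open>The shifted family at \<alpha> involves only a shorter word, so the equation determines
  b letter by letter without any summability. Linearity of the resolvent and \<open>V_W\<close>
  follow from it.\<close>

lemma right_resolvent_unique:
  assumes "\<And>\<alpha>. b \<alpha> = a \<alpha> + right_shift z b \<alpha>"
  shows "b = right_resolvent z a"
proof
  show "b \<alpha> = right_resolvent z a \<alpha>" for \<alpha>
  proof (induction \<alpha> rule: rev_induct)
    case Nil
    then show ?case
      using assms[of "[]"] right_resolvent_eq[of z a "[]"] by (simp add: right_shift_def)
  next
    case (snoc i \<alpha>)
    then show ?case
      using assms[of "\<alpha> @ [i]"] right_resolvent_eq[of z a "\<alpha> @ [i]"] by simp
  qed
qed

lemma right_shift_add: "right_shift z (\<lambda>\<alpha>. a \<alpha> + b \<alpha>) = (\<lambda>\<alpha>. right_shift z a \<alpha> + right_shift z b \<alpha>)"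
  by (auto simp: right_shift_def algebra_simps)

lemma right_shift_scale: "right_shift z (\<lambda>\<alpha>. c * a \<alpha>) = (\<lambda>\<alpha>. c * right_shift z a \<alpha>)"
  by (auto simp: right_shift_def)

lemma right_resolvent_add:
  "right_resolvent z (\<lambda>\<alpha>. a \<alpha> + b \<alpha>) = (\<lambda>\<alpha>. right_resolvent z a \<alpha> + right_resolvent z b \<alpha>)"
proof (rule right_resolvent_unique[symmetric])
  show "right_resolvent z a \<alpha> + right_resolvent z b \<alpha>
      = a \<alpha> + b \<alpha> + right_shift z (\<lambda>\<alpha>. right_resolvent z a \<alpha> + right_resolvent z b \<alpha>) \<alpha>" for \<alpha>
    using right_resolvent_eq[of z a \<alpha>] right_resolvent_eq[of z b \<alpha>] by (simp add: right_shift_add)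
qed

lemma right_resolvent_scale:
  "right_resolvent z (\<lambda>\<alpha>. c * a \<alpha>) = (\<lambda>\<alpha>. c * right_resolvent z a \<alpha>)"
proof (rule right_resolvent_unique[symmetric])
  show "c * right_resolvent z a \<alpha> = c * a \<alpha> + right_shift z (\<lambda>\<alpha>. c * right_resolvent z a \<alpha>) \<alpha>" for \<alpha>
    using right_resolvent_eq[of z a \<alpha>] by (simp add: right_shift_scale algebra_simps)
qed

text \<open>Every nonempty word is \<beta> @ [i] in exactly one way, so the shift is |z| times an
  isometry; the bound on the length grows by one because the degree does.\<close>

lemma L2_set_right_shift:
  fixes a :: "'n::finite list \<Rightarrow> complex"
  shows "L2_set (\<lambda>\<alpha>. cmod (right_shift z a \<alpha>)) {\<alpha>. length \<alpha> < Suc d}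
    = sqrt (\<Sum>i\<in>UNIV. (cmod (z i))\<^sup>2) * L2_set (\<lambda>\<alpha>. cmod (a \<alpha>)) {\<alpha>. length \<alpha> < d}"
proof -
  have "(\<Sum>\<alpha> | length \<alpha> < Suc d. (cmod (right_shift z a \<alpha>))\<^sup>2)
      = (\<Sum>k<d. \<Sum>\<beta> | length \<beta> = k. \<Sum>i\<in>UNIV. (cmod (right_shift z a (\<beta> @ [i])))\<^sup>2)"
    unfolding sum_words_less sum.lessThan_Suc_shift sum_words_Suc_snoc by (simp add: right_shift_def)
  also have "\<dots> = (\<Sum>i\<in>UNIV. (cmod (z i))\<^sup>2) * (\<Sum>\<alpha> | length \<alpha> < d. (cmod (a \<alpha>))\<^sup>2)"
    unfolding sum_words_less sum_distrib_left[of _ _ "{..<d}"] sum_distrib_left[of _ _ "{\<alpha>. length \<alpha> = _}"]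
    by (simp add: norm_mult power_mult_distrib mult.commute flip: sum_distrib_left sum_distrib_right)
  finally show ?thesis
    by (simp add: L2_set_def real_sqrt_mult)
qed

lemma square_summable_words_bounded:
  fixes a :: "'n::finite list \<Rightarrow> complex"
  assumes "\<And>d. L2_set (\<lambda>\<alpha>. cmod (a \<alpha>)) {\<alpha>. length \<alpha> < d} \<le> C"
  shows "square_summable a" "l2norm a \<le> C"
proof -
  have "L2_set (\<lambda>\<alpha>. cmod (a \<alpha>)) F \<le> C" if "finite F" for F
  proof -
    obtain d where "F \<subseteq> {\<alpha>. length \<alpha> < d}"
      using finite_words_bounded[OF \<open>finite F\<close>] .
    then have "L2_set (\<lambda>\<alpha>. cmod (a \<alpha>)) F \<le> L2_set (\<lambda>\<alpha>. cmod (a \<alpha>)) {\<alpha>. length \<alpha> < d}"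
      unfolding L2_set_def by (intro real_sqrt_le_mono sum_mono2) auto
    then show ?thesis
      using assms by (rule order_trans)
  qed
  moreover have "0 \<le> C"
    using assms[of 0] by simp
  ultimately show "square_summable a" "l2norm a \<le> C"
    using square_summable_bounded_L2_set by blast+
qed

lemma square_summable_right_shift:
  fixes a :: "'n::finite list \<Rightarrow> complex"
  assumes a: "square_summable a"
  shows "square_summable (right_shift z a)"
    and "l2norm (right_shift z a) \<le> sqrt (\<Sum>i\<in>UNIV. (cmod (z i))\<^sup>2) * l2norm a"
proof -
  have b: "L2_set (\<lambda>\<alpha>. cmod (right_shift z a \<alpha>)) {\<alpha>. length \<alpha> < d}
      \<le> sqrt (\<Sum>i\<in>UNIV. (cmod (z i))\<^sup>2) * l2norm a" for d
  proof (cases d)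
    case 0
    show ?thesis
      unfolding 0 by (simp add: sum_nonneg)
  next
    case (Suc e)
    show ?thesis
      unfolding Suc L2_set_right_shift
      by (rule mult_left_mono[OF L2_set_le_l2norm[OF a]]) (simp_all add: sum_nonneg)
  qed
  show "square_summable (right_shift z a)"
    by (rule square_summable_words_bounded(1)) (rule b)
  show "l2norm (right_shift z a) \<le> sqrt (\<Sum>i\<in>UNIV. (cmod (z i))\<^sup>2) * l2norm a"
    by (rule square_summable_words_bounded(2)) (rule b)
qed

text \<open>The Neumann series bound, proved on truncations so that the norm of the solution need
  not be known to be finite. The step is 1 + t / (1 - t) = 1 / (1 - t).\<close>

lemma square_summable_right_resolvent:
  fixes a :: "'n::finite list \<Rightarrow> complex"
  assumes a: "square_summable a" and z: "(\<Sum>i\<in>UNIV. (cmod (z i))\<^sup>2) < 1"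
  defines "t \<equiv> sqrt (\<Sum>i\<in>UNIV. (cmod (z i))\<^sup>2)"
  shows "square_summable (right_resolvent z a)"
    and "l2norm (right_resolvent z a) \<le> 1 / (1 - t) * l2norm a"
proof -
  have t: "0 \<le> t" "t < 1"
    using z by (simp_all add: t_def sum_nonneg)
  let ?b = "right_resolvent z a"
  have b: "L2_set (\<lambda>\<alpha>. cmod (?b \<alpha>)) {\<alpha>. length \<alpha> < d} \<le> 1 / (1 - t) * l2norm a" for d
  proof (induction d)
    case (Suc d)
    let ?W = "{\<alpha>::'n list. length \<alpha> < Suc d}"
    have "L2_set (\<lambda>\<alpha>. cmod (?b \<alpha>)) ?W \<le> L2_set (\<lambda>\<alpha>. cmod (a \<alpha>) + cmod (right_shift z ?b \<alpha>)) ?W"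
      by (rule L2_set_mono) (subst right_resolvent_eq, rule norm_triangle_ineq, simp)
    also have "\<dots> \<le> L2_set (\<lambda>\<alpha>. cmod (a \<alpha>)) ?W + L2_set (\<lambda>\<alpha>. cmod (right_shift z ?b \<alpha>)) ?W"
      by (rule L2_set_triangle_ineq)
    also have "\<dots> \<le> l2norm a + t * (1 / (1 - t) * l2norm a)"
      unfolding L2_set_right_shift t_def[symmetric]
      using t by (intro add_mono mult_left_mono Suc.IH L2_set_le_l2norm a) auto
    also have "\<dots> = 1 / (1 - t) * l2norm a"
      using t by (simp add: field_simps)
    finally show ?case .
  qed (use t in simp)
  show "square_summable ?b"
    by (rule square_summable_words_bounded(1)) (rule b)
  show "l2norm ?b \<le> 1 / (1 - t) * l2norm a"
    by (rule square_summable_words_bounded(2)) (rule b)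
qed

section \<open>Bounded operators induced by maps of coefficients\<close>

definition coeff_op :: "(('n list \<Rightarrow> complex) \<Rightarrow> 'n list \<Rightarrow> complex) \<Rightarrow>
    ('n::finite, 'h::complex_hilbert_space) free_fun \<Rightarrow> ('n, 'h) free_fun" where
  "coeff_op L f = free_series (L (free_coeff f))"

lemma H2_bounded_coeff_op:
  assumes inf: "separable_inf_dim TYPE('h::complex_hilbert_space)"
    and summable: "\<And>a. square_summable a \<Longrightarrow> square_summable (L a)"
    and add: "\<And>a b. L (\<lambda>\<alpha>. a \<alpha> + b \<alpha>) = (\<lambda>\<alpha>. L a \<alpha> + L b \<alpha>)"
    and scale: "\<And>c a. L (\<lambda>\<alpha>. c * a \<alpha>) = (\<lambda>\<alpha>. c * L a \<alpha>)"
    and bound: "\<And>a. square_summable a \<Longrightarrow> l2norm (L a) \<le> C * l2norm a"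
  shows "H2_bounded (coeff_op L :: ('n::finite, 'h) free_fun \<Rightarrow> ('n, 'h) free_fun)"
  unfolding H2_bounded_def H2_linear_def
proof (intro conjI ballI allI exI[of _ C])
  fix f g :: "('n, 'h) free_fun" and c
  assume f: "f \<in> H2_ball"
  note f2 = H2_coeff(1)[OF inf f]
  show "coeff_op L f \<in> H2_ball"
    unfolding coeff_op_def by (rule free_series_H2(1)[OF inf summable[OF f2]])
  show "H2_norm (coeff_op L f) \<le> C * H2_norm f"
    unfolding coeff_op_def free_series_H2(2)[OF inf summable[OF f2]]
    unfolding H2_norm_eq by (rule bound[OF f2])
  show "coeff_op L (\<lambda>X. scale_op c (f X)) = (\<lambda>X. scale_op c (coeff_op L f X))"
    unfolding coeff_op_def H2_scale(2)[OF inf f] scale by (rule ext, rule free_series_scale[OF summable[OF f2]])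
  assume g: "g \<in> H2_ball"
  note g2 = H2_coeff(1)[OF inf g]
  show "coeff_op L (\<lambda>X. f X + g X) = (\<lambda>X. coeff_op L f X + coeff_op L g X)"
    unfolding coeff_op_def H2_add(2)[OF inf f g] add
    by (rule ext, rule free_series_add[OF summable[OF f2] summable[OF g2]])
qed

lemma H2_linearD:
  assumes U: "H2_linear U" and f: "f \<in> H2_ball"
  shows "U f \<in> H2_ball"
    and "g \<in> H2_ball \<Longrightarrow> U (\<lambda>X. f X + g X) = (\<lambda>X. U f X + U g X)"
    and "U (\<lambda>X. scale_op c (f X)) = (\<lambda>X. scale_op c (U f X))"
proof -
  note U = U[unfolded H2_linear_def]
  show "U f \<in> H2_ball"
    by (rule bspec[OF conjunct1[OF U] f])
  show "U (\<lambda>X. f X + g X) = (\<lambda>X. U f X + U g X)" if "g \<in> H2_ball"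
    by (rule bspec[OF bspec[OF conjunct1[OF conjunct2[OF U]] f] that])
  show "U (\<lambda>X. scale_op c (f X)) = (\<lambda>X. scale_op c (U f X))"
    by (rule bspec[OF spec[OF conjunct2[OF conjunct2[OF U]]] f])
qed

lemma H2_bounded_compose:
  fixes S T :: "('n::finite, 'h::complex_hilbert_space) free_fun \<Rightarrow> ('n, 'h) free_fun"
  assumes S: "H2_bounded S" and T: "H2_bounded T"
  shows "H2_bounded (\<lambda>f. S (T f))"
proof -
  have SL: "H2_linear S" and TL: "H2_linear T"
    using S T by (auto simp only: H2_bounded_def)
  obtain K L where K: "\<And>f. f \<in> H2_ball \<Longrightarrow> H2_norm (S f) \<le> K * H2_norm f"
    and L: "\<And>f. f \<in> H2_ball \<Longrightarrow> H2_norm (T f) \<le> L * H2_norm f"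
    using S T by (auto simp only: H2_bounded_def)
  have TH: "T f \<in> H2_ball" if "f \<in> H2_ball" for f
    by (rule H2_linearD(1)[OF TL that])
  have "H2_norm (S (T f)) \<le> (\<bar>K\<bar> * L) * H2_norm f" if "f \<in> H2_ball" for f
  proof -
    have "H2_norm (S (T f)) \<le> \<bar>K\<bar> * H2_norm (T f)"
      by (intro order_trans[OF K[OF TH[OF that]]] mult_right_mono) (simp_all add: H2_norm_eq)
    also have "\<dots> \<le> \<bar>K\<bar> * (L * H2_norm f)"
      by (intro mult_left_mono L that) simp
    finally show ?thesis
      by (simp add: mult.assoc)
  qed
  moreover have "H2_linear (\<lambda>f. S (T f))"
    unfolding H2_linear_def
  proof (intro conjI ballI allI)
    fix f g :: "('n, 'h) free_fun" and c
    assume f: "f \<in> H2_ball"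
    show "S (T f) \<in> H2_ball"
      by (rule H2_linearD(1)[OF SL TH[OF f]])
    show "S (T (\<lambda>X. scale_op c (f X))) = (\<lambda>X. scale_op c (S (T f) X))"
      by (rule trans[OF arg_cong[of _ _ S, OF H2_linearD(3)[OF TL f]] H2_linearD(3)[OF SL TH[OF f]]])
    assume g: "g \<in> H2_ball"
    show "S (T (\<lambda>X. f X + g X)) = (\<lambda>X. S (T f) X + S (T g) X)"
      by (rule trans[OF arg_cong[of _ _ S, OF H2_linearD(2)[OF TL f g]] H2_linearD(2)[OF SL TH[OF f] TH[OF g]]])
  qed
  ultimately show ?thesis
    unfolding H2_bounded_def by blast
qed

text \<open>Needed for \<open>inv_into H2_ball V\<close>, whose values are under control only on
  \<open>H2_ball\<close>.\<close>

lemma H2_bounded_cong: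
  assumes inf: "separable_inf_dim TYPE('h::complex_hilbert_space)"
    and S: "H2_bounded (S :: ('n::finite, 'h) free_fun \<Rightarrow> ('n, 'h) free_fun)"
    and eq: "\<And>f. f \<in> H2_ball \<Longrightarrow> T f = S f"
  shows "H2_bounded T"
  using S unfolding H2_bounded_def H2_linear_def
  by (simp add: eq H2_add(1)[OF inf] H2_scale(1)[OF inf])

text \<open>The sequences \<open>g\<close>, \<open>b\<^sub>i\<close> are the coefficients of \<open>F - c k\<^sub>\<xi>\<close> and
  \<open>F\<^sub>i - c (cnj \<xi>\<^sub>i) k\<^sub>\<xi>\<close>; all correction terms cancel since
  \<open>(1 - \<bar>\<xi>\<bar>\<^sup>2) \<bar>k\<^sub>\<xi>\<bar>\<^sup>2 = 1\<close>.\<close>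

lemma l2norm_kern_perturbation:
  fixes \<xi> :: "'n::finite \<Rightarrow> complex"
  assumes \<xi>: "(\<Sum>i\<in>UNIV. (cmod (\<xi> i))\<^sup>2) < 1"
    and g: "square_summable g" and b: "\<And>i. square_summable (b i)"
    and le: "(l2norm g)\<^sup>2 \<le> (\<Sum>i\<in>UNIV. (l2norm (b i))\<^sup>2)"
    and ev: "pt_eval g \<xi> = (\<Sum>i\<in>UNIV. \<xi> i * pt_eval (b i) \<xi>)"
  shows "(l2norm (\<lambda>\<alpha>. g \<alpha> + c * kern \<xi> \<alpha>))\<^sup>2
    \<le> (cmod c)\<^sup>2 + (\<Sum>i\<in>UNIV. (l2norm (\<lambda>\<alpha>. b i \<alpha> + (c * cnj (\<xi> i)) * kern \<xi> \<alpha>))\<^sup>2)"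
proof -
  define s where "s = (\<Sum>i\<in>UNIV. (cmod (\<xi> i))\<^sup>2)"
  define K where "K = (l2norm (kern \<xi>))\<^sup>2"
  have K: "K - s * K = 1"
    using square_summable_word_val(2)[OF \<xi>] \<xi>
    by (simp add: K_def l2norm_kern field_simps flip: s_def)
  note k = square_summable_kern[OF \<xi>]
  \<comment> \<open>The cross term is an inner product with the kernel, which the reproducing
    property turns into an evaluation at \<xi>.\<close>
  have ex: "(l2norm (\<lambda>\<alpha>. a \<alpha> + u * kern \<xi> \<alpha>))\<^sup>2
      = (l2norm a)\<^sup>2 + 2 * Re (cnj u * pt_eval a \<xi>) + (cmod u)\<^sup>2 * K"
    if "square_summable a" for a u
  proof -
    have "(\<Sum>\<^sub>\<infinity>\<alpha>. a \<alpha> * cnj (u * kern \<xi> \<alpha>)) = cnj u * pt_eval a \<xi>"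
      by (simp add: kern_def pt_eval_def infsum_cmult_right' mult.left_commute)
    then show ?thesis
      using l2norm_add_sq[OF that square_summable_scale[OF k, of u]]
      by (simp add: l2norm_scale power_mult_distrib K_def)
  qed
  \<comment> \<open>The weights c (cnj \<xi>_i) are chosen for this: by \<open>ev\<close> the cross
    terms of all b_i add up to the single cross term of g.\<close>
  have "(\<Sum>i\<in>UNIV. Re (cnj (c * cnj (\<xi> i)) * pt_eval (b i) \<xi>)) = Re (cnj c * pt_eval g \<xi>)"
    unfolding ev sum_distrib_left Re_sum[symmetric] by (simp add: mult.assoc)
  moreover have "(\<Sum>i\<in>UNIV. (cmod (c * cnj (\<xi> i)))\<^sup>2 * K) = (cmod c)\<^sup>2 * (s * K)"
    by (simp add: norm_mult power_mult_distrib s_def sum_distrib_left sum_distrib_right mult.assoc)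
  ultimately have "(\<Sum>i\<in>UNIV. (l2norm (\<lambda>\<alpha>. b i \<alpha> + (c * cnj (\<xi> i)) * kern \<xi> \<alpha>))\<^sup>2)
      = (\<Sum>i\<in>UNIV. (l2norm (b i))\<^sup>2) + 2 * Re (cnj c * pt_eval g \<xi>) + (cmod c)\<^sup>2 * (s * K)"
    unfolding ex[OF b] sum.distrib sum_distrib_left[symmetric] by simp
  moreover have "(cmod c)\<^sup>2 * K = (cmod c)\<^sup>2 * (s * K) + (cmod c)\<^sup>2"
  proof -
    have "K = s * K + 1"
      using K by simp
    then have "(cmod c)\<^sup>2 * K = (cmod c)\<^sup>2 * (s * K + 1)"
      by (rule arg_cong)
    then show ?thesis
      by (simp only: distrib_left mult_1_right)
  qed
  ultimately show ?thesis
    unfolding ex[OF g] using le by linarith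
qed

section \<open>The conjugated operator at a fixed point\<close>

locale fixed_composition = compact_composition \<phi>
  for \<phi> :: "('n::finite \<Rightarrow> 'h::complex_hilbert_space op) \<Rightarrow> ('n \<Rightarrow> 'h op)" +
  fixes \<xi> :: "'n \<Rightarrow> complex"
  assumes \<xi>: "(\<Sum>i\<in>UNIV. (cmod (\<xi> i))\<^sup>2) < 1"
    and fixed: "\<phi> (scalar_point \<xi>) = scalar_point \<xi>"
begin

text \<open>\<open>V\<close> is right multiplication by the kernel function \<open>k\<^sub>\<xi> = (1 - \<Sum>\<^sub>i cnj \<xi>\<^sub>i X\<^sub>i)\<inverse>\<close>,
  and \<open>W\<close> is its inverse.\<close>

definition W :: "('n, 'h) free_fun \<Rightarrow> ('n, 'h) free_fun" where
  "W = coeff_op (\<lambda>a \<alpha>. a \<alpha> - right_shift (\<lambda>i. cnj (\<xi> i)) a \<alpha>)"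

definition V :: "('n, 'h) free_fun \<Rightarrow> ('n, 'h) free_fun" where
  "V = coeff_op (right_resolvent (\<lambda>i. cnj (\<xi> i)))"

definition A :: "('n, 'h) free_fun \<Rightarrow> ('n, 'h) free_fun" where
  "A = (\<lambda>f. V (T (W f)))"

definition k :: "('n, 'h) free_fun" where
  "k = free_series (kern \<xi>)"

definition lin :: "('n \<Rightarrow> 'h op) \<Rightarrow> 'h op" where
  "lin X = (\<Sum>i\<in>UNIV. scale_op (cnj (\<xi> i)) (X i))"

lemma \<xi>_cnj: "(\<Sum>i\<in>UNIV. (cmod (cnj (\<xi> i)))\<^sup>2) < 1"
  using \<xi> by simp

lemma W_summable: "square_summable a \<Longrightarrow> square_summable (\<lambda>\<alpha>. a \<alpha> - right_shift (\<lambda>i. cnj (\<xi> i)) a \<alpha>)"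
  by (intro square_summable_diff square_summable_right_shift)

lemma W_bounded: "H2_bounded W"
  unfolding W_def
proof (rule H2_bounded_coeff_op[OF inf, where C = 2])
  let ?R = "right_shift (\<lambda>i. cnj (\<xi> i))"
  show "(\<lambda>\<alpha>. (a \<alpha> + b \<alpha>) - ?R (\<lambda>\<alpha>. a \<alpha> + b \<alpha>) \<alpha>)
      = (\<lambda>\<alpha>. (a \<alpha> - ?R a \<alpha>) + (b \<alpha> - ?R b \<alpha>))" for a b
    by (rule ext) (simp add: right_shift_add)
  show "(\<lambda>\<alpha>. c * a \<alpha> - ?R (\<lambda>\<alpha>. c * a \<alpha>) \<alpha>) = (\<lambda>\<alpha>. c * (a \<alpha> - ?R a \<alpha>))" for c a
    by (simp add: right_shift_scale right_diff_distrib)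
  fix a :: "'n list \<Rightarrow> complex" assume a: "square_summable a"
  note R = square_summable_right_shift[OF a, of "\<lambda>i. cnj (\<xi> i)"]
  have "l2norm (\<lambda>\<alpha>. a \<alpha> - ?R a \<alpha>) \<le> l2norm a + l2norm (\<lambda>\<alpha>. - 1 * ?R a \<alpha>)"
    using square_summable_add(2)[OF a square_summable_scale[OF R(1), of "- 1"]] by simp
  also have "l2norm (\<lambda>\<alpha>. - 1 * ?R a \<alpha>) = l2norm (?R a)"
    unfolding l2norm_scale by simp
  also have "\<dots> \<le> 1 * l2norm a"
    using \<xi>_cnj by (intro order_trans[OF R(2)] mult_right_mono) auto
  finally show "l2norm (\<lambda>\<alpha>. a \<alpha> - ?R a \<alpha>) \<le> 2 * l2norm a"
    by simp
qed (rule W_summable)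

lemma V_bounded: "H2_bounded V"
  unfolding V_def
  by (rule H2_bounded_coeff_op[OF inf])
    (rule square_summable_right_resolvent[OF _ \<xi>_cnj] right_resolvent_add right_resolvent_scale; assumption?)+

lemma V_H2: "f \<in> H2_ball \<Longrightarrow> V f \<in> H2_ball" and W_H2: "f \<in> H2_ball \<Longrightarrow> W f \<in> H2_ball"
  using V_bounded W_bounded by (simp_all add: H2_bounded_def H2_linear_def)

lemma W_V:
  assumes f: "f \<in> H2_ball"
  shows "W (V f) = f"
proof -
  let ?R = "right_shift (\<lambda>i. cnj (\<xi> i))" and ?b = "right_resolvent (\<lambda>i. cnj (\<xi> i)) (free_coeff f)"
  have "free_coeff (V f) = ?b"
    unfolding V_def coeff_op_def
    by (rule free_coeff_free_series[OF inf square_summable_right_resolvent(1)[OF H2_coeff(1)[OF inf f] \<xi>_cnj]])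
  moreover have "(\<lambda>\<alpha>. ?b \<alpha> - ?R ?b \<alpha>) = free_coeff f"
    using right_resolvent_eq[of "\<lambda>i. cnj (\<xi> i)" "free_coeff f"] by (auto simp: fun_eq_iff)
  ultimately show ?thesis
    unfolding W_def coeff_op_def using H2_coeff(2)[OF inf f, symmetric] by simp
qed

lemma V_W:
  assumes f: "f \<in> H2_ball"
  shows "V (W f) = f"
proof -
  let ?R = "right_shift (\<lambda>i. cnj (\<xi> i))"
  have "free_coeff (W f) = (\<lambda>\<alpha>. free_coeff f \<alpha> - ?R (free_coeff f) \<alpha>)"
    unfolding W_def coeff_op_def
    by (rule free_coeff_free_series[OF inf W_summable[OF H2_coeff(1)[OF inf f]]])
  moreover have "right_resolvent (\<lambda>i. cnj (\<xi> i)) (\<lambda>\<alpha>. free_coeff f \<alpha> - ?R (free_coeff f) \<alpha>) = free_coeff f"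
    by (rule right_resolvent_unique[symmetric]) simp
  ultimately show ?thesis
    unfolding V_def coeff_op_def using H2_coeff(2)[OF inf f, symmetric] by simp
qed

lemma T_H2_bounded: "H2_bounded T"
  using compact T_bounded unfolding H2_bounded_def H2_compact_def by blast

lemma A_bounded: "H2_bounded A"
  unfolding A_def
  by (rule H2_bounded_compose[OF V_bounded H2_bounded_compose[OF T_H2_bounded W_bounded]])

lemma A_H2: "f \<in> H2_ball \<Longrightarrow> A f \<in> H2_ball"
  using A_bounded by (simp add: H2_bounded_def H2_linear_def)

lemma k_H2: "k \<in> H2_ball" and free_coeff_k: "free_coeff k = kern \<xi>"
  unfolding k_def
  by (rule free_series_H2(1)[OF inf square_summable_kern[OF \<xi>]],
      rule free_coeff_free_series[OF inf square_summable_kern[OF \<xi>]])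

lemma W_apply:
  assumes f: "f \<in> H2_ball" and X: "X \<in> op_ball"
  shows "W f X = f X - (f X o\<^sub>L lin X)"
proof -
  note f2 = H2_coeff(1)[OF inf f]
  note R = square_summable_right_shift(1)[OF f2]
  have "W f X = free_series (free_coeff f) X
      - free_series (right_shift (\<lambda>i. cnj (\<xi> i)) (free_coeff f)) X"
    unfolding W_def coeff_op_def by (rule free_series_diff[OF f2 R])
  also have "\<dots> = free_series (free_coeff f) X - (free_series (free_coeff f) X o\<^sub>L lin X)"
    unfolding lin_def free_series_right_shift[OF X f2 R] ..
  finally show ?thesis
    unfolding H2_coeff(2)[OF inf f, symmetric] .
qed

text \<open>Removing a first letter i multiplies the kernel coefficients by cnj \<xi>_i, so
  splitting by first letters reads k = 1 + lin k.\<close>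

lemma k_resolvent:
  assumes X: "X \<in> op_ball"
  shows "k X - (lin X o\<^sub>L k X) = id_blinfun"
proof -
  note K = square_summable_kern[OF \<xi>]
  have "k X = scale_op (kern \<xi> []) id_blinfun + (\<Sum>i\<in>UNIV. X i o\<^sub>L free_series (\<lambda>\<alpha>. kern \<xi> (i # \<alpha>)) X)"
    unfolding k_def by (rule free_series_Cons_split[OF X K])
  also have "\<dots> = scale_op (kern \<xi> []) id_blinfun + (\<Sum>i\<in>UNIV. X i o\<^sub>L scale_op (cnj (\<xi> i)) (k X))"
  proof -
    have "(\<lambda>\<alpha>. kern \<xi> (i # \<alpha>)) = (\<lambda>\<alpha>. cnj (\<xi> i) * kern \<xi> \<alpha>)" for i
      by (simp add: kern_def word_val_def)
    then have "free_series (\<lambda>\<alpha>. kern \<xi> (i # \<alpha>)) X = scale_op (cnj (\<xi> i)) (k X)" for i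
      unfolding k_def using free_series_scale[OF K] by simp
    then show ?thesis
      by simp
  qed
  also have "(\<Sum>i\<in>UNIV. X i o\<^sub>L scale_op (cnj (\<xi> i)) (k X)) = lin X o\<^sub>L k X"
    unfolding lin_def scale_op_compose_right[OF op_ball_BH[OF X]]
    by (rule blinfun_eqI) (simp add: blinfun.sum_left)
  also have "scale_op (kern \<xi> []) (id_blinfun :: 'h op) = id_blinfun"
    by (simp add: kern_def word_val_def)
  finally show ?thesis
    unfolding diff_eq_eq .
qed

text \<open>The value of \<open>A\<close> at the constant function 1.\<close>

definition q :: "('n \<Rightarrow> 'h op) \<Rightarrow> 'h op" where
  "q X = k X - (lin (\<phi> X) o\<^sub>L k X)"

text \<open>Undoing \<open>V\<close> on the left-hand side gives (A f)(1 - lin) = f(\<phi>)(1 -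
  lin(\<phi>)); multiplying by \<open>k\<close> on the right cancels 1 - lin. Thus \<open>A\<close>
  is substitution followed by a fixed right factor and respects left factors.\<close>

lemma A_apply:
  assumes f: "f \<in> H2_ball" and X: "X \<in> op_ball"
  shows "A f X = f (\<phi> X) o\<^sub>L q X"
proof -
  have "A f X - (A f X o\<^sub>L lin X) = W (A f) X"
    by (rule W_apply[OF A_H2[OF f] X, symmetric])
  also have "\<dots> = W f (\<phi> X)"
    unfolding A_def W_V[OF T_H2[OF W_H2[OF f]]] by (rule T_apply[OF X])
  also have "\<dots> = f (\<phi> X) - (f (\<phi> X) o\<^sub>L lin (\<phi> X))"
    by (rule W_apply[OF f self_map[OF X]])
  finally have eq: "A f X - (A f X o\<^sub>L lin X) = f (\<phi> X) - (f (\<phi> X) o\<^sub>L lin (\<phi> X))" .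
  have "A f X = A f X o\<^sub>L (k X - (lin X o\<^sub>L k X))"
    unfolding k_resolvent[OF X] by (rule blinfun_eqI) simp
  also have "\<dots> = (A f X - (A f X o\<^sub>L lin X)) o\<^sub>L k X"
    by (rule blinfun_eqI) (simp add: blinfun.diff_left blinfun.diff_right)
  also have "\<dots> = f (\<phi> X) o\<^sub>L q X"
    unfolding eq q_def by (rule blinfun_eqI) (simp add: blinfun.diff_left blinfun.diff_right)
  finally show ?thesis .
qed

text \<open>Left factors pass through \<open>A\<close>, so A F = c q + \<Sum> \<phi>_i (A F_i).
  Since q differs from k by a combination with left factors \<phi>_i, subtracting c k leaves a pure
  row expression in \<phi>, to which \<open>H2_row_contraction\<close> applies.\<close>

lemma A_Cons_split:
  assumes a: "square_summable a"
  shows "(H2_norm (A (free_series a)))\<^sup>2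
    \<le> (cmod (a []))\<^sup>2 + (\<Sum>i\<in>UNIV. (H2_norm (A (free_series (\<lambda>\<alpha>. a (i # \<alpha>)))))\<^sup>2)"
proof -
  define c where "c = a []"
  define F where "F = (free_series a :: ('n, 'h) free_fun)"
  define Fi where "Fi i = (free_series (\<lambda>\<alpha>. a (i # \<alpha>)) :: ('n, 'h) free_fun)" for i
  have F: "F \<in> H2_ball" and Fi: "Fi i \<in> H2_ball" for i
    unfolding F_def Fi_def by (intro free_series_H2(1)[OF inf] l2norm_Cons_split(1) a)+
  define G where "G X = A F X - scale_op c (k X)" for X
  define B where "B i X = A (Fi i) X - scale_op (c * cnj (\<xi> i)) (k X)" for i X
  have G: "G \<in> H2_ball" and cG: "free_coeff G = (\<lambda>\<alpha>. free_coeff (A F) \<alpha> - c * kern \<xi> \<alpha>)"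
    unfolding G_def using H2_diff[OF inf A_H2[OF F] H2_scale(1)[OF inf k_H2]]
    by (simp_all add: H2_scale(2)[OF inf k_H2] free_coeff_k)
  have B: "B i \<in> H2_ball"
    and cB: "free_coeff (B i) = (\<lambda>\<alpha>. free_coeff (A (Fi i)) \<alpha> - (c * cnj (\<xi> i)) * kern \<xi> \<alpha>)" for i
    unfolding B_def using H2_diff[OF inf A_H2[OF Fi] H2_scale(1)[OF inf k_H2]]
    by (simp_all add: H2_scale(2)[OF inf k_H2] free_coeff_k)
  have eq: "G X = (\<Sum>i\<in>UNIV. \<phi> X i o\<^sub>L B i X)" if X: "X \<in> op_ball" for X
  proof -
    note \<phi>X = self_map[OF X]
    have "F (\<phi> X) = scale_op c id_blinfun + (\<Sum>i\<in>UNIV. \<phi> X i o\<^sub>L Fi i (\<phi> X))"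
      unfolding F_def Fi_def c_def by (rule free_series_Cons_split[OF \<phi>X a])
    then have "A F X = (scale_op c id_blinfun + (\<Sum>i\<in>UNIV. \<phi> X i o\<^sub>L Fi i (\<phi> X))) o\<^sub>L q X"
      by (simp only: A_apply[OF F X])
    also have "\<dots> = scale_op c (q X) + (\<Sum>i\<in>UNIV. \<phi> X i o\<^sub>L A (Fi i) X)"
      unfolding A_apply[OF Fi X] by (rule blinfun_eqI) (simp add: blinfun.add_left blinfun.sum_left)
    finally show ?thesis
      unfolding G_def B_def q_def lin_def
      by (intro blinfun_eqI) (simp add: blinfun.add_left blinfun.sum_left blinfun.diff_left
        blinfun.diff_right cvs.scale_right_diff_distrib cvs.scale_sum_right sum_subtractf
        scaleC_scaleC BH_D[OF op_ball_BH[OF \<phi>X]])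
  qed
  have le: "(l2norm (free_coeff G))\<^sup>2 \<le> (\<Sum>i\<in>UNIV. (l2norm (free_coeff (B i)))\<^sup>2)"
    using H2_row_contraction[OF inf self_map G B eq] by (simp add: H2_norm_eq)
  \<comment> \<open>The fixed point enters here: at \<xi> the row \<phi> becomes the scalar row
    \<xi>, so the row identity relates the evaluations of \<open>G\<close> and the
    \<open>B i\<close>.\<close>
  have ev: "pt_eval (free_coeff G) \<xi> = (\<Sum>i\<in>UNIV. \<xi> i * pt_eval (free_coeff (B i)) \<xi>)"
  proof (rule scale_id_inject[OF inf])
    have "scale_op (pt_eval (free_coeff G) \<xi>) (id_blinfun :: 'h op) = G (scalar_point \<xi>)"
      by (rule H2_scalar_point[OF G \<xi>, symmetric])
    also have "\<dots> = (\<Sum>i\<in>UNIV. scalar_point \<xi> i o\<^sub>L B i (scalar_point \<xi>))"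
      using eq[OF scalar_point_in_op_ball[OF \<xi>]] by (simp add: fixed)
    also have "\<dots> = scale_op (\<Sum>i\<in>UNIV. \<xi> i * pt_eval (free_coeff (B i)) \<xi>) id_blinfun"
      unfolding H2_scalar_point[OF B \<xi>]
      by (rule blinfun_eqI) (simp add: blinfun.sum_left scaleC_scaleC cvs.scale_sum_left)
    finally show "scale_op (pt_eval (free_coeff G) \<xi>) (id_blinfun :: 'h op)
      = scale_op (\<Sum>i\<in>UNIV. \<xi> i * pt_eval (free_coeff (B i)) \<xi>) id_blinfun" .
  qed
  show ?thesis
    using l2norm_kern_perturbation[OF \<xi> H2_coeff(1)[OF inf G] H2_coeff(1)[OF inf B] le ev, of c]
    by (simp add: H2_norm_eq cG cB c_def F_def Fi_def)
qed

text \<open>Deleting a first letter lowers the degree, and the right-hand side of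
  \<open>A_Cons_split\<close> reproduces the orthogonal splitting of the norm of a, so the constant
  1 is preserved at each step.\<close>

lemma A_polynomial:
  assumes "\<And>\<alpha>. length \<alpha> \<ge> d \<Longrightarrow> a \<alpha> = 0"
  shows "H2_norm (A (free_series a)) \<le> l2norm a"
  using assms
proof (induction d arbitrary: a)
  case 0
  then have a: "a = (\<lambda>\<alpha>. 0)"
    by auto
  \<comment> \<open>In degree 0 only the zero function is left; boundedness shows that its image has
    norm 0.\<close>
  obtain K where "\<And>f. f \<in> H2_ball \<Longrightarrow> H2_norm (A f) \<le> K * H2_norm f"
    using A_bounded unfolding H2_bounded_def by blast
  from this[OF free_series_H2(1)[OF inf square_summable_zero]] show ?case
    unfolding a free_series_H2(2)[OF inf square_summable_zero] by simp
next
  case (Suc d)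
  have a: "square_summable a"
    by (rule finite_support_square_summable, rule finite_subset[OF _ finite_words_less[of "Suc d"]])
      (use Suc.prems in \<open>force simp: not_less\<close>)
  have "(H2_norm (A (free_series a)))\<^sup>2
      \<le> (cmod (a []))\<^sup>2 + (\<Sum>i\<in>UNIV. (H2_norm (A (free_series (\<lambda>\<alpha>. a (i # \<alpha>)))))\<^sup>2)"
    by (rule A_Cons_split[OF a])
  also have "\<dots> \<le> (cmod (a []))\<^sup>2 + (\<Sum>i\<in>UNIV. (l2norm (\<lambda>\<alpha>. a (i # \<alpha>)))\<^sup>2)"
    by (intro add_left_mono sum_mono power_mono Suc.IH) (auto simp: Suc.prems H2_norm_eq)
  also have "\<dots> = (l2norm a)\<^sup>2"
    by (rule l2norm_Cons_split(2)[OF a, symmetric])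
  finally show ?case
    by (rule power2_le_imp_le) simp
qed

text \<open>Polynomials are dense and \<open>A\<close> is already known to be bounded, so the bound
  with constant 1 extends from polynomials.\<close>

lemma A_contraction:
  assumes f: "f \<in> H2_ball"
  shows "H2_norm (A f) \<le> H2_norm f"
proof (rule field_le_epsilon)
  fix \<epsilon> :: real assume \<epsilon>: "\<epsilon> > 0"
  obtain K where K: "\<And>f. f \<in> H2_ball \<Longrightarrow> H2_norm (A f) \<le> K * H2_norm f"
    using A_bounded unfolding H2_bounded_def by blast
  note f2 = H2_coeff(1)[OF inf f]
  let ?a = "free_coeff f"
  \<comment> \<open>The denominator |K| + 1 dominates \<open>K\<close> and is positive whatever the
    sign of \<open>K\<close>.\<close>
  obtain d where d: "l2norm (\<lambda>\<alpha>. if length \<alpha> < d then 0 else ?a \<alpha>) < \<epsilon> / (\<bar>K\<bar> + 1)"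
    using l2norm_tail[OF f2 divide_pos_pos[OF \<epsilon> add_nonneg_pos[OF abs_ge_zero zero_less_one]]] by blast
  let ?h = "\<lambda>\<alpha>. if length \<alpha> < d then ?a \<alpha> else 0"
  let ?t = "\<lambda>\<alpha>. if length \<alpha> < d then 0 else ?a \<alpha>"
  have h: "square_summable ?h" "l2norm ?h \<le> l2norm ?a" and t: "square_summable ?t"
    by (rule l2norm_mono[OF f2], simp)+
  have H: "free_series ?h \<in> (H2_ball :: ('n, 'h) free_fun set)"
    and S: "free_series ?t \<in> (H2_ball :: ('n, 'h) free_fun set)"
    by (rule free_series_H2(1)[OF inf h(1)], rule free_series_H2(1)[OF inf t])
  have "f = free_series (\<lambda>\<alpha>. ?h \<alpha> + ?t \<alpha>)"
    by (subst H2_coeff(2)[OF inf f], rule arg_cong[of _ _ free_series]) auto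
  also have "\<dots> = (\<lambda>X. free_series ?h X + free_series ?t X)"
    by (rule ext) (rule free_series_add[OF h(1) t])
  finally have feq: "f = (\<lambda>X. free_series ?h X + free_series ?t X)" .
  have "A (\<lambda>X. free_series ?h X + free_series ?t X) = (\<lambda>X. A (free_series ?h) X + A (free_series ?t) X)"
    using A_bounded H S by (simp add: H2_bounded_def H2_linear_def)
  with feq have "A f = (\<lambda>X. A (free_series ?h) X + A (free_series ?t) X)"
    by simp
  then have "H2_norm (A f) \<le> H2_norm (A (free_series ?h)) + H2_norm (A (free_series ?t))"
    using square_summable_add(2)[OF H2_coeff(1)[OF inf A_H2[OF H]] H2_coeff(1)[OF inf A_H2[OF S]]]
    by (simp add: H2_norm_eq H2_add(2)[OF inf A_H2[OF H] A_H2[OF S]])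
  also have "H2_norm (A (free_series ?h)) \<le> l2norm ?h"
    by (rule A_polynomial[of d]) simp
  also have "H2_norm (A (free_series ?t)) \<le> \<epsilon>"
  proof -
    have "H2_norm (A (free_series ?t)) \<le> K * l2norm ?t"
      using K[OF S] unfolding free_series_H2(2)[OF inf t] .
    also have "\<dots> \<le> (\<bar>K\<bar> + 1) * l2norm ?t"
      by (intro mult_right_mono) auto
    also have "\<dots> \<le> (\<bar>K\<bar> + 1) * (\<epsilon> / (\<bar>K\<bar> + 1))"
      using d by (intro mult_left_mono) auto
    also have "\<dots> = \<epsilon>"
      by simp
    finally show ?thesis .
  qed
  finally show "H2_norm (A f) \<le> H2_norm f + \<epsilon>"
    using h(2) by (simp add: H2_norm_eq)
qed

lemma V_bij: "bij_betw V H2_ball H2_ball"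
  by (rule bij_betw_byWitness[where f' = W]) (auto simp: V_W W_V V_H2 W_H2)

lemma inv_V: "f \<in> H2_ball \<Longrightarrow> inv_into H2_ball V f = W f"
  by (rule inv_into_f_eq) (auto simp: V_W W_H2 bij_betw_imp_inj_on[OF V_bij])

lemma similar_to_contraction:
  "\<exists>V A. H2_invertible V \<and> H2_bounded A \<and> H2_onorm A \<le> 1 \<and>
     (\<forall>f\<in>H2_ball. T f = inv_into H2_ball V (A (V f)))"
proof (intro exI conjI ballI)
  have "H2_bounded (inv_into H2_ball V)"
    by (rule H2_bounded_cong[OF inf W_bounded inv_V])
  then show "H2_invertible V"
    by (simp add: H2_invertible_def V_bounded V_bij)
  show "H2_bounded A"
    by (rule A_bounded)
  show "H2_onorm A \<le> 1"
    unfolding H2_onorm_def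
  proof (rule cSUP_least)
    show "{f \<in> (H2_ball :: ('n, 'h) free_fun set). H2_norm f \<le> 1} \<noteq> {}"
      using zero_H2 by (metis (mono_tags, lifting) empty_iff mem_Collect_eq zero_le_one)
  qed (use A_contraction order_trans in blast)
  show "T f = inv_into H2_ball V (A (V f))" if f: "f \<in> H2_ball" for f
    unfolding inv_V[OF A_H2[OF V_H2[OF f]]] unfolding A_def W_V[OF f] W_V[OF T_H2[OF f]] ..
qed

end

theorem corollary5p8:
  fixes \<phi> :: "('n::finite \<Rightarrow> 'h::complex_hilbert_space op) \<Rightarrow> ('n \<Rightarrow> 'h op)"
  assumes "separable_inf_dim TYPE('h)"
    and "free_self_map \<phi>"
    and "H2_compact (comp_op \<phi>)"
  shows "\<exists>V A. H2_invertible V \<and> H2_bounded A \<and> H2_onorm A \<le> 1 \<and>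
           (\<forall>f\<in>H2_ball. comp_op \<phi> f = inv_into H2_ball V (A (V f)))"
proof -
  interpret compact_composition \<phi>
    using assms by unfold_locales (auto simp: free_self_map_def)
  obtain \<xi> where "(\<Sum>i\<in>UNIV. (cmod (\<xi> i))\<^sup>2) < 1" "\<phi> (scalar_point \<xi>) = scalar_point \<xi>"
    using scalar_fixed_point by blast
  then interpret fixed_composition \<phi> \<xi>
    by unfold_locales
  show ?thesis
    by (rule similar_to_contraction)
qed

end
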